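(* The interpolant existence problem for $\mathsf{wK4}$ is decidable in \textsc{coN3ExpTime}.
   Context: $\mathsf{wK4}$ (weak $\mathsf{K4}$) is the normal modal logic $\mathsf{K}\oplus\Diamond\Diamond p\to(p\lor\Diamond p)$, characterised by weakly transitive Kripke frames ($xRyRz$ implies $x=z$ or $xRz$). An interpolant for $\varphi\to\psi$ in $\mathsf{wK4}$ is a formula $\iota$ all of whose variables occur in both $\varphi$ and $\psi$ (built from $\top,\bot$ if there are no common variables) such that $\varphi\to\iota$ and $\iota\to\psi$ belong to $\mathsf{wK4}$. The interpolant existence problem: given formulas $\varphi,\psi$, decide whether $\varphi\to\psi$ has an interpolant in $\mathsf{wK4}$. \textsc{coN3ExpTime} is the class of complements of problems solvable by a nondeterministic Turing machine in triple-exponential time. *)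

theory Defs
  imports Main
begin

section \<open>Modal formulas and wK4\<close>

datatype fm =
    Var nat
  | Bot
  | And fm fm
  | Or fm fm
  | Imp fm fm
  | Box fm

text \<open>With diamond primitive and box the abbreviation, the axioms below would also have to
  include the duality of the two modalities.\<close>

definition Neg :: "fm \<Rightarrow> fm" where
  "Neg \<phi> = Imp \<phi> Bot"

definition Dia :: "fm \<Rightarrow> fm" where
  "Dia \<phi> = Neg (Box (Neg \<phi>))"

primrec vars :: "fm \<Rightarrow> nat set" where
  "vars (Var n) = {n}"
| "vars Bot = {}"
| "vars (And \<phi> \<psi>) = vars \<phi> \<union> vars \<psi>"
| "vars (Or \<phi> \<psi>) = vars \<phi> \<union> vars \<psi>"
| "vars (Imp \<phi> \<psi>) = vars \<phi> \<union> vars \<psi>"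
| "vars (Box \<phi>) = vars \<phi>"

primrec subst :: "(nat \<Rightarrow> fm) \<Rightarrow> fm \<Rightarrow> fm" where
  "subst s (Var n) = s n"
| "subst s Bot = Bot"
| "subst s (And \<phi> \<psi>) = And (subst s \<phi>) (subst s \<psi>)"
| "subst s (Or \<phi> \<psi>) = Or (subst s \<phi>) (subst s \<psi>)"
| "subst s (Imp \<phi> \<psi>) = Imp (subst s \<phi>) (subst s \<psi>)"
| "subst s (Box \<phi>) = Box (subst s \<phi>)"

text \<open>Boolean evaluation in which variables and boxed formulas are atoms, so that
  \<open>tautology\<close> describes the modal instances of classical tautologies.\<close>

primrec bool_eval :: "(fm \<Rightarrow> bool) \<Rightarrow> fm \<Rightarrow> bool" where
  "bool_eval v (Var n) \<longleftrightarrow> v (Var n)"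
| "bool_eval v Bot \<longleftrightarrow> False"
| "bool_eval v (And \<phi> \<psi>) \<longleftrightarrow> bool_eval v \<phi> \<and> bool_eval v \<psi>"
| "bool_eval v (Or \<phi> \<psi>) \<longleftrightarrow> bool_eval v \<phi> \<or> bool_eval v \<psi>"
| "bool_eval v (Imp \<phi> \<psi>) \<longleftrightarrow> (bool_eval v \<phi> \<longrightarrow> bool_eval v \<psi>)"
| "bool_eval v (Box \<phi>) \<longleftrightarrow> v (Box \<phi>)"

definition tautology :: "fm \<Rightarrow> bool" where
  "tautology \<phi> \<longleftrightarrow> (\<forall>v. bool_eval v \<phi>)"

text \<open>\<open>K_plus \<Gamma>\<close> is the least normal modal logic containing \<open>\<Gamma>\<close>.\<close>

inductive_set K_plus :: "fm set \<Rightarrow> fm set" for \<Gamma> :: "fm set" where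
  ax: "\<phi> \<in> \<Gamma> \<Longrightarrow> \<phi> \<in> K_plus \<Gamma>"
| taut: "tautology \<phi> \<Longrightarrow> \<phi> \<in> K_plus \<Gamma>"
| K: "Imp (Box (Imp (Var 0) (Var 1))) (Imp (Box (Var 0)) (Box (Var 1))) \<in> K_plus \<Gamma>"
| mp: "\<lbrakk>Imp \<phi> \<psi> \<in> K_plus \<Gamma>; \<phi> \<in> K_plus \<Gamma>\<rbrakk> \<Longrightarrow> \<psi> \<in> K_plus \<Gamma>"
| nec: "\<phi> \<in> K_plus \<Gamma> \<Longrightarrow> Box \<phi> \<in> K_plus \<Gamma>"
| sub: "\<phi> \<in> K_plus \<Gamma> \<Longrightarrow> subst s \<phi> \<in> K_plus \<Gamma>"

definition wK4 :: "fm set" where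
  "wK4 = K_plus {Imp (Dia (Dia (Var 0))) (Or (Var 0) (Dia (Var 0)))}"

definition is_interpolant :: "fm \<Rightarrow> fm \<Rightarrow> fm \<Rightarrow> bool" where
  "is_interpolant \<iota> \<phi> \<psi> \<longleftrightarrow>
     vars \<iota> \<subseteq> vars \<phi> \<inter> vars \<psi> \<and> Imp \<phi> \<iota> \<in> wK4 \<and> Imp \<iota> \<psi> \<in> wK4"


section \<open>The problem as a language\<close>

text \<open>Variable indices are written in binary, least significant digit first; each digit is
  preceded by \<open>True\<close> and the end of the numeral is marked by \<open>False\<close>.\<close>

fun enc_nat :: "nat \<Rightarrow> bool list" where
  "enc_nat n = (if n = 0 then [False] else True # odd n # enc_nat (n div 2))"

primrec enc :: "fm \<Rightarrow> bool list" where
  "enc (Var n) = [False, False, False] @ enc_nat n"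
| "enc Bot = [False, False, True]"
| "enc (And \<phi> \<psi>) = [False, True, False] @ enc \<phi> @ enc \<psi>"
| "enc (Or \<phi> \<psi>) = [False, True, True] @ enc \<phi> @ enc \<psi>"
| "enc (Imp \<phi> \<psi>) = [True, False, False] @ enc \<phi> @ enc \<psi>"
| "enc (Box \<phi>) = [True, False, True] @ enc \<phi>"

declare enc_nat.simps [simp del]

lemma enc_nat_prefix_free: "enc_nat m @ u = enc_nat n @ v \<Longrightarrow> m = n \<and> u = v"
proof (induction m arbitrary: n rule: less_induct)
  case (less m)
  show ?case
  proof (cases "m = 0 \<or> n = 0")
    case True
    then show ?thesis
      using less.prems by (auto simp: enc_nat.simps[of m] enc_nat.simps[of n] split: if_splits)
  next
    case False
    then have "odd m = odd n" and "enc_nat (m div 2) @ u = enc_nat (n div 2) @ v"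
      using less.prems by (simp_all add: enc_nat.simps[of m] enc_nat.simps[of n])
    moreover have "m div 2 < m"
      using False by simp
    ultimately have "m div 2 = n div 2" "u = v"
      using less.IH by blast+
    with \<open>odd m = odd n\<close> show ?thesis
      by (metis bit_eq_rec)
  qed
qed

lemma enc_prefix_free: "enc \<phi> @ u = enc \<psi> @ v \<Longrightarrow> \<phi> = \<psi> \<and> u = v"
proof (induction \<phi> arbitrary: \<psi> u v)
  case (Var n)
  then show ?case by (cases \<psi>) (auto dest: enc_nat_prefix_free)
next
  case Bot
  then show ?case by (cases \<psi>) auto
next
  case (And \<phi>1 \<phi>2)
  from And.prems show ?case by (cases \<psi>) (auto dest!: And.IH)
next
  case (Or \<phi>1 \<phi>2)
  from Or.prems show ?case by (cases \<psi>) (auto dest!: Or.IH)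
next
  case (Imp \<phi>1 \<phi>2)
  from Imp.prems show ?case by (cases \<psi>) (auto dest!: Imp.IH)
next
  case (Box \<phi>)
  from Box.prems show ?case by (cases \<psi>) (auto dest!: Box.IH)
qed

text \<open>Hence a word encodes at most one pair of formulas.\<close>

lemma enc_pair_inject: "enc \<phi> @ enc \<psi> = enc \<phi>' @ enc \<psi>' \<longleftrightarrow> \<phi> = \<phi>' \<and> \<psi> = \<psi>'"
  by (metis append_Nil2 enc_prefix_free)

definition interpolant_existence :: "bool list set" where
  "interpolant_existence = {enc \<phi> @ enc \<psi> | \<phi> \<psi>. \<exists>\<iota>. is_interpolant \<iota> \<phi> \<psi>}"


section \<open>Nondeterministic multi-tape Turing machines\<close>

text \<open>States are the numbers below \<open>n_states\<close>, tape symbols the numbers below \<open>n_symbols\<close>,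
  where \<open>0\<close> is the blank and \<open>1\<close>, \<open>2\<close> are the input symbols. An element \<open>(q, xs, q', as)\<close> of
  \<open>delta\<close> allows a machine in state \<open>q\<close> that reads \<open>xs\<close> to enter \<open>q'\<close> and, on the \<open>i\<close>-th tape,
  to write the symbol \<open>fst (as ! i)\<close> and move the head by \<open>snd (as ! i)\<close>.\<close>

record ntm =
  n_tapes :: nat
  n_states :: nat
  n_symbols :: nat
  start :: nat
  accept :: nat
  delta :: "(nat \<times> nat list \<times> nat \<times> (nat \<times> int) list) set"

definition wf_ntm :: "ntm \<Rightarrow> bool" where
  "wf_ntm M \<longleftrightarrow>
     n_tapes M \<ge> 1 \<and> n_symbols M \<ge> 3 \<and> start M < n_states M \<and> accept M < n_states M \<and>
     (\<forall>(q, xs, q', as) \<in> delta M.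
        q < n_states M \<and> q' < n_states M \<and>
        length xs = n_tapes M \<and> length as = n_tapes M \<and>
        set xs \<subseteq> {..<n_symbols M} \<and> set as \<subseteq> {..<n_symbols M} \<times> {-1, 0, 1})"

text \<open>A tape is infinite in both directions and given by the head position and its contents.\<close>

type_synonym tape = "int \<times> (int \<Rightarrow> nat)"
type_synonym config = "nat \<times> tape list"

definition read_tape :: "tape \<Rightarrow> nat" where
  "read_tape t = snd t (fst t)"

definition act :: "tape \<Rightarrow> nat \<times> int \<Rightarrow> tape" where
  "act t a = (fst t + snd a, (snd t)(fst t := fst a))"

inductive step :: "ntm \<Rightarrow> config \<Rightarrow> config \<Rightarrow> bool" for M :: ntm where
  "(q, map read_tape ts, q', as) \<in> delta M \<Longrightarrow> step M (q, ts) (q', map2 act ts as)"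

definition blank_tape :: tape where
  "blank_tape = (0, \<lambda>_. 0)"

definition input_tape :: "bool list \<Rightarrow> tape" where
  "input_tape w =
     (0, \<lambda>i. if 0 \<le> i \<and> i < int (length w) then if w ! nat i then 2 else 1 else 0)"

definition init :: "ntm \<Rightarrow> bool list \<Rightarrow> config" where
  "init M w = (start M, input_tape w # replicate (n_tapes M - 1) blank_tape)"

text \<open>The time bound applies to all computations, accepting or not, so that in particular every
  computation is finite.\<close>

definition decides_in_time :: "ntm \<Rightarrow> bool list set \<Rightarrow> (nat \<Rightarrow> nat) \<Rightarrow> bool" where
  "decides_in_time M L T \<longleftrightarrow>
     (\<forall>w. (\<forall>n c. (step M ^^ n) (init M w) c \<longrightarrow> n \<le> T (length w)) \<and>
          (w \<in> L \<longleftrightarrow> (\<exists>c. (step M)\<^sup>*\<^sup>* (init M w) c \<and> fst c = accept M)))"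

definition NTIME :: "(nat \<Rightarrow> nat) \<Rightarrow> bool list set set" where
  "NTIME T = {L. \<exists>M k. wf_ntm M \<and> decides_in_time M L (\<lambda>n. k * T n)}"

definition N3ExpTime :: "bool list set set" where
  "N3ExpTime = (\<Union>d. NTIME (\<lambda>n. 2 ^ (2 ^ (2 ^ (n ^ d)))))"

definition coN3ExpTime :: "bool list set set" where
  "coN3ExpTime = {L. - L \<in> N3ExpTime}"

end

theory Submission
  imports Defs
begin

text \<open>If \<open>\<phi> \<rightarrow> \<psi>\<close> has no interpolant, then the canonical model has a point satisfying \<open>\<phi>\<close> and
  a point refuting \<open>\<psi>\<close> with the same theory in the common variables, and having the same such
  theory is a bisimulation. The model is filtrated to a model of at most triple exponential size
  so that this bisimulation survives: a point is represented by its type, the types of the points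
  bisimilar to it, and data on its cluster both in the model and in the quotient modulo
  bisimilarity. The data on the clusters are needed because a point satisfying \<open>\<box>\<chi>\<close> and \<open>\<not>\<chi>\<close>
  must remain the only one of its kind in its cluster.

  A nondeterministic machine computes \<open>2 ^ 2 ^ 2 ^ n\<close> in unary, guesses such a model together with
  relations describing the syntax of the input, and checks by exhaustive search a first-order
  sentence expressing that the guess is right.\<close>

section \<open>Weakly transitive Kripke models\<close>

text \<open>A cluster of a weakly transitive frame may contain irreflexive points. If points with
  equal data were merged carelessly, such a point would come to see itself, which falsifies a box;
  one level up, in the quotient modulo bisimilarity, the same accident destroys the back-and-forth
  property. Irreflexivity therefore has to be readable from the data on both levels, and the order
  of the finite model compares nothing but data.

  Over s formulas there are 2^s types, hence doubly exponentially many mosaics and triply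
  exponentially many sets of mosaics; this is the origin of the third exponential. The machine
  accepts the complement because its certificate, a model, witnesses that there is no interpolant.

  The sentence is fixed, so its evaluation is polynomial in the size of the range, and a polynomial
  only shifts the topmost exponent. The parse is guessed with the model rather than computed: each
  syntactic relation is the only solution of a recursion equation along the word, so first-order
  conditions pin it down.\<close>

primrec sem :: "('w \<Rightarrow> 'w \<Rightarrow> bool) \<Rightarrow> ('w \<Rightarrow> nat \<Rightarrow> bool) \<Rightarrow> 'w \<Rightarrow> fm \<Rightarrow> bool" where
  "sem R V x (Var n) \<longleftrightarrow> V x n"
| "sem R V x Bot \<longleftrightarrow> False"
| "sem R V x (And \<phi> \<psi>) \<longleftrightarrow> sem R V x \<phi> \<and> sem R V x \<psi>"
| "sem R V x (Or \<phi> \<psi>) \<longleftrightarrow> sem R V x \<phi> \<or> sem R V x \<psi>"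
| "sem R V x (Imp \<phi> \<psi>) \<longleftrightarrow> (sem R V x \<phi> \<longrightarrow> sem R V x \<psi>)"
| "sem R V x (Box \<phi>) \<longleftrightarrow> (\<forall>y. R x y \<longrightarrow> sem R V y \<phi>)"

definition wtrans :: "('w \<Rightarrow> 'w \<Rightarrow> bool) \<Rightarrow> bool" where
  "wtrans R \<longleftrightarrow> (\<forall>x y z. R x y \<longrightarrow> R y z \<longrightarrow> x = z \<or> R x z)"

definition bisim :: "nat set \<Rightarrow> ('w \<Rightarrow> 'w \<Rightarrow> bool) \<Rightarrow> ('w \<Rightarrow> nat \<Rightarrow> bool) \<Rightarrow> ('w \<Rightarrow> 'w \<Rightarrow> bool) \<Rightarrow> bool" where
  "bisim \<sigma> R V Z \<longleftrightarrow> (\<forall>x y. Z x y \<longrightarrow>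
     (\<forall>n\<in>\<sigma>. V x n = V y n) \<and>
     (\<forall>x'. R x x' \<longrightarrow> (\<exists>y'. R y y' \<and> Z x' y')) \<and>
     (\<forall>y'. R y y' \<longrightarrow> (\<exists>x'. R x x' \<and> Z x' y')))"

lemma sem_subst: "sem R V x (subst s \<phi>) \<longleftrightarrow> sem R (\<lambda>x n. sem R V x (s n)) x \<phi>"
  by (induction \<phi> arbitrary: x) auto

lemma sem_bool_eval: "bool_eval (sem R V x) \<phi> \<longleftrightarrow> sem R V x \<phi>"
  by (induction \<phi>) auto

lemma wK4_sound:
  assumes "\<phi> \<in> wK4" and "wtrans R"
  shows "sem R V x \<phi>"
  using assms(1) unfolding wK4_def
proof (induction arbitrary: V x)
  case (ax \<phi>)
  then show ?case
    using assms(2) by (auto simp: Dia_def Neg_def wtrans_def)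
next
  case (taut \<phi>)
  then show ?case
    by (metis sem_bool_eval tautology_def)
next
  case (sub \<phi> s)
  then show ?case by (simp add: sem_subst)
qed auto

lemma bisim_sem:
  assumes "bisim \<sigma> R V Z" and "vars \<chi> \<subseteq> \<sigma>" and "Z x y"
  shows "sem R V x \<chi> \<longleftrightarrow> sem R V y \<chi>"
  using assms(2,3)
proof (induction \<chi> arbitrary: x y)
  case (Var n)
  then show ?case using assms(1) by (auto simp: bisim_def)
next
  case (Box \<chi>)
  have IH: "sem R V x' \<chi> = sem R V y' \<chi>" if "Z x' y'" for x' y'
    using Box.IH Box.prems(1) that by simp
  have "\<forall>x'. R x x' \<longrightarrow> (\<exists>y'. R y y' \<and> Z x' y')" "\<forall>y'. R y y' \<longrightarrow> (\<exists>x'. R x x' \<and> Z x' y')"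
    using assms(1) Box.prems(2) unfolding bisim_def by blast+
  then show ?case
    unfolding sem.simps using IH by blast
qed auto

lemma bisim_no_interpolant:
  assumes "wtrans R" "bisim (vars \<phi> \<inter> vars \<psi>) R V Z" "Z x y" "sem R V x \<phi>" "\<not> sem R V y \<psi>"
  shows "\<not> is_interpolant \<iota> \<phi> \<psi>"
proof
  assume i: "is_interpolant \<iota> \<phi> \<psi>"
  then have "sem R V x (Imp \<phi> \<iota>)" "sem R V y (Imp \<iota> \<psi>)"
    using wK4_sound[OF _ assms(1)] i unfolding is_interpolant_def by blast+
  moreover have "sem R V x \<iota> \<longleftrightarrow> sem R V y \<iota>"
    using bisim_sem[OF assms(2) _ assms(3)] i unfolding is_interpolant_def by blast
  ultimately show False using assms(4,5) by simp
qed

section \<open>The canonical model\<close>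

primrec conj :: "fm list \<Rightarrow> fm" where
  "conj [] = Imp Bot Bot"
| "conj (\<phi> # l) = And \<phi> (conj l)"

lemma bool_eval_conj [simp]: "bool_eval v (conj l) \<longleftrightarrow> (\<forall>\<phi>\<in>set l. bool_eval v \<phi>)"
  by (induction l) auto

lemma bool_eval_Neg [simp]: "bool_eval v (Neg \<phi>) \<longleftrightarrow> \<not> bool_eval v \<phi>"
  by (simp add: Neg_def)

lemma vars_conj: "vars (conj l) = (\<Union>\<phi>\<in>set l. vars \<phi>)"
  by (induction l) auto

section \<open>Derived rules and theorems of wK4\<close>

lemma wK4_mp: "\<lbrakk>Imp \<phi> \<psi> \<in> wK4; \<phi> \<in> wK4\<rbrakk> \<Longrightarrow> \<psi> \<in> wK4"
  unfolding wK4_def by (rule K_plus.mp)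

lemma wK4_taut: "(\<And>v. bool_eval v \<phi>) \<Longrightarrow> \<phi> \<in> wK4"
  unfolding wK4_def by (rule K_plus.taut) (simp add: tautology_def)

text \<open>Iterated modus ponens. It reduces every propositional step inside \<open>wK4\<close> to
  a check of Boolean valuations, with the modal premises collected in \<open>l\<close>.\<close>

lemma wK4_prop:
  assumes "set l \<subseteq> wK4" and "\<And>v. \<forall>\<chi>\<in>set l. bool_eval v \<chi> \<Longrightarrow> bool_eval v \<psi>"
  shows "\<psi> \<in> wK4"
  using assms
proof (induction l arbitrary: \<psi>)
  case Nil
  then show ?case by (simp add: wK4_taut)
next
  case (Cons \<chi> l)
  then have "Imp \<chi> \<psi> \<in> wK4" by auto
  then show ?case using Cons.prems(1) wK4_mp by auto
qed

lemma wK4_K: "Imp (Box (Imp \<phi> \<psi>)) (Imp (Box \<phi>) (Box \<psi>)) \<in> wK4"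
proof -
  have "subst (\<lambda>n. if n = 0 then \<phi> else \<psi>)
      (Imp (Box (Imp (Var 0) (Var 1))) (Imp (Box (Var 0)) (Box (Var 1)))) \<in> wK4"
    unfolding wK4_def by (rule K_plus.sub, rule K_plus.K)
  then show ?thesis by simp
qed

lemma wK4_nec: "\<phi> \<in> wK4 \<Longrightarrow> Box \<phi> \<in> wK4"
  unfolding wK4_def by (rule K_plus.nec)

lemma wK4_Box_mono: "Imp \<phi> \<psi> \<in> wK4 \<Longrightarrow> Imp (Box \<phi>) (Box \<psi>) \<in> wK4"
  using wK4_K wK4_mp wK4_nec by blast

lemma wK4_Box_conj: "Imp (conj (map Box l)) (Box (conj l)) \<in> wK4"
proof (induction l)
  case Nil
  have "Box (conj []) \<in> wK4" by (rule wK4_nec, rule wK4_taut) simp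
  then show ?case by (intro wK4_prop[of "[Box (conj [])]"]) auto
next
  case (Cons \<phi> l)
  have "Imp (Box \<phi>) (Box (Imp (conj l) (conj (\<phi> # l)))) \<in> wK4"
    by (rule wK4_Box_mono, rule wK4_taut) simp
  then show ?case
    using Cons wK4_K[of "conj l" "conj (\<phi> # l)"]
    by (intro wK4_prop[of "[Imp (Box \<phi>) (Box (Imp (conj l) (conj (\<phi> # l)))),
          Imp (conj (map Box l)) (Box (conj l)),
          Imp (Box (Imp (conj l) (conj (\<phi> # l)))) (Imp (Box (conj l)) (Box (conj (\<phi> # l))))]"]) auto
qed

text \<open>This is the axiom at \<open>Neg \<phi>\<close> read contrapositively. Since
  \<open>Dia\<close> is an abbreviation, double negations remain under boxes, and
  \<open>wK4_Box_mono\<close> removes them.\<close>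

lemma wK4_axiom: "Imp (And \<phi> (Box \<phi>)) (Box (Box \<phi>)) \<in> wK4"
proof -
  let ?n = "Neg \<phi>"
  have "subst (\<lambda>_. ?n) (Imp (Dia (Dia (Var 0))) (Or (Var 0) (Dia (Var 0)))) \<in> wK4"
    unfolding wK4_def by (rule K_plus.sub, rule K_plus.ax) simp
  then have 1: "Imp (Dia (Dia ?n)) (Or ?n (Dia ?n)) \<in> wK4"
    by (simp add: Dia_def Neg_def)
  have 2: "Imp (Box \<phi>) (Box (Neg ?n)) \<in> wK4"
    by (rule wK4_Box_mono, rule wK4_taut) simp
  have "Imp (Box (Neg ?n)) (Box \<phi>) \<in> wK4"
    by (rule wK4_Box_mono, rule wK4_taut) simp
  then have "Imp (Neg (Dia ?n)) (Box \<phi>) \<in> wK4"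
    by (intro wK4_prop[of "[Imp (Box (Neg ?n)) (Box \<phi>)]"]) (auto simp: Dia_def)
  then have 3: "Imp (Box (Neg (Dia ?n))) (Box (Box \<phi>)) \<in> wK4"
    by (rule wK4_Box_mono)
  show ?thesis
    using 1 2 3
    by (intro wK4_prop[of "[Imp (Dia (Dia ?n)) (Or ?n (Dia ?n)), Imp (Box \<phi>) (Box (Neg ?n)),
          Imp (Box (Neg (Dia ?n))) (Box (Box \<phi>))]"]) (auto simp: Dia_def)
qed

section \<open>Maximal consistent sets\<close>

definition consistent :: "fm set \<Rightarrow> bool" where
  "consistent \<Gamma> \<longleftrightarrow> (\<forall>l. set l \<subseteq> \<Gamma> \<longrightarrow> Neg (conj l) \<notin> wK4)"

definition mcs :: "fm set \<Rightarrow> bool" where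
  "mcs \<Gamma> \<longleftrightarrow> consistent \<Gamma> \<and> (\<forall>\<chi>. \<chi> \<in> \<Gamma> \<or> Neg \<chi> \<in> \<Gamma>)"

lemma consistent_extend:
  assumes "consistent \<Gamma>"
  shows "consistent (insert \<chi> \<Gamma>) \<or> consistent (insert (Neg \<chi>) \<Gamma>)"
proof (rule ccontr)
  assume "\<not> ?thesis"
  then obtain l k where l: "set l \<subseteq> insert \<chi> \<Gamma>" "Neg (conj l) \<in> wK4"
    and k: "set k \<subseteq> insert (Neg \<chi>) \<Gamma>" "Neg (conj k) \<in> wK4"
    unfolding consistent_def by blast
  \<comment> \<open>The members of the two refuted lists that lie in \<open>\<Gamma>\<close> cannot
    hold together, whichever value \<open>\<chi>\<close> takes.\<close>
  let ?j = "filter (\<lambda>\<phi>. \<phi> \<in> \<Gamma>) (l @ k)"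
  have "Neg (conj ?j) \<in> wK4"
  proof (rule wK4_prop[of "[Neg (conj l), Neg (conj k)]"])
    fix v assume "\<forall>\<phi>\<in>set [Neg (conj l), Neg (conj k)]. bool_eval v \<phi>"
    then have "bool_eval v (Neg (conj l))" "bool_eval v (Neg (conj k))" by simp_all
    then obtain a b where "a \<in> set l" "\<not> bool_eval v a" "b \<in> set k" "\<not> bool_eval v b" by auto
    then show "bool_eval v (Neg (conj ?j))"
      using l(1) k(1) by (cases "bool_eval v \<chi>") auto
  qed (use l k in auto)
  moreover have "set ?j \<subseteq> \<Gamma>" by auto
  ultimately show False using assms unfolding consistent_def by blast
qed

lemma lindenbaum:
  assumes "consistent \<Gamma>"
  shows "\<exists>\<Delta>. \<Gamma> \<subseteq> \<Delta> \<and> mcs \<Delta>"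
proof -
  let ?A = "{\<Delta>. \<Gamma> \<subseteq> \<Delta> \<and> consistent \<Delta>}"
  have "\<exists>M\<in>?A. \<forall>X\<in>?A. M \<subseteq> X \<longrightarrow> X = M"
  proof (rule subset_Zorn_nonempty)
    fix C assume C: "C \<noteq> {}" "subset.chain ?A C"
    have "consistent (\<Union>C)"
      unfolding consistent_def
    proof (intro allI impI)
      fix l assume "set l \<subseteq> \<Union>C"
      then obtain X where "X \<in> C" "set l \<subseteq> X"
        using finite_subset_Union_chain[of "set l" C ?A] C by auto
      then show "Neg (conj l) \<notin> wK4"
        using C(2) unfolding subset.chain_def consistent_def by blast
    qed
    moreover have "\<Gamma> \<subseteq> \<Union>C"
      using C unfolding subset.chain_def by blast
    ultimately show "\<Union>C \<in> ?A" by simp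
  qed (use assms in auto)
  then obtain \<Delta> where \<Delta>: "\<Gamma> \<subseteq> \<Delta>" "consistent \<Delta>"
    and max: "\<And>X. \<lbrakk>\<Gamma> \<subseteq> X; consistent X; \<Delta> \<subseteq> X\<rbrakk> \<Longrightarrow> X = \<Delta>" by auto
  have "\<chi> \<in> \<Delta> \<or> Neg \<chi> \<in> \<Delta>" for \<chi>
    using consistent_extend[OF \<Delta>(2), of \<chi>] max \<Delta>(1) by blast
  then show ?thesis using \<Delta> unfolding mcs_def by blast
qed

lemma mcs_closed:
  assumes "mcs \<Gamma>" "set l \<subseteq> \<Gamma>" "Imp (conj l) \<chi> \<in> wK4"
  shows "\<chi> \<in> \<Gamma>"
proof (rule ccontr)
  assume "\<chi> \<notin> \<Gamma>"
  then have "Neg \<chi> \<in> \<Gamma>" using assms(1) unfolding mcs_def by blast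
  moreover have "Neg (conj (Neg \<chi> # l)) \<in> wK4"
    by (rule wK4_prop[of "[Imp (conj l) \<chi>]"]) (use assms(3) in auto)
  ultimately show False
    using assms(1,2) unfolding mcs_def consistent_def
    by (metis insert_subset list.set(2))
qed

lemma mcs_prop:
  assumes "mcs \<Gamma>" "set l \<subseteq> \<Gamma>" "\<And>v. \<forall>\<chi>\<in>set l. bool_eval v \<chi> \<Longrightarrow> bool_eval v \<chi>"
  shows "\<chi> \<in> \<Gamma>"
  by (rule mcs_closed[OF assms(1,2)], rule wK4_taut) (use assms(3) in auto)

lemma mcs_wK4: "\<lbrakk>mcs \<Gamma>; Imp \<phi> \<chi> \<in> wK4; \<phi> \<in> \<Gamma>\<rbrakk> \<Longrightarrow> \<chi> \<in> \<Gamma>"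
  by (rule mcs_closed[of _ "[\<phi>]"], simp_all, rule wK4_prop[of "[Imp \<phi> \<chi>]"]) auto

lemma mcs_Neg: "mcs \<Gamma> \<Longrightarrow> Neg \<chi> \<in> \<Gamma> \<longleftrightarrow> \<chi> \<notin> \<Gamma>"
proof -
  assume m: "mcs \<Gamma>"
  have "\<not> (\<chi> \<in> \<Gamma> \<and> Neg \<chi> \<in> \<Gamma>)"
  proof
    assume "\<chi> \<in> \<Gamma> \<and> Neg \<chi> \<in> \<Gamma>"
    then have "set [\<chi>, Neg \<chi>] \<subseteq> \<Gamma>" by simp
    moreover have "Neg (conj [\<chi>, Neg \<chi>]) \<in> wK4" by (rule wK4_taut) simp
    ultimately show False using m unfolding mcs_def consistent_def by blast
  qed
  then show ?thesis using m unfolding mcs_def by blast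
qed

lemma mcs_simps:
  assumes "mcs \<Gamma>"
  shows "Bot \<notin> \<Gamma>"
    and "And \<phi> \<psi> \<in> \<Gamma> \<longleftrightarrow> \<phi> \<in> \<Gamma> \<and> \<psi> \<in> \<Gamma>"
    and "Or \<phi> \<psi> \<in> \<Gamma> \<longleftrightarrow> \<phi> \<in> \<Gamma> \<or> \<psi> \<in> \<Gamma>"
    and "Imp \<phi> \<psi> \<in> \<Gamma> \<longleftrightarrow> (\<phi> \<in> \<Gamma> \<longrightarrow> \<psi> \<in> \<Gamma>)"
proof -
  note N = mcs_Neg[OF assms] and p = mcs_prop[OF assms]
  have "Neg Bot \<in> \<Gamma>" by (rule p[of "[]"]) auto
  then show "Bot \<notin> \<Gamma>" using N[of Bot] by simp
  have "And \<phi> \<psi> \<in> \<Gamma> \<Longrightarrow> \<phi> \<in> \<Gamma>" by (rule p[of "[And \<phi> \<psi>]"]) auto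
  moreover have "And \<phi> \<psi> \<in> \<Gamma> \<Longrightarrow> \<psi> \<in> \<Gamma>" by (rule p[of "[And \<phi> \<psi>]"]) auto
  moreover have "\<phi> \<in> \<Gamma> \<Longrightarrow> \<psi> \<in> \<Gamma> \<Longrightarrow> And \<phi> \<psi> \<in> \<Gamma>" by (rule p[of "[\<phi>, \<psi>]"]) auto
  ultimately show "And \<phi> \<psi> \<in> \<Gamma> \<longleftrightarrow> \<phi> \<in> \<Gamma> \<and> \<psi> \<in> \<Gamma>" by blast
  have "\<phi> \<in> \<Gamma> \<Longrightarrow> Or \<phi> \<psi> \<in> \<Gamma>" by (rule p[of "[\<phi>]"]) auto
  moreover have "\<psi> \<in> \<Gamma> \<Longrightarrow> Or \<phi> \<psi> \<in> \<Gamma>" by (rule p[of "[\<psi>]"]) auto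
  moreover have "Or \<phi> \<psi> \<in> \<Gamma> \<Longrightarrow> Neg \<phi> \<in> \<Gamma> \<Longrightarrow> \<psi> \<in> \<Gamma>" by (rule p[of "[Or \<phi> \<psi>, Neg \<phi>]"]) auto
  ultimately show "Or \<phi> \<psi> \<in> \<Gamma> \<longleftrightarrow> \<phi> \<in> \<Gamma> \<or> \<psi> \<in> \<Gamma>" using N[of \<phi>] by blast
  have "Neg \<phi> \<in> \<Gamma> \<Longrightarrow> Imp \<phi> \<psi> \<in> \<Gamma>" by (rule p[of "[Neg \<phi>]"]) auto
  moreover have "\<psi> \<in> \<Gamma> \<Longrightarrow> Imp \<phi> \<psi> \<in> \<Gamma>" by (rule p[of "[\<psi>]"]) auto
  moreover have "Imp \<phi> \<psi> \<in> \<Gamma> \<Longrightarrow> \<phi> \<in> \<Gamma> \<Longrightarrow> \<psi> \<in> \<Gamma>" by (rule p[of "[Imp \<phi> \<psi>, \<phi>]"]) auto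
  ultimately show "Imp \<phi> \<psi> \<in> \<Gamma> \<longleftrightarrow> (\<phi> \<in> \<Gamma> \<longrightarrow> \<psi> \<in> \<Gamma>)" using N[of \<phi>] by blast
qed

lemma mcs_conj: "mcs \<Gamma> \<Longrightarrow> conj l \<in> \<Gamma> \<longleftrightarrow> set l \<subseteq> \<Gamma>"
  by (induction l) (auto simp: mcs_simps)

section \<open>The canonical frame\<close>

definition canon :: "fm set \<Rightarrow> fm set \<Rightarrow> bool" where
  "canon x y \<longleftrightarrow> mcs x \<and> mcs y \<and> (\<forall>\<chi>. Box \<chi> \<in> x \<longrightarrow> \<chi> \<in> y)"

text \<open>A finite conflict between \<open>\<Delta>\<close> and what is boxed in \<open>x\<close>
  would put the boxed negation of a conjunction over \<open>\<Delta>\<close> into \<open>x\<close>.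
  A whole set \<open>\<Delta>\<close> is allowed because \<open>same_part_forth\<close> must realise
  a complete common theory at once; the truth lemma uses a singleton.\<close>

lemma canon_exists:
  assumes x: "mcs x" and \<Delta>: "\<And>l. set l \<subseteq> \<Delta> \<Longrightarrow> Box (Neg (conj l)) \<notin> x"
  shows "\<exists>y. canon x y \<and> \<Delta> \<subseteq> y"
proof -
  have "consistent ({\<chi>. Box \<chi> \<in> x} \<union> \<Delta>)"
    unfolding consistent_def
  proof (intro allI impI notI)
    fix l assume l: "set l \<subseteq> {\<chi>. Box \<chi> \<in> x} \<union> \<Delta>" "Neg (conj l) \<in> wK4"
    let ?a = "filter (\<lambda>\<chi>. Box \<chi> \<in> x) l" and ?b = "filter (\<lambda>\<chi>. Box \<chi> \<notin> x) l"
    have "Imp (conj ?a) (Neg (conj ?b)) \<in> wK4"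
      by (rule wK4_prop[of "[Neg (conj l)]"]) (use l in auto)
    then have "Imp (Box (conj ?a)) (Box (Neg (conj ?b))) \<in> wK4" by (rule wK4_Box_mono)
    moreover have "Box (conj ?a) \<in> x"
      by (rule mcs_wK4[OF x wK4_Box_conj]) (auto simp: mcs_conj[OF x])
    ultimately have "Box (Neg (conj ?b)) \<in> x" using mcs_wK4[OF x] by blast
    moreover have "set ?b \<subseteq> \<Delta>" using l(1) by auto
    ultimately show False using \<Delta> by blast
  qed
  then obtain y where "mcs y" "{\<chi>. Box \<chi> \<in> x} \<union> \<Delta> \<subseteq> y" using lindenbaum by blast
  then show ?thesis using x unfolding canon_def by blast
qed

lemma truth: "mcs x \<Longrightarrow> sem canon (\<lambda>x n. Var n \<in> x) x \<chi> \<longleftrightarrow> \<chi> \<in> x"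
proof (induction \<chi> arbitrary: x)
  case (Box \<chi>)
  show ?case
  proof
    assume s: "sem canon (\<lambda>x n. Var n \<in> x) x (Box \<chi>)"
    show "Box \<chi> \<in> x"
    proof (rule ccontr)
      assume B: "Box \<chi> \<notin> x"
      have "Box (Neg (conj l)) \<notin> x" if "set l \<subseteq> {Neg \<chi>}" for l
      proof
        assume "Box (Neg (conj l)) \<in> x"
        moreover have "Imp (Neg (conj l)) \<chi> \<in> wK4"
          by (rule wK4_taut) (use that in auto)
        ultimately show False using B mcs_wK4[OF Box.prems] wK4_Box_mono by blast
      qed
      then obtain y where "canon x y" "Neg \<chi> \<in> y" using canon_exists[OF Box.prems, of "{Neg \<chi>}"] by auto
      then show False
        using s Box.IH mcs_Neg unfolding canon_def by auto
    qed
  qed (use Box.IH in \<open>auto simp: canon_def\<close>)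
qed (auto simp: mcs_simps)

lemma wtrans_canon: "wtrans canon"
  unfolding wtrans_def
proof (intro allI impI)
  fix x y z assume xy: "canon x y" and yz: "canon y z"
  show "x = z \<or> canon x z"
  proof (rule ccontr)
    assume "\<not> ?thesis"
    then have ne: "x \<noteq> z" and "\<not> canon x z" by auto
    have m: "mcs x" "mcs y" "mcs z" using xy yz unfolding canon_def by auto
    with \<open>\<not> canon x z\<close> obtain \<chi> where \<chi>: "Box \<chi> \<in> x" "\<chi> \<notin> z" unfolding canon_def by auto
    obtain \<psi> where \<psi>: "\<psi> \<in> x" "\<psi> \<notin> z"
      using ne m mcs_Neg by blast
    \<comment> \<open>This disjunction is true at \<open>x\<close> by \<open>\<psi>\<close> and
      boxed there by \<open>\<chi>\<close>, so \<open>wK4_axiom\<close> carries it over two steps to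
      \<open>z\<close>, where both disjuncts fail.\<close>
    let ?p = "Or \<chi> \<psi>"
    have "Imp (Box \<chi>) (Box ?p) \<in> wK4" by (rule wK4_Box_mono, rule wK4_taut) simp
    then have "And ?p (Box ?p) \<in> x"
      using \<chi> \<psi> mcs_wK4[OF m(1)] m by (simp add: mcs_simps)
    then have "Box (Box ?p) \<in> x" using mcs_wK4[OF m(1) wK4_axiom] by blast
    then have "?p \<in> z" using xy yz unfolding canon_def by blast
    then show False using \<chi> \<psi> m by (simp add: mcs_simps)
  qed
qed

text \<open>The first disjunct provides reflexivity at the sets that are not maximal consistent: the
  canonical frame lives on all sets of formulas, and these are isolated in it.\<close>

definition same_part :: "nat set \<Rightarrow> fm set \<Rightarrow> fm set \<Rightarrow> bool" where
  "same_part \<sigma> x y \<longleftrightarrow> x = y \<or> mcs x \<and> mcs y \<and> (\<forall>\<chi>. vars \<chi> \<subseteq> \<sigma> \<longrightarrow> \<chi> \<in> x \<longleftrightarrow> \<chi> \<in> y)"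

lemma equivp_same_part: "equivp (same_part \<sigma>)"
  by (rule equivpI) (auto simp: reflp_def symp_def transp_def same_part_def)

lemma vars_Neg [simp]: "vars (Neg \<phi>) = vars \<phi>"
  by (simp add: Neg_def)

text \<open>Saturation of the canonical model: if the common theory of \<open>x'\<close> could not
  be realised above \<open>y\<close>, a finite part of it would be refuted by a boxed formula in the
  common variables, which \<open>y\<close> shares with \<open>x\<close>.\<close>

lemma same_part_forth:
  assumes "same_part \<sigma> x y" "canon x x'"
  shows "\<exists>y'. canon y y' \<and> same_part \<sigma> x' y'"
proof (cases "x = y")
  case True
  then show ?thesis using assms(2) by (auto simp: same_part_def)
next
  case False
  then have m: "mcs x" "mcs y" "mcs x'" and eq: "\<And>\<chi>. vars \<chi> \<subseteq> \<sigma> \<Longrightarrow> \<chi> \<in> x \<longleftrightarrow> \<chi> \<in> y"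
    using assms by (auto simp: same_part_def canon_def)
  let ?D = "{\<chi> \<in> x'. vars \<chi> \<subseteq> \<sigma>}"
  have "Box (Neg (conj l)) \<notin> y" if "set l \<subseteq> ?D" for l
  proof
    assume "Box (Neg (conj l)) \<in> y"
    moreover have "vars (Box (Neg (conj l))) \<subseteq> \<sigma>" using that by (auto simp: vars_conj)
    ultimately have "Box (Neg (conj l)) \<in> x" using eq by blast
    then have "Neg (conj l) \<in> x'" using assms(2) by (auto simp: canon_def)
    then show False using that mcs_conj[OF m(3)] mcs_Neg[OF m(3)] by auto
  qed
  then obtain y' where y': "canon y y'" "?D \<subseteq> y'" using canon_exists[OF m(2), of ?D] by blast
  then have "mcs y'" by (simp add: canon_def)
  have "\<chi> \<in> x' \<longleftrightarrow> \<chi> \<in> y'" if "vars \<chi> \<subseteq> \<sigma>" for \<chi>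
  proof -
    have "Neg \<chi> \<in> x' \<Longrightarrow> Neg \<chi> \<in> y'" "\<chi> \<in> x' \<Longrightarrow> \<chi> \<in> y'"
      using y'(2) that vars_Neg[of \<chi>] by blast+
    then show ?thesis using mcs_Neg[OF m(3), of \<chi>] mcs_Neg[OF \<open>mcs y'\<close>, of \<chi>] by blast
  qed
  then show ?thesis using y'(1) m(3) \<open>mcs y'\<close> by (auto simp: same_part_def)
qed

text \<open>If \<open>Neg \<psi>\<close> contradicted the consequences of \<open>\<phi>\<close> in
  the common variables, finitely many of these would imply \<open>\<psi>\<close>, and their
  conjunction would be an interpolant. This yields \<open>y\<close>. Its common theory is then
  consistent with \<open>\<phi>\<close>, since a refutation would be a consequence of
  \<open>\<phi>\<close> and hence lie in \<open>y\<close> itself.\<close>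

lemma no_interpolant_canon:
  assumes "\<And>\<iota>. \<not> is_interpolant \<iota> \<phi> \<psi>"
  shows "\<exists>x y. mcs x \<and> mcs y \<and> \<phi> \<in> x \<and> \<psi> \<notin> y \<and> same_part (vars \<phi> \<inter> vars \<psi>) x y"
proof -
  let ?\<sigma> = "vars \<phi> \<inter> vars \<psi>"
  let ?G = "{\<chi>. vars \<chi> \<subseteq> ?\<sigma> \<and> Imp \<phi> \<chi> \<in> wK4}"
  have "consistent (insert (Neg \<psi>) ?G)"
    unfolding consistent_def
  proof (intro allI impI notI)
    fix l assume l: "set l \<subseteq> insert (Neg \<psi>) ?G" "Neg (conj l) \<in> wK4"
    let ?l = "filter (\<lambda>\<chi>. \<chi> \<in> ?G) l"
    have "Imp (conj ?l) \<psi> \<in> wK4"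
      by (rule wK4_prop[of "[Neg (conj l)]"]) (use l in auto)
    moreover have "Imp \<phi> (conj ?l) \<in> wK4"
      by (rule wK4_prop[of "map (Imp \<phi>) ?l"]) auto
    moreover have "vars (conj ?l) \<subseteq> ?\<sigma>" by (auto simp: vars_conj)
    ultimately show False using assms unfolding is_interpolant_def by blast
  qed
  from lindenbaum[OF this] obtain y where y: "mcs y" "Neg \<psi> \<in> y" "?G \<subseteq> y"
    by (metis insert_subset)
  let ?D = "{\<chi> \<in> y. vars \<chi> \<subseteq> ?\<sigma>}"
  have "consistent (insert \<phi> ?D)"
    unfolding consistent_def
  proof (intro allI impI notI)
    fix l assume l: "set l \<subseteq> insert \<phi> ?D" "Neg (conj l) \<in> wK4"
    let ?l = "filter (\<lambda>\<chi>. \<chi> \<in> ?D) l"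
    have "Imp \<phi> (Neg (conj ?l)) \<in> wK4"
      by (rule wK4_prop[of "[Neg (conj l)]"]) (use l in auto)
    moreover have "vars (Neg (conj ?l)) \<subseteq> ?\<sigma>" by (auto simp: vars_conj)
    ultimately have "Neg (conj ?l) \<in> y" using y(3) by blast
    then show False using mcs_Neg[OF y(1)] mcs_conj[OF y(1)] by auto
  qed
  from lindenbaum[OF this] obtain x where x: "mcs x" "\<phi> \<in> x" "?D \<subseteq> x"
    by (metis insert_subset)
  have "\<chi> \<in> x \<longleftrightarrow> \<chi> \<in> y" if "vars \<chi> \<subseteq> ?\<sigma>" for \<chi>
  proof -
    have "Neg \<chi> \<in> y \<Longrightarrow> Neg \<chi> \<in> x" "\<chi> \<in> y \<Longrightarrow> \<chi> \<in> x"
      using x(3) that vars_Neg[of \<chi>] by blast+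
    then show ?thesis using mcs_Neg[OF x(1), of \<chi>] mcs_Neg[OF y(1), of \<chi>] by blast
  qed
  then have "same_part ?\<sigma> x y" using x(1) y(1) unfolding same_part_def by simp
  moreover have "\<psi> \<notin> y" using mcs_Neg[OF y(1)] y(2) by simp
  ultimately show ?thesis using x(1,2) y(1) by blast
qed

section \<open>Finite bisimilar models\<close>

text \<open>A mosaic records, for all points bisimilar to a given one, the type and the set of formulas
  that are boxed somewhere in the cluster. A point of the finite model consists of the mosaics that
  occur in its cluster of the quotient modulo bisimilarity (flagged if irreflexive there), the types
  and mosaics that occur in its own cluster, its type and its mosaic.\<close>

type_synonym mosaic = "(fm set \<times> fm set) set"
type_synonym point = "(mosaic \<times> bool) set \<times> (fm set \<times> mosaic) set \<times> fm set \<times> mosaic"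

text \<open>What holds at a point and at all its successors. By weak transitivity it persists at
  every later point, which makes these the formulas that can be demanded across clusters.\<close>

definition perm :: "fm set \<Rightarrow> fm set" where
  "perm t = {\<chi>. \<chi> \<in> t \<and> Box \<chi> \<in> t}"

definition boxes :: "(fm set \<times> mosaic) set \<Rightarrow> fm set" where
  "boxes \<gamma> = {\<chi>. \<exists>(t, \<tau>)\<in>\<gamma>. Box \<chi> \<in> t}"

text \<open>A point that sees no point bisimilar to it has no later cluster over the same cluster of the
  quotient above it, since that cluster would contain a bisimilar point.\<close>

definition terminal :: "(mosaic \<times> bool) set \<Rightarrow> (fm set \<times> mosaic) set \<Rightarrow> bool" where
  "terminal \<delta> \<gamma> \<longleftrightarrow> (\<exists>(t, \<tau>)\<in>\<gamma>. (\<tau>, True) \<in> \<delta>)"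

text \<open>Abstracts strict precedence of clusters of the quotient.\<close>

definition below :: "(mosaic \<times> bool) set \<Rightarrow> (mosaic \<times> bool) set \<Rightarrow> bool" where
  "below \<delta> \<delta>' \<longleftrightarrow>
     (\<forall>(\<tau>, i)\<in>\<delta>. \<forall>(t, f)\<in>\<tau>. \<forall>(\<tau>', i')\<in>\<delta>'. \<exists>(t', f')\<in>\<tau>'. f \<subseteq> perm t')"

text \<open>Equality of \<open>\<gamma>\<close> and of \<open>\<delta>\<close> stands for lying in
  one cluster. Otherwise everything boxed anywhere in the lower cluster has to be permanent at the
  upper point; using the boxes of the whole cluster instead of those in \<open>t\<close> makes the
  condition independent of the chosen point, as transitivity requires.\<close>

fun leq :: "point \<Rightarrow> point \<Rightarrow> bool" where
  "leq (\<delta>, \<gamma>, t, \<tau>) (\<delta>', \<gamma>', t', \<tau>') \<longleftrightarrow>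
     (\<gamma> = \<gamma>' \<and> \<delta> = \<delta>') \<or>
     (boxes \<gamma> \<subseteq> perm t' \<and> ((\<delta> = \<delta>' \<and> \<not> terminal \<delta> \<gamma>) \<or> below \<delta> \<delta>'))"

text \<open>The first alternative is forced by the truth of boxes, the second by the bisimulation.
  The exception \<open>below \<delta> \<delta>\<close> is there because distinct clusters of the
  quotient may have equal data: if one precedes the other, a point of the finite model may stand for
  points over both and must then see itself.\<close>

fun irreflexive :: "fm set \<Rightarrow> point \<Rightarrow> bool" where
  "irreflexive S (\<delta>, \<gamma>, t, \<tau>) \<longleftrightarrow>
     (\<exists>\<chi>\<in>S. Box \<chi> \<in> t \<and> \<chi> \<notin> t) \<or> ((\<tau>, True) \<in> \<delta> \<and> \<not> below \<delta> \<delta>)"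

definition acc :: "fm set \<Rightarrow> point \<Rightarrow> point \<Rightarrow> bool" where
  "acc S p q \<longleftrightarrow> leq p q \<and> (p \<noteq> q \<or> \<not> irreflexive S p)"

primrec args :: "fm \<Rightarrow> fm set" where
  "args (Var n) = {}"
| "args Bot = {}"
| "args (And \<phi> \<psi>) = {\<phi>, \<psi>}"
| "args (Or \<phi> \<psi>) = {\<phi>, \<psi>}"
| "args (Imp \<phi> \<psi>) = {\<phi>, \<psi>}"
| "args (Box \<phi>) = {\<phi>}"

text \<open>As \<open>sim\<close> is symmetric, \<open>forth\<close> contains the back condition as
  well. Later the model is the canonical one and \<open>S\<close> consists of the subformulas of
  both input formulas.\<close>

locale sim_model =
  fixes R :: "'w \<Rightarrow> 'w \<Rightarrow> bool" and V :: "'w \<Rightarrow> nat \<Rightarrow> bool"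
    and sim :: "'w \<Rightarrow> 'w \<Rightarrow> bool" (infix \<open>\<sim>\<close> 50) and \<sigma> :: "nat set" and S :: "fm set"
  assumes wt: "wtrans R"
    and equiv: "equivp sim"
    and forth: "\<lbrakk>x \<sim> y; R x x'\<rbrakk> \<Longrightarrow> \<exists>y'. R y y' \<and> x' \<sim> y'"
    and atoms: "\<lbrakk>x \<sim> y; n \<in> \<sigma>\<rbrakk> \<Longrightarrow> V x n = V y n"
    and closed: "\<chi> \<in> S \<Longrightarrow> args \<chi> \<subseteq> S"
    and atoms_closed: "n \<in> \<sigma> \<Longrightarrow> Var n \<in> S"
begin

lemma sim_refl [simp]: "x \<sim> x"
  and sim_sym: "x \<sim> y \<Longrightarrow> y \<sim> x"
  and sim_trans: "\<lbrakk>x \<sim> y; y \<sim> z\<rbrakk> \<Longrightarrow> x \<sim> z"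
  using equivp_reflp[OF equiv] equivp_symp[OF equiv] equivp_transp[OF equiv] by blast+

lemma closedD:
  "Box \<chi> \<in> S \<Longrightarrow> \<chi> \<in> S"
  "And \<phi> \<psi> \<in> S \<Longrightarrow> \<phi> \<in> S" "And \<phi> \<psi> \<in> S \<Longrightarrow> \<psi> \<in> S"
  "Or \<phi> \<psi> \<in> S \<Longrightarrow> \<phi> \<in> S" "Or \<phi> \<psi> \<in> S \<Longrightarrow> \<psi> \<in> S"
  "Imp \<phi> \<psi> \<in> S \<Longrightarrow> \<phi> \<in> S" "Imp \<phi> \<psi> \<in> S \<Longrightarrow> \<psi> \<in> S"
  by (drule closed, simp)+

section \<open>Clusters and the data of points\<close>

definition le (infix \<open>\<preceq>\<close> 50) where "x \<preceq> y \<longleftrightarrow> x = y \<or> R x y"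

lemma le_refl [simp]: "x \<preceq> x"
  and R_le: "R x y \<Longrightarrow> x \<preceq> y"
  and le_neq_R: "\<lbrakk>x \<preceq> y; x \<noteq> y\<rbrakk> \<Longrightarrow> R x y"
  by (auto simp: le_def)

lemma le_trans: "\<lbrakk>x \<preceq> y; y \<preceq> z\<rbrakk> \<Longrightarrow> x \<preceq> z"
  using wt unfolding wtrans_def le_def by blast

definition tp where "tp x = {\<chi> \<in> S. sem R V x \<chi>}"
definition cluster where "cluster x = {z. x \<preceq> z \<and> z \<preceq> x}"
definition boxed where "boxed x = {\<chi>. \<exists>z\<in>cluster x. Box \<chi> \<in> tp z}"
definition mos where "mos x = {(tp y, boxed y) | y. x \<sim> y}"
definition qle (infix \<open>\<unlhd>\<close> 50) where "x \<unlhd> y \<longleftrightarrow> (\<exists>y'. y \<sim> y' \<and> x \<preceq> y')"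
definition qeq (infix \<open>\<approx>\<close> 50) where "x \<approx> y \<longleftrightarrow> x \<unlhd> y \<and> y \<unlhd> x"
text \<open>Merging the bisimilarity classes with the same mosaic in one cluster of the quotient yields a
  bisimulation again, and afterwards the cluster and the mosaic determine the class.\<close>
definition sim1 (infix \<open>\<sim>\<^sub>1\<close> 50) where "x \<sim>\<^sub>1 y \<longleftrightarrow> x \<approx> y \<and> mos x = mos y"
text \<open>Irreflexivity of the class of \<open>x\<close> in the quotient by the merged classes;
  \<open>irr_sim1\<close> shows that all members of the class agree on it.\<close>

definition irr where "irr x \<longleftrightarrow> (\<forall>y. R x y \<longrightarrow> \<not> y \<sim>\<^sub>1 x)"
definition qcluster where "qcluster x = {(mos y, irr y) | y. x \<approx> y}"
definition sig where "sig x = {(tp z, mos z) | z. z \<in> cluster x}"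
definition pt :: "'w \<Rightarrow> point" where "pt x = (qcluster x, sig x, tp x, mos x)"

lemma tp_perm_mono: "x \<preceq> y \<Longrightarrow> perm (tp x) \<subseteq> perm (tp y)"
proof (clarsimp simp: perm_def tp_def)
  fix \<chi> assume "x \<preceq> y" "sem R V x \<chi>" "\<forall>u. R x u \<longrightarrow> sem R V u \<chi>"
  then have "sem R V u \<chi>" if "y \<preceq> u" for u
    using le_trans[OF \<open>x \<preceq> y\<close> that] by (auto simp: le_def)
  then show "sem R V y \<chi> \<and> (\<forall>u. R y u \<longrightarrow> sem R V u \<chi>)" by (simp add: R_le)
qed

lemma cluster_self [simp]: "x \<in> cluster x"
  by (simp add: cluster_def)

lemma cluster_eq: "y \<in> cluster x \<Longrightarrow> cluster y = cluster x"
  unfolding cluster_def using le_trans by blast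

text \<open>A point in the cluster of \<open>x\<close> differs from every \<open>u\<close> above
  \<open>y\<close>, since \<open>y\<close> does not reach back to \<open>x\<close>. Hence weak
  transitivity gives a genuine edge to \<open>u\<close>, and the boxed formula holds there.\<close>

lemma boxed_strict:
  assumes "x \<preceq> y" "\<not> y \<preceq> x"
  shows "boxed x \<subseteq> perm (tp y)"
proof
  fix \<chi> assume "\<chi> \<in> boxed x"
  then obtain z where z: "x \<preceq> z" "z \<preceq> x" and B: "Box \<chi> \<in> S" "sem R V z (Box \<chi>)"
    by (auto simp: boxed_def cluster_def tp_def)
  then have C: "\<chi> \<in> S" using closedD(1) by blast
  have "sem R V u \<chi>" if "y \<preceq> u" for u
  proof -
    have "z \<preceq> u" using z assms(1) that le_trans by blast
    moreover have "z \<noteq> u" using assms z that le_trans by blast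
    ultimately show ?thesis using B le_neq_R by auto
  qed
  then have "sem R V y \<chi>" "sem R V y (Box \<chi>)" by (auto simp: R_le)
  then show "\<chi> \<in> perm (tp y)" using B C by (simp add: perm_def tp_def)
qed

lemma box_boxed: "Box \<chi> \<in> tp x \<Longrightarrow> \<chi> \<in> boxed x"
  unfolding boxed_def using cluster_self by blast

lemma perm_boxed: "perm (tp x) \<subseteq> boxed x"
  using box_boxed by (auto simp: perm_def)

lemma boxes_sig: "boxes (sig x) = boxed x"
  by (auto simp: boxes_def sig_def boxed_def)

section \<open>The quotient modulo bisimilarity\<close>

lemma qle_refl [simp]: "x \<unlhd> x"
  using le_refl sim_refl unfolding qle_def by blast

lemma le_qle: "x \<preceq> y \<Longrightarrow> x \<unlhd> y"
  using sim_refl unfolding qle_def by blast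

lemma sim_qle: "x \<sim> y \<Longrightarrow> x \<unlhd> y"
  using le_refl sim_sym unfolding qle_def by blast

lemma le_sim: "\<lbrakk>x \<preceq> y; x \<sim> x'\<rbrakk> \<Longrightarrow> \<exists>y'. y \<sim> y' \<and> x' \<preceq> y'"
  using forth unfolding le_def by blast

lemma qle_trans: "\<lbrakk>x \<unlhd> y; y \<unlhd> z\<rbrakk> \<Longrightarrow> x \<unlhd> z"
  unfolding qle_def by (meson le_sim le_trans sim_trans)

lemma qeq_refl [simp]: "x \<approx> x"
  and qeq_sym: "x \<approx> y \<Longrightarrow> y \<approx> x"
  and qeq_trans: "\<lbrakk>x \<approx> y; y \<approx> z\<rbrakk> \<Longrightarrow> x \<approx> z"
  unfolding qeq_def using qle_trans by auto

lemma sim_qeq: "x \<sim> y \<Longrightarrow> x \<approx> y"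
  unfolding qeq_def using sim_qle sim_sym by blast

lemma cluster_qeq: "y \<in> cluster x \<Longrightarrow> x \<approx> y"
  unfolding qeq_def cluster_def using le_qle by blast

lemma mos_sim: "x \<sim> y \<Longrightarrow> mos x = mos y"
  unfolding mos_def using sim_sym sim_trans by blast

lemma qcluster_qeq: "x \<approx> y \<Longrightarrow> qcluster x = qcluster y"
  unfolding qcluster_def using qeq_sym qeq_trans by blast

lemma in_sig: "z \<in> cluster x \<Longrightarrow> (tp z, mos z) \<in> sig x"
  by (auto simp: sig_def)

lemma in_qcluster: "x \<approx> y \<Longrightarrow> (mos y, irr y) \<in> qcluster x"
  by (auto simp: qcluster_def)

lemma in_mos: "x \<sim> y \<Longrightarrow> (tp y, boxed y) \<in> mos x"
  by (auto simp: mos_def)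

lemma sig_cluster: "y \<in> cluster x \<Longrightarrow> sig y = sig x"
  unfolding sig_def using cluster_eq by simp

lemma sim1_refl [simp]: "x \<sim>\<^sub>1 x"
  and sim1_sym: "x \<sim>\<^sub>1 y \<Longrightarrow> y \<sim>\<^sub>1 x"
  and sim1_trans: "\<lbrakk>x \<sim>\<^sub>1 y; y \<sim>\<^sub>1 z\<rbrakk> \<Longrightarrow> x \<sim>\<^sub>1 z"
  and sim_sim1: "x \<sim> y \<Longrightarrow> x \<sim>\<^sub>1 y"
  unfolding sim1_def using qeq_sym sim_qeq mos_sim by (auto intro: qeq_trans)

text \<open>Let \<open>x\<close> see \<open>x'\<close> in its own class. As \<open>y\<close> lies in
  the same cluster of the quotient, it reaches a point \<open>u\<close> bisimilar to
  \<open>x\<close>. If \<open>u\<close> differs from \<open>y\<close>, it is a successor in the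
  class of \<open>y\<close>; if \<open>u\<close> is \<open>y\<close>, the edge from \<open>x\<close>
  to \<open>x'\<close> is copied to \<open>y\<close> by \<open>forth\<close>.\<close>

lemma irr_sim1_imp:
  assumes "x \<sim>\<^sub>1 y" "\<not> irr x"
  shows "\<not> irr y"
proof -
  obtain x' where x': "R x x'" "x' \<sim>\<^sub>1 x" using assms(2) by (auto simp: irr_def)
  have "y \<unlhd> x" "y \<unlhd> x'" using assms(1) x' qle_trans by (auto simp: sim1_def qeq_def)
  then obtain u u' where u: "x \<sim> u" "y \<preceq> u" "x' \<sim> u'" "y \<preceq> u'" by (auto simp: qle_def)
  have s: "u \<sim>\<^sub>1 y" "u' \<sim>\<^sub>1 y"
    using u x' assms(1) sim_sim1 sim1_sym sim1_trans by blast+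
  show ?thesis
  proof (cases "y = u")
    case True
    then obtain w where "R y w" "x' \<sim> w" using forth u(1) x'(1) by blast
    then have "w \<sim>\<^sub>1 y" using x' assms(1) sim_sim1 sim1_sym sim1_trans by blast
    then show ?thesis using \<open>R y w\<close> by (auto simp: irr_def)
  next
    case False
    then show ?thesis using s u le_neq_R by (auto simp: irr_def)
  qed
qed

lemma irr_sim1: "x \<sim>\<^sub>1 y \<Longrightarrow> irr x = irr y"
  using irr_sim1_imp sim1_sym by blast

text \<open>The flag stored with a mosaic is unambiguous: points with the same mosaic in one cluster
  of the quotient are merged by \<open>sim1\<close>, and \<open>irr\<close> is invariant under
  it.\<close>

lemma irr_in_qcluster: "(mos x, True) \<in> qcluster x \<longleftrightarrow> irr x"
proof
  assume "(mos x, True) \<in> qcluster x"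
  then obtain y where "x \<approx> y" "mos x = mos y" "irr y" by (auto simp: qcluster_def)
  then show "irr x" using irr_sim1[of x y] by (auto simp: sim1_def)
qed (auto simp: qcluster_def)

lemma irr_same_data:
  assumes "qcluster x = qcluster y" "mos x = mos y"
  shows "irr x = irr y"
  using assms irr_in_qcluster[of x] irr_in_qcluster[of y] by simp

lemma terminal_sig: "terminal (qcluster x) (sig x) \<longleftrightarrow> (\<exists>z\<in>cluster x. irr z)"
proof -
  have "(mos z, True) \<in> qcluster x \<longleftrightarrow> irr z" if "z \<in> cluster x" for z
    using irr_in_qcluster[of z] qcluster_qeq[OF cluster_qeq[OF that]] by simp
  then show ?thesis by (auto simp: terminal_def sig_def)
qed

text \<open>A mosaic lists each type together with what is boxed in the cluster of its point, so the
  combinatorial condition translates into one about points. Any member of the class of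
  \<open>y'\<close> may serve as \<open>y''\<close>.\<close>

lemma below_iff:
  "below (qcluster x) (qcluster y) \<longleftrightarrow>
     (\<forall>x' y'. x \<approx> x' \<longrightarrow> y \<approx> y' \<longrightarrow> (\<exists>y''. y' \<sim> y'' \<and> boxed x' \<subseteq> perm (tp y'')))"
    (is "?l \<longleftrightarrow> ?r")
proof
  assume ?l
  show ?r
  proof (intro allI impI)
    fix x' y' assume "x \<approx> x'" "y \<approx> y'"
    then have "(mos x', irr x') \<in> qcluster x" "(mos y', irr y') \<in> qcluster y"
      by (auto simp: qcluster_def)
    moreover have "(tp x', boxed x') \<in> mos x'" by (rule in_mos) simp
    ultimately have "\<exists>(t', f')\<in>mos y'. boxed x' \<subseteq> perm t'"
      using \<open>?l\<close> unfolding below_def by fast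
    then show "\<exists>y''. y' \<sim> y'' \<and> boxed x' \<subseteq> perm (tp y'')" by (auto simp: mos_def)
  qed
next
  assume r: ?r
  show ?l
    unfolding below_def
  proof (clarify)
    fix \<tau> i t f \<tau>' i'
    assume "(\<tau>, i) \<in> qcluster x" "(t, f) \<in> \<tau>" "(\<tau>', i') \<in> qcluster y"
    then obtain u x' y' where u: "x \<approx> u" "u \<sim> x'" "f = boxed x'" and y': "y \<approx> y'" "\<tau>' = mos y'"
      by (auto simp: qcluster_def mos_def)
    then have "x \<approx> x'" using sim_qeq qeq_trans by blast
    then obtain y'' where "y' \<sim> y''" "boxed x' \<subseteq> perm (tp y'')" using r y' by blast
    then show "\<exists>(t', f')\<in>\<tau>'. f \<subseteq> perm t'" using u y' by (auto simp: mos_def)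
  qed
qed

lemma below_trans:
  assumes "below (qcluster x) (qcluster y)" "below (qcluster y) (qcluster z)"
  shows "below (qcluster x) (qcluster z)"
  unfolding below_iff
proof (intro allI impI)
  fix x' z' assume x': "x \<approx> x'" and z': "z \<approx> z'"
  obtain y' where y': "y \<sim> y'" "boxed x' \<subseteq> perm (tp y')"
    using assms(1) x' qeq_refl[of y] unfolding below_iff by blast
  then obtain z'' where "z' \<sim> z''" "boxed y' \<subseteq> perm (tp z'')"
    using assms(2) z' sim_qeq unfolding below_iff by blast
  then show "\<exists>z''. z' \<sim> z'' \<and> boxed x' \<subseteq> perm (tp z'')"
    using y'(2) perm_boxed by blast
qed

section \<open>The order and accessibility of the finite model\<close>

lemma leq_pt:
  "leq (pt x) (pt y) \<longleftrightarrow>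
     (sig x = sig y \<and> qcluster x = qcluster y) \<or>
     (boxed x \<subseteq> perm (tp y) \<and>
        ((qcluster x = qcluster y \<and> (\<forall>z\<in>cluster x. \<not> irr z)) \<or> below (qcluster x) (qcluster y)))"
  by (simp add: pt_def boxes_sig terminal_sig)

lemma irreflexive_pt:
  "irreflexive S (pt x) \<longleftrightarrow>
     (\<exists>\<chi>\<in>S. Box \<chi> \<in> tp x \<and> \<chi> \<notin> tp x) \<or> (irr x \<and> \<not> below (qcluster x) (qcluster x))"
  by (simp add: pt_def irr_in_qcluster)

text \<open>Equal signatures realise the type of \<open>y\<close> in the cluster of
  \<open>x\<close>, and permanent formulas do not vary within a cluster.\<close>

lemma sig_perm:
  assumes "sig x = sig y"
  shows "perm (tp x) = perm (tp y)"
proof -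
  have "(tp y, mos y) \<in> sig x" using in_sig[of y y] assms by simp
  then obtain z where "z \<in> cluster x" "tp y = tp z" unfolding sig_def by blast
  then show ?thesis using tp_perm_mono[of x z] tp_perm_mono[of z x] by (auto simp: cluster_def)
qed

text \<open>The inclusions compose because what is permanent at \<open>y\<close> is in particular
  boxed in its cluster (\<open>perm_boxed\<close>). If one of the two steps stays in a cluster,
  \<open>sig_perm\<close> or the equality of the data transfers the condition of the other.\<close>

lemma leq_pt_trans:
  assumes xy: "leq (pt x) (pt y)" and yz: "leq (pt y) (pt z)"
  shows "leq (pt x) (pt z)"
proof (cases "sig x = sig y \<and> qcluster x = qcluster y")
  case True
  then have "boxed x = boxed y" using boxes_sig by metis
  moreover have "(\<exists>u\<in>cluster x. irr u) = (\<exists>u\<in>cluster y. irr u)"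
    using True terminal_sig by metis
  ultimately show ?thesis using True yz unfolding leq_pt by auto
next
  case xy': False
  show ?thesis
  proof (cases "sig y = sig z \<and> qcluster y = qcluster z")
    case True
    then show ?thesis using xy sig_perm[of y z] unfolding leq_pt by auto
  next
    case False
    have x: "boxed x \<subseteq> perm (tp y)"
      "qcluster x = qcluster y \<and> (\<forall>u\<in>cluster x. \<not> irr u) \<or> below (qcluster x) (qcluster y)"
      using xy xy' unfolding leq_pt by blast+
    have y: "boxed y \<subseteq> perm (tp z)"
      "qcluster y = qcluster z \<and> (\<forall>u\<in>cluster y. \<not> irr u) \<or> below (qcluster y) (qcluster z)"
      using yz False unfolding leq_pt by blast+
    have "boxed x \<subseteq> perm (tp z)" using x(1) y(1) perm_boxed[of y] by blast
    moreover have "qcluster x = qcluster z \<and> (\<forall>u\<in>cluster x. \<not> irr u) \<or> below (qcluster x) (qcluster z)"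
      using x(2) y(2) below_trans[of x y z] by metis
    ultimately show ?thesis unfolding leq_pt by blast
  qed
qed

text \<open>Points over the two clusters are comparable up to bisimilarity, and never in the reverse
  direction, so \<open>boxed_strict\<close> applies to each pair.\<close>

lemma below_strict:
  assumes "x \<preceq> y" "\<not> x \<approx> y"
  shows "below (qcluster x) (qcluster y)"
  unfolding below_iff
proof (intro allI impI)
  fix x' y' assume x': "x \<approx> x'" and y': "y \<approx> y'"
  have "x' \<unlhd> y'" using x' y' le_qle[OF assms(1)] qle_trans unfolding qeq_def by blast
  then obtain y'' where y'': "y' \<sim> y''" "x' \<preceq> y''" by (auto simp: qle_def)
  have "\<not> y'' \<preceq> x'"
  proof
    assume "y'' \<preceq> x'"
    then have "y' \<unlhd> x'" using y''(1) sim_qle le_qle qle_trans by blast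
    then have "y \<unlhd> x" using x' y' qle_trans unfolding qeq_def by blast
    then show False using assms le_qle by (simp add: qeq_def)
  qed
  then show "\<exists>y''. y' \<sim> y'' \<and> boxed x' \<subseteq> perm (tp y'')" using y'' boxed_strict by blast
qed

lemma le_leq:
  assumes "x \<preceq> y"
  shows "leq (pt x) (pt y)"
proof (cases "y \<preceq> x")
  case True
  then have "y \<in> cluster x" using assms by (simp add: cluster_def)
  then show ?thesis unfolding leq_pt using sig_cluster cluster_qeq qcluster_qeq by blast
next
  case False
  then have b: "boxed x \<subseteq> perm (tp y)" using boxed_strict assms by blast
  show ?thesis
  proof (cases "x \<approx> y")
    case True
    \<comment> \<open>The class of \<open>z\<close> recurs above \<open>y\<close>, which lies over
      the same cluster of the quotient. That occurrence is not \<open>z\<close> itself because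
      \<open>y\<close> is strictly above the cluster of \<open>x\<close>, so \<open>z\<close> sees
      its own class.\<close>
    have "\<not> irr z" if z: "z \<in> cluster x" for z
    proof -
      have "y \<approx> z" using True z cluster_qeq qeq_sym qeq_trans by blast
      then obtain z' where z': "z \<sim> z'" "y \<preceq> z'" by (auto simp: qeq_def qle_def)
      have zx: "z \<preceq> x" "x \<preceq> z" using z by (auto simp: cluster_def)
      have "z \<preceq> z'" by (rule le_trans[OF zx(1) le_trans[OF assms z'(2)]])
      moreover have "z \<noteq> z'" using z'(2) zx False le_trans by blast
      ultimately show ?thesis using z' sim_sim1 sim_sym le_neq_R unfolding irr_def by blast
    qed
    then show ?thesis using b True qcluster_qeq unfolding leq_pt by blast
  next
    case False
    have "below (qcluster x) (qcluster y)" by (rule below_strict[OF assms False])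
    then show ?thesis using b unfolding leq_pt by blast
  qed
qed

text \<open>Beyond \<open>le_leq\<close>, an edge between two points with equal data must not be
  deleted as a loop. A failing reflexive box would fail along the edge as well, and an edge leaving
  an irreflexive class without changing the data passes between clusters related by
  \<open>below\<close>.\<close>

lemma R_acc:
  assumes "R x y"
  shows "acc S (pt x) (pt y)"
proof -
  have l: "x \<preceq> y" using assms by (rule R_le)
  have "\<not> irreflexive S (pt x)" if p: "pt x = pt y"
  proof
    assume "irreflexive S (pt x)"
    then consider \<chi> where "\<chi> \<in> S" "Box \<chi> \<in> tp x" "\<chi> \<notin> tp x"
      | "irr x" "\<not> below (qcluster x) (qcluster x)"
      unfolding irreflexive_pt by blast
    then show False
    proof cases
      case 1
      then have "\<chi> \<in> tp y" using assms by (auto simp: tp_def)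
      then show False using 1 p by (simp add: pt_def)
    next
      case 2
      have m: "mos x = mos y" "qcluster x = qcluster y" using p by (simp_all add: pt_def)
      have "\<not> x \<approx> y"
      proof
        assume "x \<approx> y"
        then have "y \<sim>\<^sub>1 x" using m qeq_sym by (simp add: sim1_def)
        then show False using 2(1) assms by (auto simp: irr_def)
      qed
      then have "below (qcluster x) (qcluster y)" by (rule below_strict[OF l])
      then show False using 2(2) m(2) by simp
    qed
  qed
  then show ?thesis using le_leq[OF l] by (auto simp: acc_def)
qed

lemma acc_box:
  assumes "acc S (pt x) (pt y)" "Box \<chi> \<in> tp x"
  shows "\<chi> \<in> tp y"
proof -
  have cS: "\<chi> \<in> S" using assms(2) closedD(1) by (simp add: tp_def)
  consider "sig x = sig y" "qcluster x = qcluster y" | "boxed x \<subseteq> perm (tp y)"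
    using assms(1) unfolding acc_def leq_pt by blast
  then show ?thesis
  proof cases
    case 1
    have "(tp y, mos y) \<in> sig x" using in_sig[of y y] 1 by simp
    \<comment> \<open>Signatures pair types with mosaics. So \<open>z = x\<close> gives equality of
      the mosaics too and turns the step into a loop at \<open>pt x\<close>, which
      \<open>irreflexive\<close> controls; equality of types alone would not.\<close>
    then obtain z where z: "z \<in> cluster x" "tp y = tp z" "mos y = mos z" unfolding sig_def by blast
    show ?thesis
    proof (cases "z = x")
      case True
      then have "pt x = pt y" using 1 z by (simp add: pt_def)
      then have "\<not> irreflexive S (pt x)" using assms(1) by (simp add: acc_def)
      then show ?thesis using assms(2) cS z True unfolding irreflexive_pt by auto
    next
      case False
      then have "R x z" using z le_neq_R by (auto simp: cluster_def)
      then have "\<chi> \<in> tp z" using assms(2) cS by (simp add: tp_def)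
      then show ?thesis using z by simp
    qed
  next
    case 2
    then show ?thesis using box_boxed[OF assms(2)] by (auto simp: perm_def)
  qed
qed

lemma acc_forth:
  assumes acc: "acc S (pt x) (pt x1)" and d: "qcluster x = qcluster y" and m: "mos x = mos y"
  shows "\<exists>y1. acc S (pt y) (pt y1) \<and> qcluster x1 = qcluster y1 \<and> mos x1 = mos y1"
proof -
  have special: "\<not> (\<exists>\<chi>\<in>S. Box \<chi> \<in> tp y \<and> \<chi> \<notin> tp y)"
    if "boxed y \<subseteq> perm (tp w)" "tp w = tp y" for w
    using that box_boxed[of _ y] by (auto simp: perm_def)
  have self: "\<exists>y1. acc S (pt y) (pt y1) \<and> qcluster x1 = qcluster y1 \<and> mos x1 = mos y1"
    if b: "below (qcluster y) (qcluster x1)"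
  proof -
    obtain y1 where y1: "x1 \<sim> y1" "boxed y \<subseteq> perm (tp y1)"
      using b qeq_refl unfolding below_iff by blast
    have q: "qcluster x1 = qcluster y1" "mos x1 = mos y1"
      using y1(1) sim_qeq qcluster_qeq mos_sim by blast+
    then have l: "leq (pt y) (pt y1)" using y1 b unfolding leq_pt by auto
    \<comment> \<open>The chosen successor may coincide with the point itself. Both reasons for
      irreflexivity then vanish: permanence excludes a failing reflexive box, and \<open>b\<close>
      makes the data below themselves.\<close>
    have "\<not> irreflexive S (pt y)" if "pt y = pt y1"
    proof -
      have "tp y1 = tp y" "qcluster y1 = qcluster y" using that by (simp_all add: pt_def)
      then show ?thesis using special[OF y1(2)] b q unfolding irreflexive_pt by simp
    qed
    then show ?thesis using l q by (auto simp: acc_def)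
  qed
  show ?thesis
  proof (cases "below (qcluster x) (qcluster x1)")
    case True
    then show ?thesis using self d by simp
  next
    case nb: False
    then have d1: "qcluster x1 = qcluster x"
      and c: "sig x = sig x1 \<or> (\<forall>z\<in>cluster x. \<not> irr z)"
      using acc unfolding acc_def leq_pt by auto
    have "(mos x1, irr x1) \<in> qcluster y"
      using in_qcluster[of x1 x1] d d1 by simp
    then obtain c' where c': "y \<approx> c'" "mos x1 = mos c'" by (auto simp: qcluster_def)
    then obtain y2 where y2: "c' \<sim> y2" "y \<preceq> y2" by (auto simp: qeq_def qle_def)
    have y2': "mos x1 = mos y2" "qcluster x1 = qcluster y2"
      using c' y2 mos_sim sim_qeq qcluster_qeq d d1 by metis+
    show ?thesis
    proof (cases "R y y2")
      case True
      then show ?thesis using R_acc y2' by blast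
    next
      case False
      then have yy: "y2 = y" using y2 by (auto simp: le_def)
      show ?thesis
      proof (cases "irr y")
        case nirr: False
        then obtain y3 where "R y y3" "y3 \<sim>\<^sub>1 y" by (auto simp: irr_def)
        then have "acc S (pt y) (pt y3)" "mos y3 = mos y" "qcluster y3 = qcluster y"
          using R_acc qcluster_qeq by (auto simp: sim1_def)
        then show ?thesis using y2' yy by metis
      next
        case True
        then have ix: "irr x" using irr_same_data d m by blast
        then have "sig x = sig x1" using c cluster_self[of x] by blast
        then have "(tp x1, mos x1) \<in> sig x" using in_sig[of x1 x1] by simp
        then obtain z where z: "z \<in> cluster x" "tp x1 = tp z" "mos x1 = mos z"
          unfolding sig_def by blast
        have "z \<sim>\<^sub>1 x"
          using z m y2' yy cluster_qeq qeq_sym by (auto simp: sim1_def)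
        \<comment> \<open>An irreflexive class has no second member in the cluster, since
          \<open>x\<close> would see it.\<close>
        then have "z = x" using ix z(1) le_neq_R[of x z] unfolding irr_def cluster_def by blast
        then have "pt x = pt x1" using z \<open>sig x = sig x1\<close> d1 by (simp add: pt_def)
        then have "\<not> irreflexive S (pt x)" using acc by (simp add: acc_def)
        then have "below (qcluster x) (qcluster x)" using ix unfolding irreflexive_pt by blast
        then show ?thesis using nb d1 by simp
      qed
    qed
  qed
qed

section \<open>The finite model and its bisimulation\<close>

definition pR where "pR p q \<longleftrightarrow> p \<in> range pt \<and> q \<in> range pt \<and> acc S p q"
definition pV where "pV p n \<longleftrightarrow> Var n \<in> fst (snd (snd (p :: point)))"
definition pZ where "pZ p q \<longleftrightarrow> p \<in> range pt \<and> q \<in> range pt \<and> fst p = fst q \<and>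
  snd (snd (snd p)) = snd (snd (snd (q :: point)))"

lemma wtrans_pR: "wtrans pR"
  unfolding wtrans_def pR_def
proof (intro allI impI, elim conjE)
  fix p q r assume a: "acc S p q" "acc S q r" "p \<in> range pt" "q \<in> range pt" "r \<in> range pt"
  then have "leq p r" using leq_pt_trans unfolding acc_def by blast
  then show "p = r \<or> p \<in> range pt \<and> r \<in> range pt \<and> acc S p r"
    using a by (auto simp: acc_def)
qed

lemma sem_pt: "\<chi> \<in> S \<Longrightarrow> sem pR pV (pt x) \<chi> \<longleftrightarrow> sem R V x \<chi>"
proof (induction \<chi> arbitrary: x)
  case (Var n)
  then show ?case by (simp add: pV_def pt_def tp_def)
next
  case (Box \<chi>)
  then have \<chi>: "\<chi> \<in> S" using closedD(1) by blast
  show ?case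
  proof
    assume "sem pR pV (pt x) (Box \<chi>)"
    then have "sem R V y \<chi>" if "R x y" for y
      using R_acc[OF that] Box.IH[OF \<chi>, of y] unfolding sem.simps pR_def by blast
    then show "sem R V x (Box \<chi>)" by simp
  next
    assume "sem R V x (Box \<chi>)"
    then have "Box \<chi> \<in> tp x" using Box.prems by (simp add: tp_def)
    then have "sem pR pV (pt y) \<chi>" if "acc S (pt x) (pt y)" for y
      using acc_box[OF that] Box.IH[OF \<chi>] by (simp add: tp_def)
    then show "sem pR pV (pt x) (Box \<chi>)" by (auto simp: pR_def)
  qed
qed (auto dest: closedD)

lemma bisim_pZ: "bisim \<sigma> pR pV pZ"
proof -
  have sym: "pZ p q \<Longrightarrow> pZ q p" for p q by (auto simp: pZ_def)
  have f: "\<exists>q'. pR q q' \<and> pZ p' q'" if "pZ p q" "pR p p'" for p q p'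
  proof -
    have "p \<in> range pt" "q \<in> range pt" "p' \<in> range pt"
      using that by (simp_all add: pZ_def pR_def)
    then obtain x y x' where e: "p = pt x" "q = pt y" "p' = pt x'" by blast
    then have "acc S (pt x) (pt x')" "qcluster x = qcluster y" "mos x = mos y"
      using that by (auto simp: pZ_def pR_def pt_def)
    from acc_forth[OF this] obtain y1
      where "acc S (pt y) (pt y1)" "qcluster x' = qcluster y1" "mos x' = mos y1" by blast
    then have "pR q (pt y1)" "pZ p' (pt y1)" using e by (auto simp: pR_def pZ_def pt_def)
    then show ?thesis by blast
  qed
  have a: "pV p n = pV q n" if "pZ p q" "n \<in> \<sigma>" for p q n
  proof -
    have "p \<in> range pt" "q \<in> range pt" using that by (simp_all add: pZ_def)
    then obtain x y where e: "p = pt x" "q = pt y" by blast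
    then have "mos x = mos y" using that by (auto simp: pZ_def pt_def)
    \<comment> \<open>As the mosaics agree, the type of \<open>x\<close> also occurs at a point
      bisimilar to \<open>y\<close>, and bisimilar points agree on \<open>\<sigma>\<close>.\<close>
    moreover have "(tp x, boxed x) \<in> mos x" by (rule in_mos) simp
    ultimately obtain z where "y \<sim> z" "tp x = tp z" by (auto simp: mos_def)
    then show ?thesis
      using e atoms[of y z n] atoms_closed that(2) by (auto simp: pV_def pt_def tp_def set_eq_iff)
  qed
  show ?thesis
    unfolding bisim_def using a f sym by blast
qed

lemma pZ_sim: "x \<sim> y \<Longrightarrow> pZ (pt x) (pt y)"
  using sim_qeq qcluster_qeq mos_sim by (auto simp: pZ_def pt_def)

lemma boxed_sub: "boxed x \<subseteq> S"
  using closedD(1) by (auto simp: boxed_def tp_def)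

lemma range_pt:
  "range pt \<subseteq> Pow (Pow (Pow S \<times> Pow S) \<times> UNIV) \<times> Pow (Pow S \<times> Pow (Pow S \<times> Pow S)) \<times>
     Pow S \<times> Pow (Pow S \<times> Pow S)"
proof -
  have t: "tp x \<in> Pow S" for x by (auto simp: tp_def)
  have m: "mos x \<in> Pow (Pow S \<times> Pow S)" for x using t boxed_sub by (auto simp: mos_def)
  show ?thesis
  proof -
    have "qcluster x \<in> Pow (Pow (Pow S \<times> Pow S) \<times> UNIV)" for x
      unfolding qcluster_def Pow_iff[of _ "Pow (Pow S \<times> Pow S) \<times> UNIV"] using m by blast
    moreover have "sig x \<in> Pow (Pow S \<times> Pow (Pow S \<times> Pow S))" for x
      unfolding sig_def Pow_iff[of _ "Pow S \<times> Pow (Pow S \<times> Pow S)"] using t m by blast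
    ultimately show ?thesis using t m unfolding pt_def by blast
  qed
qed

end

text \<open>The factors count, for \<open>s\<close> formulas, the possible flagged mosaics of a
  cluster of the quotient, the signatures, the types and the mosaics.\<close>

definition point_bound :: "nat \<Rightarrow> nat" where
  "point_bound s = 2 ^ (2 ^ (2 ^ s * 2 ^ s) * 2) * (2 ^ (2 ^ s * 2 ^ (2 ^ s * 2 ^ s)) *
     (2 ^ s * 2 ^ (2 ^ s * 2 ^ s)))"

lemma (in sim_model) card_range_pt:
  assumes "finite S"
  shows "finite (range pt)" "card (range pt) \<le> point_bound (card S)"
proof -
  let ?A = "Pow (Pow (Pow S \<times> Pow S) \<times> (UNIV :: bool set)) \<times>
     Pow (Pow S \<times> Pow (Pow S \<times> Pow S)) \<times> Pow S \<times> Pow (Pow S \<times> Pow S)"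
  have "finite ?A" using assms by simp
  then show "finite (range pt)" by (rule finite_subset[OF range_pt])
  have "card ?A = point_bound (card S)"
    using assms by (simp add: card_cartesian_product card_Pow point_bound_def UNIV_bool)
  then show "card (range pt) \<le> point_bound (card S)"
    using card_mono[OF \<open>finite ?A\<close> range_pt] by simp
qed

lemma sem_transport:
  assumes "inj_on e A" "\<And>p q. R p q \<Longrightarrow> p \<in> A \<and> q \<in> A" "p \<in> A"
  shows "sem (\<lambda>i j. \<exists>p q. i = e p \<and> j = e q \<and> R p q) (\<lambda>i n. \<exists>p\<in>A. i = e p \<and> V p n) (e p) \<chi> \<longleftrightarrow>
    sem R V p \<chi>"
  using assms(3)
proof (induction \<chi> arbitrary: p)
  case (Var n)
  then show ?case using assms(1) by (auto simp: inj_on_def)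
next
  case (Box \<chi>)
  let ?R = "\<lambda>i j. \<exists>p q. i = e p \<and> j = e q \<and> R p q"
  have "?R (e p) j \<longleftrightarrow> (\<exists>q. j = e q \<and> R p q)" for j
    using Box.prems assms(2) inj_onD[OF assms(1), of p] by metis
  moreover have "q \<in> A" if "R p q" for q using assms(2) that by blast
  ultimately show ?case using Box.IH by auto
qed auto

text \<open>Numbers serve as worlds so that the relations can be written as tables of width
  depending on \<open>m\<close>; the worlds from \<open>m\<close> on are isolated.\<close>

definition separated :: "nat \<Rightarrow> fm \<Rightarrow> fm \<Rightarrow> bool" where
  "separated m \<phi> \<psi> \<longleftrightarrow> (\<exists>R V Z x y.
     (\<forall>i j. R i j \<longrightarrow> i < m \<and> j < m) \<and> (\<forall>i j. Z i j \<longrightarrow> i < m \<and> j < m) \<and>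
     wtrans R \<and> bisim (vars \<phi> \<inter> vars \<psi>) R V Z \<and> Z x y \<and> sem R V x \<phi> \<and> \<not> sem R V y \<psi>)"

lemma (in sim_model) separatedI:
  assumes "finite S" "point_bound (card S) \<le> m" "\<phi> \<in> S" "\<psi> \<in> S" "\<sigma> = vars \<phi> \<inter> vars \<psi>"
    and "x \<sim> y" "sem R V x \<phi>" "\<not> sem R V y \<psi>"
  shows "separated m \<phi> \<psi>"
proof -
  let ?A = "range pt"
  obtain e :: "point \<Rightarrow> nat" where e: "inj_on e ?A" "e ` ?A \<subseteq> {..<m}"
    using card_range_pt[OF assms(1)] assms(2) card_le_inj[of ?A "{..<m}"] by auto
  let ?R = "\<lambda>i j. \<exists>p q. i = e p \<and> j = e q \<and> pR p q"
  let ?Z = "\<lambda>i j. \<exists>p q. i = e p \<and> j = e q \<and> pZ p q"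
  let ?V = "\<lambda>i n. \<exists>p\<in>?A. i = e p \<and> pV p n"
  have RA: "pR p q \<Longrightarrow> p \<in> ?A \<and> q \<in> ?A" for p q by (simp add: pR_def)
  have ZA: "pZ p q \<Longrightarrow> p \<in> ?A \<and> q \<in> ?A" for p q by (simp add: pZ_def)
  have ie: "p \<in> ?A \<Longrightarrow> q \<in> ?A \<Longrightarrow> e p = e q \<longleftrightarrow> p = q" for p q
    using e(1) by (auto simp: inj_on_def)
  have s: "sem ?R ?V (e (pt u)) \<chi> \<longleftrightarrow> sem R V u \<chi>" if "\<chi> \<in> S" for u \<chi>
    using sem_transport[OF e(1), of pR "pt u" pV \<chi>] RA sem_pt[OF that] by simp
  have "wtrans ?R"
    unfolding wtrans_def
  proof (intro allI impI, elim exE conjE)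
    fix i j k p q q' r assume h: "i = e p" "j = e q" "pR p q" "j = e q'" "k = e r" "pR q' r"
    then have "q = q'" using ie[of q q'] RA by metis
    then have "p = r \<or> pR p r" using wtrans_pR h unfolding wtrans_def by blast
    then show "i = k \<or> ?R i k" using h by blast
  qed
  moreover have "bisim \<sigma> ?R ?V ?Z"
    unfolding bisim_def
  proof (intro allI impI, elim exE conjE)
    fix i j p q assume h: "i = e p" "j = e q" "pZ p q"
    have pA: "p \<in> ?A" "q \<in> ?A" using ZA h by blast+
    have V: "?V (e p) n = pV p n" if "p \<in> ?A" for p n using that ie by auto
    have R: "?R (e p) j' \<longleftrightarrow> (\<exists>p'. j' = e p' \<and> pR p p')" if "p \<in> ?A" for p j'
      using that ie RA by metis
    have b: "\<forall>n\<in>\<sigma>. pV p n = pV q n" "\<And>p'. pR p p' \<Longrightarrow> \<exists>q'. pR q q' \<and> pZ p' q'"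
      "\<And>q'. pR q q' \<Longrightarrow> \<exists>p'. pR p p' \<and> pZ p' q'"
      using bisim_pZ h(3) unfolding bisim_def by blast+
    have "\<forall>n\<in>\<sigma>. ?V i n = ?V j n"
      unfolding h(1,2) V[OF pA(1)] V[OF pA(2)] by (rule b(1))
    moreover have "\<exists>j'. ?R j j' \<and> ?Z i' j'" if i': "?R i i'" for i'
    proof -
      obtain p' where p': "i' = e p'" "pR p p'" using i' unfolding h(1) R[OF pA(1)] by blast
      obtain q' where "pR q q'" "pZ p' q'" using b(2)[OF p'(2)] by blast
      then have "?R j (e q')" "?Z i' (e q')" using p'(1) h(2) by metis+
      then show ?thesis by (intro exI[of _ "e q'"] conjI)
    qed
    moreover have "\<exists>i'. ?R i i' \<and> ?Z i' j'" if j': "?R j j'" for j'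
    proof -
      obtain q' where q': "j' = e q'" "pR q q'" using j' unfolding h(2) R[OF pA(2)] by blast
      obtain p' where "pR p p'" "pZ p' q'" using b(3)[OF q'(2)] by blast
      then have "?R i (e p')" "?Z (e p') j'" using q'(1) h(1) by metis+
      then show ?thesis by (intro exI[of _ "e p'"] conjI)
    qed
    ultimately show "(\<forall>n\<in>\<sigma>. ?V i n = ?V j n) \<and> (\<forall>i'. ?R i i' \<longrightarrow> (\<exists>j'. ?R j j' \<and> ?Z i' j')) \<and>
      (\<forall>j'. ?R j j' \<longrightarrow> (\<exists>i'. ?R i i' \<and> ?Z i' j'))" by (intro conjI allI impI)
  qed
  moreover have "?Z (e (pt x)) (e (pt y))" using pZ_sim[OF assms(6)] by blast
  moreover have "sem ?R ?V (e (pt x)) \<phi>" "\<not> sem ?R ?V (e (pt y)) \<psi>"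
    using s[OF assms(3)] s[OF assms(4)] assms(7,8) by simp_all
  moreover have em: "e p < m" if "p \<in> ?A" for p using e(2) that by blast
  have "\<forall>i j. ?R i j \<longrightarrow> i < m \<and> j < m"
    using RA em by (intro allI impI, elim exE conjE) simp
  moreover have "\<forall>i j. ?Z i j \<longrightarrow> i < m \<and> j < m"
    using ZA em by (intro allI impI, elim exE conjE) simp
  ultimately show ?thesis
    unfolding separated_def assms(5)
    by (intro exI[of _ ?R] exI[of _ ?V] exI[of _ ?Z] exI[of _ "e (pt x)"] exI[of _ "e (pt y)"] conjI)
qed

section \<open>Subformulas and the length of the encoding\<close>

primrec subfms :: "fm \<Rightarrow> fm set" where
  "subfms (Var n) = {Var n}"
| "subfms Bot = {Bot}"
| "subfms (And \<phi> \<psi>) = insert (And \<phi> \<psi>) (subfms \<phi> \<union> subfms \<psi>)"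
| "subfms (Or \<phi> \<psi>) = insert (Or \<phi> \<psi>) (subfms \<phi> \<union> subfms \<psi>)"
| "subfms (Imp \<phi> \<psi>) = insert (Imp \<phi> \<psi>) (subfms \<phi> \<union> subfms \<psi>)"
| "subfms (Box \<phi>) = insert (Box \<phi>) (subfms \<phi>)"

lemma subfms_self [simp]: "\<phi> \<in> subfms \<phi>"
  by (cases \<phi>) auto

lemma args_subfms: "\<chi> \<in> subfms \<phi> \<Longrightarrow> args \<chi> \<subseteq> subfms \<phi>"
  by (induction \<phi>) auto

lemma finite_subfms [simp]: "finite (subfms \<phi>)"
  by (induction \<phi>) auto

text \<open>Every constructor costs a tag of three symbols. The factor 3 is what
  \<open>point_bound_tower\<close> consumes.\<close>

lemma card_subfms: "3 * card (subfms \<phi>) \<le> length (enc \<phi>)"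
proof (induction \<phi>)
  case (And \<phi>1 \<phi>2)
  have "card (subfms (And \<phi>1 \<phi>2)) \<le> Suc (card (subfms \<phi>1) + card (subfms \<phi>2))"
    using card_Un_le[of "subfms \<phi>1" "subfms \<phi>2"] by (simp add: card_insert_if)
  then show ?case using And by simp
next
  case (Or \<phi>1 \<phi>2)
  have "card (subfms (Or \<phi>1 \<phi>2)) \<le> Suc (card (subfms \<phi>1) + card (subfms \<phi>2))"
    using card_Un_le[of "subfms \<phi>1" "subfms \<phi>2"] by (simp add: card_insert_if)
  then show ?case using Or by simp
next
  case (Imp \<phi>1 \<phi>2)
  have "card (subfms (Imp \<phi>1 \<phi>2)) \<le> Suc (card (subfms \<phi>1) + card (subfms \<phi>2))"
    using card_Un_le[of "subfms \<phi>1" "subfms \<phi>2"] by (simp add: card_insert_if)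
  then show ?case using Imp by simp
next
  case (Box \<phi>)
  have "card (subfms (Box \<phi>)) \<le> Suc (card (subfms \<phi>))" by (simp add: card_insert_if)
  then show ?case using Box by simp
qed auto

lemma vars_subfms: "n \<in> vars \<phi> \<Longrightarrow> Var n \<in> subfms \<phi>"
  by (induction \<phi>) auto

text \<open>An interpolant excludes separation for every \<open>m\<close>; the bound serves the
  converse, where the finite image of the canonical model has to fit into \<open>m\<close>
  worlds.\<close>

theorem interpolant_iff_not_separated:
  assumes "point_bound (card (subfms \<phi> \<union> subfms \<psi>)) \<le> m"
  shows "(\<exists>\<iota>. is_interpolant \<iota> \<phi> \<psi>) \<longleftrightarrow> \<not> separated m \<phi> \<psi>"
proof
  assume "\<exists>\<iota>. is_interpolant \<iota> \<phi> \<psi>"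
  then obtain \<iota> where \<iota>: "is_interpolant \<iota> \<phi> \<psi>" by blast
  show "\<not> separated m \<phi> \<psi>"
    unfolding separated_def
  proof (intro notI, elim exE conjE)
    fix R V Z x y
    assume "wtrans R" "bisim (vars \<phi> \<inter> vars \<psi>) R V Z" "Z x y" "sem R V x \<phi>" "\<not> sem R V y \<psi>"
    from bisim_no_interpolant[OF this] show False using \<iota> by blast
  qed
next
  assume ns: "\<not> separated m \<phi> \<psi>"
  show "\<exists>\<iota>. is_interpolant \<iota> \<phi> \<psi>"
  proof (rule ccontr)
    assume "\<nexists>\<iota>. is_interpolant \<iota> \<phi> \<psi>"
    then obtain x y where xy: "mcs x" "mcs y" "\<phi> \<in> x" "\<psi> \<notin> y"
      "same_part (vars \<phi> \<inter> vars \<psi>) x y"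
      using no_interpolant_canon by blast
    interpret sim_model canon "\<lambda>x n. Var n \<in> x" "same_part (vars \<phi> \<inter> vars \<psi>)"
      "vars \<phi> \<inter> vars \<psi>" "subfms \<phi> \<union> subfms \<psi>"
    proof
      show "Var n \<in> subfms \<phi> \<union> subfms \<psi>" if "n \<in> vars \<phi> \<inter> vars \<psi>" for n
        using that vars_subfms by blast
      show "(Var n \<in> x) = (Var n \<in> y)"
        if "same_part (vars \<phi> \<inter> vars \<psi>) x y" "n \<in> vars \<phi> \<inter> vars \<psi>" for x y n
        using that unfolding same_part_def by (metis empty_subsetI insert_subset vars.simps(1))
      show "args \<chi> \<subseteq> subfms \<phi> \<union> subfms \<psi>" if "\<chi> \<in> subfms \<phi> \<union> subfms \<psi>" for \<chi>
        using that args_subfms by blast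
    qed (use wtrans_canon equivp_same_part same_part_forth in auto)
    have "separated m \<phi> \<psi>"
      by (rule separatedI[OF _ assms _ _ refl xy(5)]) (use xy truth in auto)
    then show False using ns by blast
  qed
qed

section \<open>Structured programs for Turing machines\<close>

datatype prog =
    Mv nat int
  | Wr nat nat
  | Seq prog prog
  | If nat nat prog prog
  | While nat nat prog
  | Choose prog prog

text \<open>\<open>If i a\<close> tests whether the symbol under head \<open>i\<close> is \<open>a\<close>; \<open>While i a\<close> loops until it is.\<close>

type_synonym mstate = "(nat \<Rightarrow> int) \<times> (nat \<Rightarrow> int \<Rightarrow> nat)"

definition keep :: "(nat \<Rightarrow> nat) \<Rightarrow> nat \<Rightarrow> nat \<times> int" where
  "keep r = (\<lambda>j. (r j, 0))"

text \<open>A configuration keeps a stack of the programs still to be run. The result depends only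
  on the stack and the symbols read and prescribes one write and one move per tape, so a small step
  is exactly one transition of a machine.\<close>

fun nxt :: "prog list \<Rightarrow> (nat \<Rightarrow> nat) \<Rightarrow> (prog list \<times> (nat \<Rightarrow> nat \<times> int)) set" where
  "nxt [] r = {}"
| "nxt (Mv i d # ps) r = {(ps, \<lambda>j. (r j, if j = i then d else 0))}"
| "nxt (Wr i a # ps) r = {(ps, \<lambda>j. (if j = i then a else r j, 0))}"
| "nxt (Seq p q # ps) r = {(p # q # ps, keep r)}"
| "nxt (If i a p q # ps) r = {((if r i = a then p else q) # ps, keep r)}"
| "nxt (While i a p # ps) r = {(if r i = a then ps else p # While i a p # ps, keep r)}"
| "nxt (Choose p q # ps) r = {(p # ps, keep r), (q # ps, keep r)}"

definition reads :: "mstate \<Rightarrow> nat \<Rightarrow> nat" where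
  "reads s = (\<lambda>j. snd s j (fst s j))"

definition perform :: "mstate \<Rightarrow> (nat \<Rightarrow> nat \<times> int) \<Rightarrow> mstate" where
  "perform s a = (\<lambda>j. fst s j + snd (a j), \<lambda>j. (snd s j)(fst s j := fst (a j)))"

inductive sstep :: "prog list \<times> mstate \<Rightarrow> prog list \<times> mstate \<Rightarrow> bool" where
  "(l', a) \<in> nxt l (reads s) \<Longrightarrow> sstep (l, s) (l', perform s a)"

lemma perform_keep [simp]: "perform s (keep (reads s)) = s"
  by (cases s) (auto simp: perform_def keep_def reads_def)

lemma perform_Mv: "perform (h, C) (\<lambda>j. (reads (h, C) j, if j = i then d else 0)) = (h(i := h i + d), C)"
  by (auto simp: perform_def reads_def)

lemma perform_Wr: "perform (h, C) (\<lambda>j. (if j = i then a else reads (h, C) j, 0)) = (h, C(i := (C i)(h i := a)))"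
  by (auto simp: perform_def reads_def)

lemma sstep_simps [simp]:
  "\<not> sstep ([], s) c"
  "sstep (Mv i d # ps, (h, C)) c \<longleftrightarrow> c = (ps, (h(i := h i + d), C))"
  "sstep (Wr i a # ps, (h, C)) c \<longleftrightarrow> c = (ps, (h, C(i := (C i)(h i := a))))"
  "sstep (Seq p q # ps, s) c \<longleftrightarrow> c = (p # q # ps, s)"
  "sstep (If i a p q # ps, s) c \<longleftrightarrow> c = ((if reads s i = a then p else q) # ps, s)"
  "sstep (While i a p # ps, s) c \<longleftrightarrow> c = (if reads s i = a then ps else p # While i a p # ps, s)"
  "sstep (Choose p q # ps, s) c \<longleftrightarrow> c = (p # ps, s) \<or> c = (q # ps, s)"
proof -
  have "c = (p # ps, s) \<or> c = (q # ps, s) \<Longrightarrow> sstep (Choose p q # ps, s) c"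
    using sstep.intros[of _ "keep (reads s)" "Choose p q # ps" s] by auto
  then show "sstep (Choose p q # ps, s) c \<longleftrightarrow> c = (p # ps, s) \<or> c = (q # ps, s)"
    by (auto simp: sstep.simps)
qed (auto simp: sstep.simps perform_Mv perform_Wr)

lemma sstep_total: "\<exists>c. sstep (p # ps, s) c"
  by (cases p; cases s) auto

lemma sstep_append: "sstep (l, s) (l', s') \<Longrightarrow> sstep (l @ ps, s) (l' @ ps, s')"
  by (cases s; cases "(l, reads s)" rule: nxt.cases) auto

lemma sstep_star_append: "sstep\<^sup>*\<^sup>* (l, s) (l', s') \<Longrightarrow> sstep\<^sup>*\<^sup>* (l @ ps, s) (l' @ ps, s')"
proof (induction "(l', s')" arbitrary: l' s' rule: rtranclp_induct)
  case (step y)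
  then show ?case
    by (cases y) (metis rtranclp.rtrancl_into_rtrancl sstep_append)
qed simp

primrec wfp :: "nat \<Rightarrow> nat \<Rightarrow> prog \<Rightarrow> bool" where
  "wfp K A (Mv i d) \<longleftrightarrow> i < K \<and> d \<in> {-1, 0, 1}"
| "wfp K A (Wr i a) \<longleftrightarrow> i < K \<and> a < A"
| "wfp K A (Seq p q) \<longleftrightarrow> wfp K A p \<and> wfp K A q"
| "wfp K A (If i a p q) \<longleftrightarrow> i < K \<and> wfp K A p \<and> wfp K A q"
| "wfp K A (While i a p) \<longleftrightarrow> i < K \<and> wfp K A p"
| "wfp K A (Choose p q) \<longleftrightarrow> wfp K A p \<and> wfp K A q"

subsection \<open>Compilation\<close>

text \<open>A finite set that contains all stacks arising from \<open>[p]\<close>; these become the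
  states. It is finite because a stack is determined by a place in the program text, even inside
  loops. For a loop, \<open>[]\<close> in \<open>conts p\<close> accounts for the stack consisting
  of the loop alone.\<close>

primrec conts :: "prog \<Rightarrow> prog list set" where
  "conts (Mv i d) = {[], [Mv i d]}"
| "conts (Wr i a) = {[], [Wr i a]}"
| "conts (Seq p q) = insert [Seq p q] ((\<lambda>l. l @ [q]) ` conts p \<union> conts q)"
| "conts (If i a p q) = insert [If i a p q] (conts p \<union> conts q)"
| "conts (While i a p) = insert [] ((\<lambda>l. l @ [While i a p]) ` conts p)"
| "conts (Choose p q) = insert [Choose p q] (conts p \<union> conts q)"

lemma finite_conts [simp]: "finite (conts p)"
  by (induction p) auto

lemma conts_Nil [simp]: "[] \<in> conts p"
  by (induction p) auto

lemma conts_self [simp]: "[p] \<in> conts p"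
  by (cases p) (use conts_Nil in force)+

lemma nxt_append: "l \<noteq> [] \<Longrightarrow> nxt (l @ ps) r = (\<lambda>(l', a). (l' @ ps, a)) ` nxt l r"
  by (cases "(l, r)" rule: nxt.cases) auto

lemma conts_nxt: "\<lbrakk>l \<in> conts p; (l', a) \<in> nxt l r\<rbrakk> \<Longrightarrow> l' \<in> conts p"
proof (induction p arbitrary: l l' a)
  case (Seq p q)
  consider "l = [Seq p q]" | k where "l = k @ [q]" "k \<in> conts p" "k \<noteq> []" | "l = [q]" | "l \<in> conts q"
    using Seq.prems(1) by fastforce
  then show ?case
  proof cases
    case 1
    then show ?thesis using Seq.prems(2) conts_self[of p] by (force simp: image_iff)
  next
    case 2
    then show ?thesis using Seq.prems(2) Seq.IH(1) by (auto simp: nxt_append)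
  next
    case 3
    then show ?thesis using Seq.prems(2) Seq.IH(2)[of "[q]"] by auto
  next
    case 4
    then show ?thesis using Seq.prems(2) Seq.IH(2) by auto
  qed
next
  case (If i b p q)
  then show ?case by (auto split: if_splits)
next
  case (While i b p)
  then consider "l = []" | "l = [While i b p]" | k where "l = k @ [While i b p]" "k \<in> conts p" "k \<noteq> []"
    by auto
  then show ?case
  proof cases
    case 2
    then show ?thesis using While.prems(2) conts_self[of p] by (force simp: image_iff split: if_splits)
  next
    case 3
    then show ?thesis using While.prems(2) While.IH by (auto simp: nxt_append)
  qed (use While.prems in auto)
qed auto

lemma nxt_wf:
  assumes "(l', a) \<in> nxt l r" "list_all (wfp K A) l" "\<And>j. r j < A"
  shows "fst (a j) < A" "snd (a j) \<in> {-1, 0, 1}" "K \<le> j \<Longrightarrow> a j = (r j, 0)"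
  using assms by (cases "(l, r)" rule: nxt.cases; auto simp: keep_def)+

lemma conts_wf: "\<lbrakk>wfp K A p; l \<in> conts p\<rbrakk> \<Longrightarrow> list_all (wfp K A) l"
  by (induction p arbitrary: l) auto

definition input_state :: "bool list \<Rightarrow> mstate" where
  "input_state w = (\<lambda>_. 0, (\<lambda>_ _. 0)(0 := snd (input_tape w)))"

text \<open>Stacks are numbered as states, and one further state accepts. It is entered from the
  empty stack if head \<open>fl\<close> is on a blank, which explains the additional step in the
  time bound.\<close>

lemma compile:
  assumes p: "wfp K A p" and K: "fl < K" "0 < K" and A: "3 \<le> A"
    and bound: "\<And>w n c. (sstep ^^ n) ([p], input_state w) c \<Longrightarrow> n \<le> T (length w)"
    and lang: "\<And>w. w \<in> L \<longleftrightarrow> (\<exists>s. sstep\<^sup>*\<^sup>* ([p], input_state w) ([], s) \<and> reads s fl = 0)"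
  shows "\<exists>M. wf_ntm M \<and> decides_in_time M L (\<lambda>n. Suc (T n))"
proof -
  let ?Q = "conts p"
  obtain idx where "bij_betw idx ?Q {0..<card ?Q}"
    using ex_bij_betw_finite_nat[of ?Q] by auto
  then have idx_inj: "inj_on idx ?Q" and idx_lt: "\<And>l. l \<in> ?Q \<Longrightarrow> idx l < card ?Q"
    by (auto simp: bij_betw_def)
  let ?acc = "card ?Q"
  \<comment> \<open>The value 0 is what a blank tape shows; \<open>ok\<close> keeps all tapes from
    \<open>K\<close> on blank, so \<open>rd\<close> recovers the full function
    \<open>reads\<close>.\<close>
  define rd where "rd xs = (\<lambda>j. if j < K then xs ! j else 0)" for xs :: "nat list"
  define \<Delta>1 where "\<Delta>1 = {(q, xs, q', as). \<exists>l l' a. l \<in> ?Q \<and> q = idx l \<and> length xs = K \<and>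
    set xs \<subseteq> {..<A} \<and> (l', a) \<in> nxt l (rd xs) \<and> q' = idx l' \<and> as = map a [0..<K]}"
  define \<Delta>2 where "\<Delta>2 = {(q, xs, q', as). q = idx [] \<and> length xs = K \<and>
    set xs \<subseteq> {..<A} \<and> xs ! fl = 0 \<and> q' = ?acc \<and> as = map (\<lambda>j. (xs ! j, 0 :: int)) [0..<K]}"
  define M where "M = \<lparr>n_tapes = K, n_states = Suc ?acc, n_symbols = A, start = idx [p],
    accept = ?acc, delta = \<Delta>1 \<union> \<Delta>2\<rparr>"
  have rdA: "rd xs j < A" if "length xs = K" "set xs \<subseteq> {..<A}" for xs j
    using that A nth_mem[of j xs] by (auto simp: rd_def subset_eq)
  have d1: "q \<le> ?acc \<and> q' \<le> ?acc \<and> length xs = K \<and> length as = K \<and> set xs \<subseteq> {..<A} \<and>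
      set as \<subseteq> {..<A} \<times> {-1, 0, 1}" if d: "(q, xs, q', as) \<in> \<Delta>1" for q xs q' as
  proof -
    obtain l l' a where l: "l \<in> ?Q" "q = idx l" "length xs = K" "set xs \<subseteq> {..<A}"
      "(l', a) \<in> nxt l (rd xs)" "q' = idx l'" "as = map a [0..<K]"
      using d by (auto simp: \<Delta>1_def)
    have "fst (a j) < A \<and> snd (a j) \<in> {-1, 0, 1}" for j
      using nxt_wf(1,2)[OF l(5) conts_wf[OF p l(1)] rdA[OF l(3,4)]] by blast
    then have aj: "a j \<in> {..<A} \<times> {-1, 0, 1}" for j
      by (metis lessThan_iff mem_Sigma_iff prod.collapse)
    have "set as \<subseteq> {..<A} \<times> {-1, 0, 1}" unfolding l(7) set_map by (rule image_subsetI) (rule aj)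
    moreover have "l' \<in> ?Q" using conts_nxt l by blast
    ultimately show ?thesis using l idx_lt[of l] idx_lt[of l'] by auto
  qed
  have "wf_ntm M"
    unfolding wf_ntm_def
  proof (intro conjI ballI, goal_cases)
    case (5 x)
    obtain q xs q' as where x: "x = (q, xs, q', as)" by (cases x)
    from 5 consider "(q, xs, q', as) \<in> \<Delta>1" | "(q, xs, q', as) \<in> \<Delta>2" by (auto simp: M_def x)
    then show ?case
    proof cases
      case 1
      then show ?thesis using d1[OF 1] by (auto simp: x M_def)
    next
      case 2
      then show ?thesis using idx_lt[of "[]"] nth_mem[of _ xs] by (auto simp: x M_def \<Delta>2_def subset_eq)
    qed
  qed (use K A idx_lt[of "[p]"] in \<open>auto simp: M_def\<close>)
  define ts where "ts s = map (\<lambda>j. (fst s j, snd s j)) [0..<K]" for s :: mstate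
  define ok where "ok s \<longleftrightarrow> (\<forall>j z. snd s j z < A) \<and> (\<forall>j\<ge>K. snd s j = (\<lambda>_. 0))" for s :: mstate
  have rts: "map read_tape (ts s) = map (reads s) [0..<K]" for s
    by (simp add: ts_def read_tape_def reads_def)
  have rd: "rd (map (reads s) [0..<K]) = reads s" if "ok s" for s
    using that by (auto simp: rd_def reads_def ok_def)
  have rA: "set (map (reads s) [0..<K]) \<subseteq> {..<A}" if "ok s" for s
    using that by (auto simp: reads_def ok_def)
  have tsp: "map2 act (ts s) (map a [0..<K]) = ts (perform s a)" for s a
    by (rule nth_equalityI) (auto simp: ts_def act_def perform_def)
  have tsp2: "map2 act (ts s) (map (\<lambda>j. (map (reads s) [0..<K] ! j, 0)) [0..<K]) = ts s" for s
    by (rule nth_equalityI) (auto simp: ts_def act_def reads_def)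
  have okp: "ok (perform s a)" if "ok s" "l \<in> ?Q" "(l', a) \<in> nxt l (reads s)" for s a l l'
  proof -
    have "reads s j < A" for j using that(1) by (auto simp: ok_def reads_def)
    note n = nxt_wf[OF that(3) conts_wf[OF p that(2)] this]
    have "snd (perform s a) j = (\<lambda>_. 0)" if "K \<le> j" for j
      using n(3)[OF that] \<open>ok s\<close> that by (auto simp: perform_def reads_def ok_def)
    then show ?thesis using n(1) that(1) by (auto simp: ok_def perform_def)
  qed
  have fwd: "l' \<in> ?Q \<and> ok s' \<and> step M (idx l, ts s) (idx l', ts s')"
    if st: "sstep (l, s) (l', s')" and that: "l \<in> ?Q" "ok s" for l s l' s'
  proof -
    obtain a where a: "(l', a) \<in> nxt l (reads s)" "s' = perform s a"
      using st by (auto simp: sstep.simps)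
    have "(idx l, map read_tape (ts s), idx l', map a [0..<K]) \<in> \<Delta>1"
      unfolding rts \<Delta>1_def using that a rd rA by auto
    then have "step M (idx l, ts s) (idx l', map2 act (ts s) (map a [0..<K]))"
      by (intro step.intros) (simp add: M_def)
    then show ?thesis using okp that a conts_nxt by (auto simp: tsp)
  qed
  have bwd: "(\<exists>l' s'. sstep (l, s) (l', s') \<and> l' \<in> ?Q \<and> ok s' \<and> c = (idx l', ts s')) \<or>
      (l = [] \<and> reads s fl = 0 \<and> fst c = ?acc)"
    if st: "step M (idx l, ts s) c" and l: "l \<in> ?Q" and s: "ok s" for l s c
  proof -
    obtain q' as where d: "(idx l, map (reads s) [0..<K], q', as) \<in> \<Delta>1 \<union> \<Delta>2"
      and c: "c = (q', map2 act (ts s) as)"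
      using st by (auto simp: step.simps M_def rts)
    from d show ?thesis
    proof
      assume "(idx l, map (reads s) [0..<K], q', as) \<in> \<Delta>1"
      then obtain k l' a where k: "k \<in> ?Q" "idx l = idx k" "(l', a) \<in> nxt k (reads s)" "q' = idx l'"
        "as = map a [0..<K]" by (auto simp: \<Delta>1_def rd[OF s])
      then have "k = l" using idx_inj l by (auto simp: inj_on_def)
      then have "sstep (l, s) (l', perform s a)" using k by (auto intro: sstep.intros)
      moreover have "c = (idx l', ts (perform s a))" using c k tsp by simp
      ultimately show ?thesis using fwd l s by blast
    next
      assume "(idx l, map (reads s) [0..<K], q', as) \<in> \<Delta>2"
      then have "l = []" "q' = ?acc" "reads s fl = 0"
        using idx_inj l K by (auto simp: \<Delta>2_def inj_on_def)
      then show ?thesis using c by simp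
    qed
  qed
  have acc_stuck: "\<not> step M c c'" if fin: "fst c = ?acc" for c c'
  proof
    assume "step M c c'"
    then have "\<exists>xs q' as. (?acc, xs, q', as) \<in> \<Delta>1 \<union> \<Delta>2"
      using fin by (cases rule: step.cases) (auto simp: M_def)
    then have "\<exists>l\<in>?Q. ?acc = idx l" using conts_Nil[of p] unfolding \<Delta>1_def \<Delta>2_def by blast
    then show False using idx_lt by fastforce
  qed
  have init: "init M w = (idx [p], ts (input_state w))" for w
    using K by (auto simp: init_def M_def ts_def input_state_def input_tape_def blank_tape_def
        nth_Cons' intro!: nth_equalityI)
  have ok0: "ok (input_state w)" for w
    using K A by (auto simp: ok_def input_state_def input_tape_def)
  have runs: "(\<exists>l s. (sstep ^^ n) ([p], input_state w) (l, s) \<and> l \<in> ?Q \<and> ok s \<and> c = (idx l, ts s)) \<or>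
      (\<exists>k s. n = Suc k \<and> (sstep ^^ k) ([p], input_state w) ([], s) \<and> reads s fl = 0 \<and> fst c = ?acc)"
    if "(step M ^^ n) (init M w) c" for n c w
    using that
  proof (induction n arbitrary: c)
    case 0
    then show ?case using init ok0 conts_self by auto
  next
    case (Suc n)
    then obtain b where b: "(step M ^^ n) (init M w) b" "step M b c" by auto
    from Suc.IH[OF b(1)] show ?case
    proof
      assume "\<exists>l s. (sstep ^^ n) ([p], input_state w) (l, s) \<and> l \<in> ?Q \<and> ok s \<and> b = (idx l, ts s)"
      then obtain l s where ls: "(sstep ^^ n) ([p], input_state w) (l, s)" "l \<in> ?Q" "ok s"
        "b = (idx l, ts s)" by blast
      from bwd[of l s c] b(2) ls
      have "(\<exists>l' s'. sstep (l, s) (l', s') \<and> l' \<in> ?Q \<and> ok s' \<and> c = (idx l', ts s')) \<or>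
        (l = [] \<and> reads s fl = 0 \<and> fst c = ?acc)" by simp
      then show ?thesis
      proof
        assume "\<exists>l' s'. sstep (l, s) (l', s') \<and> l' \<in> ?Q \<and> ok s' \<and> c = (idx l', ts s')"
        then obtain l' s' where *: "sstep (l, s) (l', s')" "l' \<in> ?Q" "ok s'" "c = (idx l', ts s')"
          by (elim exE conjE)
        then have "(sstep ^^ Suc n) ([p], input_state w) (l', s')" using ls(1) by auto
        with * show ?thesis by (intro disjI1 exI[of _ l'] exI[of _ s'] conjI)
      next
        assume "l = [] \<and> reads s fl = 0 \<and> fst c = ?acc"
        with ls(1) show ?thesis by (intro disjI2 exI[of _ n] exI[of _ s]) simp
      qed
    next
      assume "\<exists>k s. n = Suc k \<and> (sstep ^^ k) ([p], input_state w) ([], s) \<and> reads s fl = 0 \<and> fst b = ?acc"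
      then show ?thesis using acc_stuck b(2) by blast
    qed
  qed
  have star: "(step M)\<^sup>*\<^sup>* (init M w) (idx l, ts s) \<and> l \<in> ?Q \<and> ok s"
    if "sstep\<^sup>*\<^sup>* ([p], input_state w) (l, s)" for l s w
    using that
  proof (induction "(l, s)" arbitrary: l s rule: rtranclp_induct)
    case base
    then show ?case using init ok0 conts_self by auto
  next
    case (step y)
    then obtain l' s' where y: "y = (l', s')" by (cases y)
    then have "(step M)\<^sup>*\<^sup>* (init M w) (idx l', ts s')" "l' \<in> ?Q" "ok s'" using step by auto
    moreover have "sstep (l', s') (l, s)" using step(2) unfolding y .
    ultimately have "step M (idx l', ts s') (idx l, ts s)" "l \<in> ?Q" "ok s"
      using fwd[of l' s' l s] by blast+
    then show ?case using \<open>(step M)\<^sup>*\<^sup>* (init M w) (idx l', ts s')\<close>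
      by (simp add: rtranclp.rtrancl_into_rtrancl)
  qed
  have "decides_in_time M L (\<lambda>n. Suc (T n))"
    unfolding decides_in_time_def
  proof (intro allI conjI impI)
    fix w n c assume "(step M ^^ n) (init M w) c"
    from runs[OF this] show "n \<le> Suc (T (length w))"
      using bound[where w = w] by (auto simp: le_SucI)
  next
    fix w
    show "w \<in> L \<longleftrightarrow> (\<exists>c. (step M)\<^sup>*\<^sup>* (init M w) c \<and> fst c = accept M)"
    proof
      assume "w \<in> L"
      then obtain s where s: "sstep\<^sup>*\<^sup>* ([p], input_state w) ([], s)" "reads s fl = 0" using lang by blast
      from star[OF s(1)] have r: "(step M)\<^sup>*\<^sup>* (init M w) (idx [], ts s)" and "ok s" by auto
      have "(idx [], map read_tape (ts s), ?acc, map (\<lambda>j. (map (reads s) [0..<K] ! j, 0)) [0..<K]) \<in> \<Delta>2"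
        unfolding rts \<Delta>2_def using s(2) rA[OF \<open>ok s\<close>] K by auto
      then have "step M (idx [], ts s) (?acc, ts s)"
        using step.intros[of "idx []" "ts s" ?acc _ M] tsp2[of s] by (fastforce simp: M_def)
      then show "\<exists>c. (step M)\<^sup>*\<^sup>* (init M w) c \<and> fst c = accept M"
        using r by (intro exI[of _ "(?acc, ts s)"]) (auto simp: M_def)
    next
      assume "\<exists>c. (step M)\<^sup>*\<^sup>* (init M w) c \<and> fst c = accept M"
      then obtain c n where c: "(step M ^^ n) (init M w) c" "fst c = ?acc"
        by (auto simp: M_def rtranclp_power)
      from runs[OF c(1)] show "w \<in> L"
      proof
        assume "\<exists>l s. (sstep ^^ n) ([p], input_state w) (l, s) \<and> l \<in> ?Q \<and> ok s \<and> c = (idx l, ts s)"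
        then show ?thesis using c(2) idx_lt by (metis fst_conv less_irrefl)
      next
        assume "\<exists>k s. n = Suc k \<and> (sstep ^^ k) ([p], input_state w) ([], s) \<and> reads s fl = 0 \<and> fst c = ?acc"
        then show ?thesis using lang rtranclp_power by metis
      qed
    qed
  qed
  then show ?thesis using \<open>wf_ntm M\<close> by blast
qed

subsection \<open>Total correctness with time bounds\<close>

text \<open>Total correctness over all nondeterministic choices: every run ends within the given
  number of steps, and in \<open>F\<close>. Only the empty stack halts, by
  \<open>sstep_total\<close>.\<close>

inductive safe :: "(mstate \<Rightarrow> bool) \<Rightarrow> nat \<Rightarrow> prog list \<times> mstate \<Rightarrow> bool" for F where
  safe_Nil: "F s \<Longrightarrow> safe F n ([], s)"
| safe_Cons: "(\<And>c. sstep (p # ps, s) c \<Longrightarrow> safe F n c) \<Longrightarrow> safe F (Suc n) (p # ps, s)"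

lemma safe_mono: "safe F n c \<Longrightarrow> n \<le> m \<Longrightarrow> safe F m c"
proof (induction arbitrary: m rule: safe.induct)
  case (safe_Cons p ps s n)
  then obtain k where "m = Suc k" "n \<le> k" by (cases m) auto
  then show ?case using safe_Cons by (auto intro: safe.safe_Cons)
qed (rule safe_Nil)

lemma safe_step: "safe F n c \<Longrightarrow> sstep c c' \<Longrightarrow> \<exists>k. n = Suc k \<and> safe F k c'"
  by (erule safe.cases) auto

lemma safe_bound: "safe F n c \<Longrightarrow> (sstep ^^ k) c c' \<Longrightarrow> k \<le> n"
proof (induction k arbitrary: n c)
  case (Suc k)
  then obtain b where "sstep c b" "(sstep ^^ k) b c'" by (metis relpowp_Suc_D2)
  then show ?case using Suc safe_step by fastforce
qed simp

lemma safe_final: "sstep\<^sup>*\<^sup>* c ([], s) \<Longrightarrow> safe F n c \<Longrightarrow> F s"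
proof (induction arbitrary: n rule: converse_rtranclp_induct)
  case base
  then show ?case by (auto elim!: safe.cases)
next
  case (step y z)
  then show ?case using safe_step by blast
qed

lemma safe_exists: "safe F n c \<Longrightarrow> \<exists>s. F s \<and> sstep\<^sup>*\<^sup>* c ([], s)"
proof (induction rule: safe.induct)
  case (safe_Cons p ps s n)
  then show ?case using sstep_total by (metis converse_rtranclp_into_rtranclp)
qed auto

text \<open>The quantification over continuations makes triples compose without induction.\<close>

definition tri :: "prog \<Rightarrow> mstate \<Rightarrow> nat \<Rightarrow> (mstate \<Rightarrow> bool) \<Rightarrow> bool" where
  "tri p s n Q \<longleftrightarrow>
     (\<forall>ps m F. (\<forall>s'. Q s' \<longrightarrow> safe F m (ps, s')) \<longrightarrow> safe F (n + m) (p # ps, s))"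

lemma tri_safe: "tri p s n Q \<Longrightarrow> safe Q n ([p], s)"
  unfolding tri_def by (metis add.right_neutral safe_Nil)

lemma tri_mono: "\<lbrakk>tri p s n Q; n \<le> m; \<And>s'. Q s' \<Longrightarrow> Q' s'\<rbrakk> \<Longrightarrow> tri p s m Q'"
  unfolding tri_def using safe_mono[OF _ add_le_mono1] by blast

text \<open>A triple speaks about all runs, and at least one run exists and terminates; with a
  single final state it therefore leads there. Deterministic parts thus need only a triple, while
  the guesses need \<open>reach_guess\<close> besides.\<close>

lemma tri_reach: "tri p s n (\<lambda>s'. s' = t) \<Longrightarrow> sstep\<^sup>*\<^sup>* (p # ps, s) (ps, t)"
proof -
  assume "tri p s n (\<lambda>s'. s' = t)"
  then have "sstep\<^sup>*\<^sup>* ([p], s) ([], t)" using safe_exists[OF tri_safe] by blast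
  from sstep_star_append[OF this, of ps] show ?thesis by simp
qed

lemma tri_Mv: "Q (h(i := h i + d), C) \<Longrightarrow> tri (Mv i d) (h, C) 1 Q"
  unfolding tri_def by (auto intro!: safe_Cons)

lemma tri_Wr: "Q (h, C(i := (C i)(h i := a))) \<Longrightarrow> tri (Wr i a) (h, C) 1 Q"
  unfolding tri_def by (auto intro!: safe_Cons)

lemma tri_Seq:
  assumes "tri p s a P" "\<And>s'. P s' \<Longrightarrow> tri q s' b Q"
  shows "tri (Seq p q) s (Suc (a + b)) Q"
  using assms unfolding tri_def by (auto intro!: safe_Cons simp: add.assoc)

lemma tri_If:
  assumes "reads s i = a \<Longrightarrow> tri p s n Q" "reads s i \<noteq> a \<Longrightarrow> tri q s n Q"
  shows "tri (If i a p q) s (Suc n) Q"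
  using assms unfolding tri_def by (auto intro!: safe_Cons)

lemma tri_Choose:
  assumes "tri p s n Q" "tri q s n Q"
  shows "tri (Choose p q) s (Suc n) Q"
  using assms unfolding tri_def by (auto intro!: safe_Cons)

lemma tri_While_stop: "reads s i = a \<Longrightarrow> Q s \<Longrightarrow> tri (While i a p) s 1 Q"
  unfolding tri_def by (auto intro!: safe_Cons)

lemma tri_While_step:
  assumes "reads s i \<noteq> a" "tri p s n P" "\<And>s'. P s' \<Longrightarrow> tri (While i a p) s' m Q"
  shows "tri (While i a p) s (Suc (n + m)) Q"
  using assms unfolding tri_def by (auto intro!: safe_Cons simp: add.assoc)

lemma tri_While:
  assumes "\<And>k s. \<lbrakk>k < N; I k s\<rbrakk> \<Longrightarrow> reads s i \<noteq> a \<and> tri p s n (I (Suc k))"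
    and "\<And>s. I N s \<Longrightarrow> reads s i = a"
    and "I k s" "k \<le> N"
  shows "tri (While i a p) s (Suc ((N - k) * Suc n)) (I N)"
  using assms(3,4)
proof (induction "N - k" arbitrary: k s)
  case 0
  then show ?case using assms(2) tri_While_stop by (auto intro: tri_mono[OF tri_While_stop])
next
  case (Suc d)
  then have k: "k < N" "d = N - Suc k" by auto
  have "tri (While i a p) s (Suc (n + Suc (d * Suc n))) (I N)"
    by (rule tri_While_step[of _ _ _ _ _ "I (Suc k)"]) (use assms(1) Suc k in auto)
  moreover have "Suc (n + Suc (d * Suc n)) = Suc ((N - k) * Suc n)" using Suc(2)[symmetric] by simp
  ultimately show ?case by simp
qed

section \<open>First-order properties of words with guessed relations\<close>

text \<open>In \<open>Rel k u a v b\<close> and \<open>Inp s u a\<close> the arguments are \<open>u + a\<close> and \<open>v + b\<close>, where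
  \<open>u\<close> and \<open>v\<close> are variables and \<open>a\<close> and \<open>b\<close> constants.\<close>

datatype fo =
    Inp nat nat nat
  | Rel nat nat nat nat nat
  | Not fo
  | Conj fo fo
  | Ex nat fo

primrec sat :: "(nat \<Rightarrow> nat) \<Rightarrow> (nat \<Rightarrow> nat \<Rightarrow> nat \<Rightarrow> bool) \<Rightarrow> nat \<Rightarrow> (nat \<Rightarrow> nat) \<Rightarrow> fo \<Rightarrow> bool" where
  "sat inp X m e (Inp s u a) \<longleftrightarrow> inp (e u + a) = s"
| "sat inp X m e (Rel k u a v b) \<longleftrightarrow> X k (e u + a) (e v + b)"
| "sat inp X m e (Not f) \<longleftrightarrow> \<not> sat inp X m e f"
| "sat inp X m e (Conj f g) \<longleftrightarrow> sat inp X m e f \<and> sat inp X m e g"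
| "sat inp X m e (Ex j f) \<longleftrightarrow> (\<exists>x<m. sat inp X m (e(j := x)) f)"

primrec qvars :: "fo \<Rightarrow> nat set" where
  "qvars (Inp s u a) = {}"
| "qvars (Rel k u a v b) = {}"
| "qvars (Not f) = qvars f"
| "qvars (Conj f g) = qvars f \<union> qvars g"
| "qvars (Ex j f) = insert j (qvars f)"

text \<open>These limits are those of the tape layout: twelve variables, eight relations, and
  offsets that stay within table rows of width \<open>m + 4\<close>. The condition on
  \<open>qvars\<close> keeps nested quantifiers from sharing the counters of
  \<open>j\<close>.\<close>

primrec okf :: "fo \<Rightarrow> bool" where
  "okf (Inp s u a) \<longleftrightarrow> u < 12 \<and> a \<le> 3"
| "okf (Rel k u a v b) \<longleftrightarrow> k < 8 \<and> u < 12 \<and> v < 12 \<and> a \<le> 3 \<and> b \<le> 3"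
| "okf (Not f) \<longleftrightarrow> okf f"
| "okf (Conj f g) \<longleftrightarrow> okf f \<and> okf g"
| "okf (Ex j f) \<longleftrightarrow> j < 12 \<and> j \<notin> qvars f \<and> okf f"

subsection \<open>Tapes as counters\<close>

text \<open>Tape 0 holds the input, tapes 1 to 8 the guessed relations. The other tapes are counters
  whose value is the head position: 9 is the flag, 10 and 11 are scratch, \<open>12 + 2 * j\<close> holds
  variable \<open>j\<close> and \<open>13 + 2 * j\<close> the partial result of its quantifier, 36 to 39 are used in the
  preparation. Symbol 3 marks position 0 of a counter and position -1 of the other tapes, symbol 4
  the end of the range.\<close>

abbreviation vart :: "nat \<Rightarrow> nat" where "vart j \<equiv> 12 + 2 * j"
abbreviation acct :: "nat \<Rightarrow> nat" where "acct j \<equiv> 13 + 2 * j"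

text \<open>A run with a determined result that leaves all tape contents as they are: evaluation
  computes with head positions only.\<close>

definition ev :: "(nat \<Rightarrow> int \<Rightarrow> nat) \<Rightarrow> prog \<Rightarrow> (nat \<Rightarrow> int) \<Rightarrow> nat \<Rightarrow> (nat \<Rightarrow> int) \<Rightarrow> bool" where
  "ev C p h n h' \<longleftrightarrow> tri p (h, C) n (\<lambda>s. s = (h', C))"

lemma ev_mono: "ev C p h n h' \<Longrightarrow> n \<le> n' \<Longrightarrow> ev C p h n' h'"
  unfolding ev_def by (erule tri_mono)

lemma ev_Mv: "ev C (Mv i d) h 1 (h(i := h i + d))"
  unfolding ev_def by (rule tri_Mv) simp

lemma ev_Mv0: "ev C (Mv i 0) h 1 h"
  using ev_Mv[of C i 0 h] by simp

lemma ev_Seq: "ev C p h a h1 \<Longrightarrow> ev C q h1 b h2 \<Longrightarrow> ev C (Seq p q) h (Suc (a + b)) h2"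
  unfolding ev_def by (erule tri_Seq) simp

lemma ev_If:
  "(C i (h i) = a \<Longrightarrow> ev C p h n h') \<Longrightarrow> (C i (h i) \<noteq> a \<Longrightarrow> ev C q h n h') \<Longrightarrow>
    ev C (If i a p q) h (Suc n) h'"
  unfolding ev_def by (rule tri_If) (simp_all add: reads_def)

lemma ev_If_True: "C i (h i) = a \<Longrightarrow> ev C p h n h' \<Longrightarrow> ev C (If i a p q) h (Suc n) h'"
  by (rule ev_If) simp_all

lemma ev_If_False: "C i (h i) \<noteq> a \<Longrightarrow> ev C q h n h' \<Longrightarrow> ev C (If i a p q) h (Suc n) h'"
  by (rule ev_If) simp_all

lemma ev_While:
  assumes "\<And>k. k < N \<Longrightarrow> C i (f k i) \<noteq> a" "\<And>k. k < N \<Longrightarrow> ev C p (f k) n (f (Suc k))"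
    and "C i (f N i) = a" "f 0 = h" "f N = h'"
  shows "ev C (While i a p) h (Suc (N * Suc n)) h'"
proof -
  have "tri (While i a p) (h, C) (Suc ((N - 0) * Suc n)) (\<lambda>s. s = (f N, C))"
    by (rule tri_While[of N "\<lambda>k s. s = (f k, C)"])
      (use assms in \<open>auto simp: ev_def reads_def\<close>)
  then show ?thesis using assms by (simp add: ev_def)
qed

section \<open>Counter programs and the evaluation of formulas\<close>

definition reset :: "nat \<Rightarrow> prog" where
  "reset i = While i 3 (Mv i (-1))"

lemma ev_reset:
  assumes "C i z = 3" "\<And>y. z < y \<Longrightarrow> C i y \<noteq> 3" "z \<le> h i"
  shows "ev C (reset i) h (Suc (nat (h i - z) * 2)) (h(i := z))"
proof -
  have "ev C (Mv i (-1)) (h(i := h i - int k)) 1 (h(i := h i - int (Suc k)))" for k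
    using ev_Mv[of C i "-1" "h(i := h i - int k)"] by (simp add: algebra_simps)
  then show ?thesis
    unfolding reset_def
    using assms ev_While[of "nat (h i - z)" C i "\<lambda>k. h(i := h i - int k)" 3 "Mv i (-1)" 1 h "h(i := z)"]
    by (simp add: numeral_2_eq_2)
qed

primrec reps :: "nat \<Rightarrow> nat \<Rightarrow> prog \<Rightarrow> prog" where
  "reps X 0 p = Mv X 0"
| "reps X (Suc k) p = Seq p (reps X k p)"

text \<open>Runs \<open>p\<close> once per unit of counter \<open>u\<close>. The count is parked on
  tape 10 and carried back, so \<open>u\<close> keeps its value.\<close>

definition forv :: "nat \<Rightarrow> prog \<Rightarrow> prog" where
  "forv u p = Seq (While u 3 (Seq (Mv u (-1)) (Seq (Mv 10 1) p)))
     (While 10 3 (Seq (Mv 10 (-1)) (Mv u 1)))"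

text \<open>Advances by one table row. The program cannot contain the number \<open>m\<close>, so it
  is measured by the end mark on tape 11; the remaining four cells leave room for offsets.\<close>

definition stride :: "nat \<Rightarrow> prog" where
  "stride X = Seq (While 11 4 (Seq (Mv 11 1) (Mv X 1))) (Seq (reset 11) (reps X 4 (Mv X 1)))"

text \<open>The marker of a work tape is at position -1, so after \<open>reset\<close> the head has
  to step right once to be at 0 again.\<close>

definition lookup :: "nat \<Rightarrow> prog \<Rightarrow> nat \<Rightarrow> prog" where
  "lookup X g a = Seq g (Seq (If X a (Mv 9 1) (Mv 9 0)) (Seq (reset X) (Mv X 1)))"

definition goto :: "nat \<Rightarrow> nat \<Rightarrow> nat \<Rightarrow> nat \<Rightarrow> nat \<Rightarrow> prog" where
  "goto X u a v b = Seq (forv u (stride X)) (Seq (reps X a (stride X))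
     (Seq (forv v (Mv X 1)) (reps X b (Mv X 1))))"

text \<open>The truth value is left in counter 9, which is 0 on entry. A conjunction returns it to 0
  before its second part. A quantifier tries all \<open>m\<close> values without early exit, records
  success in \<open>acct j\<close> and transfers it to the flag at the end.\<close>

primrec comp :: "fo \<Rightarrow> prog" where
  "comp (Inp s u a) = lookup 0 (Seq (forv (vart u) (Mv 0 1)) (reps 0 a (Mv 0 1))) s"
| "comp (Rel k u a v b) = lookup (Suc k) (goto (Suc k) (vart u) a (vart v) b) 2"
| "comp (Not f) = Seq (comp f) (If 9 3 (Mv 9 1) (Mv 9 (-1)))"
| "comp (Conj f g) = Seq (comp f) (If 9 3 (Mv 9 0) (Seq (Mv 9 (-1)) (comp g)))"
| "comp (Ex j f) =
    Seq (While (vart j) 4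
          (Seq (comp f)
          (Seq (If 9 3 (Mv 9 0) (Seq (Mv 9 (-1)) (If (acct j) 3 (Mv (acct j) 1) (Mv (acct j) 0))))
            (Mv (vart j) 1))))
    (Seq (reset (vart j)) (If (acct j) 3 (Mv 9 0) (Seq (Mv (acct j) (-1)) (Mv 9 1))))"

primrec comp_time :: "nat \<Rightarrow> fo \<Rightarrow> nat" where
  "comp_time m (Inp s u a) = 100 * (m + 4) ^ 2"
| "comp_time m (Rel k u a v b) = 100 * (m + 4) ^ 2"
| "comp_time m (Not f) = comp_time m f + 3"
| "comp_time m (Conj f g) = comp_time m f + comp_time m g + 4"
| "comp_time m (Ex j f) = (m + 4) * (comp_time m f + 20)"

lemma comp_time_poly: "\<exists>c d. \<forall>m. comp_time m f \<le> c * (m + 4) ^ d"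
proof (induction f)
  case (Not f)
  then obtain c d where "\<And>m. comp_time m f \<le> c * (m + 4) ^ d" by blast
  then have "comp_time m (Not f) \<le> (c + 3) * (m + 4) ^ d" for m
    using add_mono[of _ _ 3 "3 * (m + 4) ^ d"] by (simp add: add_mult_distrib)
  then show ?case by blast
next
  case (Conj f g)
  then obtain c d c' d' where *: "\<And>m. comp_time m f \<le> c * (m + 4) ^ d"
    "\<And>m. comp_time m g \<le> c' * (m + 4) ^ d'" by blast
  have "comp_time m (Conj f g) \<le> (c + c' + 4) * (m + 4) ^ (d + d')" for m
  proof -
    have 1: "1 \<le> (m + 4) ^ d" "1 \<le> (m + 4) ^ d'" by simp_all
    have "c * (m + 4) ^ d \<le> c * (m + 4) ^ (d + d')" "c' * (m + 4) ^ d' \<le> c' * (m + 4) ^ (d + d')"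
      by (simp_all add: power_increasing)
    moreover have "4 \<le> 4 * (m + 4) ^ (d + d')" by simp
    ultimately have "comp_time m f + comp_time m g + 4 \<le>
      c * (m + 4) ^ (d + d') + c' * (m + 4) ^ (d + d') + 4 * (m + 4) ^ (d + d')"
      using *[of m] by linarith
    then show ?thesis by (simp add: add_mult_distrib)
  qed
  then show ?case by blast
next
  case (Ex j f)
  then obtain c d where *: "\<And>m. comp_time m f \<le> c * (m + 4) ^ d" by blast
  have "comp_time m (Ex j f) \<le> (c + 20) * (m + 4) ^ Suc d" for m
  proof -
    have "comp_time m f + 20 \<le> (c + 20) * (m + 4) ^ d"
      using *[of m] add_mono[of _ _ 20 "20 * (m + 4) ^ d"] by (simp add: add_mult_distrib)
    then have "(m + 4) * (comp_time m f + 20) \<le> (m + 4) * ((c + 20) * (m + 4) ^ d)"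
      by (rule mult_le_mono2)
    then show ?thesis by (simp add: ac_simps)
  qed
  then show ?case by blast
qed (auto intro: exI[of _ 100] exI[of _ 2])

section \<open>Effect and running time of the counter programs\<close>

locale counters =
  fixes C :: "nat \<Rightarrow> int \<Rightarrow> nat"
  assumes counter: "\<lbrakk>9 \<le> i; i < 40\<rbrakk> \<Longrightarrow> C i 0 = 3" "\<lbrakk>9 \<le> i; i < 40; 0 < z\<rbrakk> \<Longrightarrow> C i z \<noteq> 3"
begin

text \<open>The scratch counter 11 must be 0 because \<open>stride\<close> measures with it. The
  case \<open>X = 11\<close> is excepted since the preparation of the end marks moves head 11
  itself.\<close>

definition adv :: "prog \<Rightarrow> nat \<Rightarrow> nat \<Rightarrow> nat \<Rightarrow> bool" where
  "adv p X d n \<longleftrightarrow> (\<forall>h. X = 11 \<or> h 11 = 0 \<longrightarrow> ev C p h n (h(X := h X + int d)))"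

lemma advD: "adv p X d n \<Longrightarrow> X = 11 \<or> h 11 = 0 \<Longrightarrow> ev C p h n (h(X := h X + int d))"
  unfolding adv_def by blast

lemma adv_Mv: "adv (Mv X 1) X 1 1"
  using ev_Mv by (simp add: adv_def)

lemma adv_reps: "adv p X d n \<Longrightarrow> adv (reps X k p) X (k * d) (Suc (k * Suc n))"
proof (induction k)
  case 0
  then show ?case using ev_Mv0 by (simp add: adv_def)
next
  case (Suc k)
  show ?case
    unfolding adv_def
  proof (intro allI impI)
    fix h :: "nat \<Rightarrow> int" assume h: "X = 11 \<or> h 11 = 0"
    let ?h = "h(X := h X + int d)"
    have "ev C (reps X k p) ?h (Suc (k * Suc n)) (?h(X := ?h X + int (k * d)))"
      by (rule advD[OF Suc.IH[OF Suc.prems]]) (use h in auto)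
    then have "ev C (reps X k p) ?h (Suc (k * Suc n)) (h(X := h X + int d + int (k * d)))" by simp
    moreover have "ev C p h n ?h" by (rule advD[OF Suc.prems]) (rule h)
    ultimately have "ev C (reps X (Suc k) p) h (Suc (n + Suc (k * Suc n))) (h(X := h X + int d + int (k * d)))"
      unfolding reps.simps by (rule ev_Seq[rotated])
    then show "ev C (reps X (Suc k) p) h (Suc (Suc k * Suc n)) (h(X := h X + int (Suc k * d)))"
      by (simp add: algebra_simps)
  qed
qed

lemma ev_forv:
  assumes p: "adv p X d n" and h: "h 11 = 0" "h 10 = 0" "0 \<le> h u"
    and ne: "9 \<le> u" "u < 40" "u \<noteq> X" "u \<noteq> 10" "u \<noteq> 11" "X \<noteq> 10"
  shows "ev C (forv u p) h (3 + nat (h u) * (n + 9)) (h(X := h X + h u * int d))"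
proof -
  let ?N = "nat (h u)"
  define f where "f k = h(u := h u - int k, 10 := int k, X := h X + int k * int d)" for k
  define g where "g k = h(u := int k, 10 := h u - int k, X := h X + h u * int d)" for k
  have f: "ev C (Seq (Mv u (-1)) (Seq (Mv 10 1) p)) (f k) (Suc (1 + Suc (1 + n))) (f (Suc k))" for k
  proof (rule ev_Seq[OF ev_Mv ev_Seq[OF ev_Mv]])
    let ?h = "(f k)(u := f k u + - 1)"
    have "X = 11 \<or> (?h(10 := ?h 10 + 1)) 11 = 0" using h ne by (simp add: f_def)
    then have "ev C p (?h(10 := ?h 10 + 1)) n ((?h(10 := ?h 10 + 1))(X := (?h(10 := ?h 10 + 1)) X + int d))"
      using p unfolding adv_def by blast
    moreover have "(?h(10 := ?h 10 + 1))(X := (?h(10 := ?h 10 + 1)) X + int d) = f (Suc k)"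
      using ne by (auto simp: f_def fun_eq_iff algebra_simps)
    ultimately show "ev C p (?h(10 := ?h 10 + 1)) n (f (Suc k))" by simp
  qed
  have g: "ev C (Seq (Mv 10 (-1)) (Mv u 1)) (g k) (Suc (1 + 1)) (g (Suc k))" for k
  proof -
    have "(g k)(10 := g k 10 + - 1, u := ((g k)(10 := g k 10 + - 1)) u + 1) = g (Suc k)"
      using ne by (auto simp: g_def)
    then show ?thesis using ev_Seq[OF ev_Mv[of C 10 "-1" "g k"] ev_Mv[of C u 1]] by simp
  qed
  have "ev C (While u 3 (Seq (Mv u (-1)) (Seq (Mv 10 1) p))) h (Suc (?N * Suc (Suc (1 + Suc (1 + n))))) (f ?N)"
    by (rule ev_While[where f = f]) (use f h ne counter in \<open>auto simp: f_def\<close>)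
  moreover have "ev C (While 10 3 (Seq (Mv 10 (-1)) (Mv u 1))) (f ?N) (Suc (?N * Suc (Suc (1 + 1)))) (g ?N)"
    by (rule ev_While[where f = g]) (use g h ne counter in \<open>auto simp: f_def g_def\<close>)
  ultimately have "ev C (forv u p) h (Suc (Suc (?N * Suc (Suc (1 + Suc (1 + n)))) + Suc (?N * Suc (Suc (1 + 1))))) (g ?N)"
    unfolding forv_def by (rule ev_Seq)
  moreover have "g ?N = h(X := h X + h u * int d)" using h ne by (auto simp: g_def)
  moreover have "Suc (Suc (?N * Suc (Suc (1 + Suc (1 + n)))) + Suc (?N * Suc (Suc (1 + 1)))) = 3 + ?N * (n + 9)"
    by (simp add: algebra_simps)
  ultimately show ?thesis by metis
qed

end

locale layout = counters +
  fixes m :: nat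
  assumes end_mark: "\<lbrakk>11 \<le> i; i < 36; i = 11 \<or> even i\<rbrakk> \<Longrightarrow> C i (int m) = 4"
      "\<lbrakk>11 \<le> i; i < 36; i = 11 \<or> even i; 0 \<le> z; z < int m\<rbrakk> \<Longrightarrow> C i z \<noteq> 4"
    and work: "i \<le> 8 \<Longrightarrow> C i (-1) = 3" "\<lbrakk>i \<le> 8; 0 \<le> z\<rbrakk> \<Longrightarrow> C i z \<noteq> 3"
begin

lemma adv_stride:
  assumes "X \<noteq> 11"
  shows "adv (stride X) X (m + 4) (6 * m + 13)"
  unfolding adv_def
proof (intro allI impI)
  fix h :: "nat \<Rightarrow> int" assume "X = 11 \<or> h 11 = 0"
  then have h: "h 11 = 0" using assms by simp
  define f where "f k = h(11 := int k, X := h X + int k)" for k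
  have f: "ev C (Seq (Mv 11 1) (Mv X 1)) (f k) (Suc (1 + 1)) (f (Suc k))" for k
  proof -
    have "(f k)(11 := f k 11 + 1, X := ((f k)(11 := f k 11 + 1)) X + 1) = f (Suc k)"
      using assms by (auto simp: f_def)
    then show ?thesis using ev_Seq[OF ev_Mv[of C 11 1 "f k"] ev_Mv[of C X 1]] by simp
  qed
  have 1: "ev C (While 11 4 (Seq (Mv 11 1) (Mv X 1))) h (Suc (m * Suc (Suc (1 + 1)))) (f m)"
    by (rule ev_While[where f = f]) (use f h assms end_mark in \<open>auto simp: f_def\<close>)
  have 2: "ev C (reset 11) (f m) (Suc (nat (f m 11 - 0) * 2)) ((f m)(11 := 0))"
    by (rule ev_reset) (use counter assms in \<open>auto simp: f_def\<close>)
  let ?h = "(f m)(11 := 0)"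
  have 3: "ev C (reps X 4 (Mv X 1)) ?h (Suc (4 * Suc 1)) (?h(X := ?h X + int (4 * 1)))"
    by (rule advD[OF adv_reps[OF adv_Mv]]) (use assms in auto)
  have e: "?h(X := ?h X + int (4 * 1)) = h(X := h X + int (m + 4))"
    using assms h by (auto simp: f_def)
  have "nat (f m 11 - 0) = m" using assms by (simp add: f_def)
  then show "ev C (stride X) h (6 * m + 13) (h(X := h X + int (m + 4)))"
    using ev_Seq[OF 1 ev_Seq[OF 2 3]] unfolding stride_def e by (simp add: algebra_simps eval_nat_numeral)
qed

lemma ev_lookup:
  assumes g: "ev C g h n (h(X := int q))" and h: "h X = 0" "h 9 = 0" and X: "X \<le> 8"
  shows "ev C (lookup X g a) h (n + 2 * q + 9) (h(9 := if C X (int q) = a then 1 else 0))"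
proof -
  let ?h = "h(X := int q)" and ?r = "if C X (int q) = a then 1 else 0 :: int"
  have 1: "ev C (If X a (Mv 9 1) (Mv 9 0)) ?h (Suc 1) (?h(9 := ?r))"
  proof (rule ev_If)
    have "?h(9 := 0) = ?h" using h X by auto
    then show "C X (?h X) \<noteq> a \<Longrightarrow> ev C (Mv 9 0) ?h 1 (?h(9 := ?r))" using ev_Mv0[of C 9 ?h] by simp
    show "C X (?h X) = a \<Longrightarrow> ev C (Mv 9 1) ?h 1 (?h(9 := ?r))" using ev_Mv[of C 9 1 ?h] h X by simp
  qed
  have 2: "ev C (reset X) (?h(9 := ?r)) (Suc (nat ((?h(9 := ?r)) X - (-1)) * 2)) (?h(9 := ?r, X := -1))"
    by (rule ev_reset) (use work X in auto)
  have 3: "ev C (Mv X 1) (?h(9 := ?r, X := -1)) 1 (h(9 := ?r))"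
    using ev_Mv[of C X 1 "?h(9 := ?r, X := -1)"] h X by (simp add: fun_upd_twist fun_upd_idem)
  have "nat ((?h(9 := ?r)) X - (-1)) = q + 1"
  proof -
    have "X \<noteq> 9" using X by simp
    then show ?thesis by (simp add: nat_add_distrib)
  qed
  moreover have "Suc (n + Suc (Suc 1 + Suc (Suc (x * 2) + 1))) = n + 2 * q + 9" if "x = q + 1" for x
    using that by simp
  ultimately have "Suc (n + Suc (Suc 1 + Suc (Suc (nat ((?h(9 := ?r)) X - (-1)) * 2) + 1))) = n + 2 * q + 9"
    by blast
  then show ?thesis
    using ev_Seq[OF g ev_Seq[OF 1 ev_Seq[OF 2 3]]] unfolding lookup_def by metis
qed

lemma ev_goto:
  assumes h: "h 11 = 0" "h 10 = 0" "h X = 0" and X: "X \<le> 8"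
    and u: "12 \<le> u" "u < 40" "0 \<le> h u" "h u < int m" and v: "12 \<le> v" "v < 40" "0 \<le> h v" "h v < int m"
    and ab: "a \<le> 3" "b \<le> 3"
  shows "\<exists>n. ev C (goto X u a v b) h n (h(X := int ((nat (h u) + a) * (m + 4) + (nat (h v) + b)))) \<and>
    n \<le> 80 * (m + 4) ^ 2"
proof -
  let ?M = "m + 4" and ?U = "nat (h u)" and ?V = "nat (h v)"
  have X11: "X \<noteq> 11" and X10: "X \<noteq> 10" using X by auto
  define h1 where "h1 = h(X := h X + h u * int ?M)"
  define h2 where "h2 = h1(X := h1 X + int (a * ?M))"
  define h3 where "h3 = h2(X := h2 X + h2 v * int 1)"
  define h4 where "h4 = h3(X := h3 X + int (b * 1))"
  have 1: "ev C (forv u (stride X)) h (3 + ?U * (6 * m + 13 + 9)) h1"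
    unfolding h1_def by (rule ev_forv[OF adv_stride[OF X11]]) (use h u X in auto)
  have 2: "ev C (reps X a (stride X)) h1 (Suc (a * Suc (6 * m + 13))) h2"
    unfolding h2_def by (rule advD[OF adv_reps[OF adv_stride[OF X11]]]) (use h X in \<open>auto simp: h1_def\<close>)
  have v2: "h2 v = h v" using v X by (auto simp: h2_def h1_def)
  have 3: "ev C (forv v (Mv X 1)) h2 (3 + nat (h2 v) * (1 + 9)) h3"
    unfolding h3_def by (rule ev_forv[OF adv_Mv]) (use h v v2 X in \<open>auto simp: h1_def h2_def\<close>)
  have 4: "ev C (reps X b (Mv X 1)) h3 (Suc (b * Suc 1)) h4"
    unfolding h4_def by (rule advD[OF adv_reps[OF adv_Mv]]) (use h X in \<open>auto simp: h1_def h2_def h3_def\<close>)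
  have e: "h4 = h(X := int ((?U + a) * ?M + (?V + b)))"
    using h u v v2 by (auto simp: h4_def h3_def h2_def h1_def algebra_simps)
  let ?n = "Suc ((3 + ?U * (6 * m + 13 + 9)) + Suc (Suc (a * Suc (6 * m + 13)) +
    Suc ((3 + nat (h2 v) * (1 + 9)) + Suc (b * Suc 1))))"
  have "ev C (goto X u a v b) h ?n h4"
    unfolding goto_def by (rule ev_Seq[OF 1 ev_Seq[OF 2 ev_Seq[OF 3 4]]])
  moreover have "?n \<le> 80 * ?M ^ 2"
  proof -
    have "?U * (6 * m + 13 + 9) \<le> ?M * (6 * ?M)" by (rule mult_le_mono) (use u in auto)
    moreover have "a * Suc (6 * m + 13) \<le> 3 * (6 * ?M)" by (rule mult_le_mono) (use ab in auto)
    moreover have "nat (h2 v) * (1 + 9) \<le> ?M * 10" using v v2 by auto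
    moreover have "b * Suc 1 \<le> 6" using ab by auto
    moreover have "?M * 4 \<le> ?M * ?M" by (rule mult_le_mono2) simp
    moreover have "4 * 4 \<le> ?M * ?M" by (rule mult_le_mono) auto
    ultimately show ?thesis unfolding power2_eq_square by linarith
  qed
  ultimately show ?thesis unfolding e by blast
qed

definition inp :: "nat \<Rightarrow> nat" where "inp z = C 0 (int z)"
definition rel :: "nat \<Rightarrow> nat \<Rightarrow> nat \<Rightarrow> bool" where
  "rel k u v \<longleftrightarrow> C (Suc k) (int (u * (m + 4) + v)) = 2"

definition clean :: "(nat \<Rightarrow> int) \<Rightarrow> bool" where
  "clean h \<longleftrightarrow> (\<forall>i\<le>11. h i = 0) \<and> (\<forall>j<12. 0 \<le> h (vart j) \<and> h (vart j) < int m)"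

lemma lookup_time:
  fixes n p q y :: nat
  assumes "p \<le> y * y" "q \<le> y" "4 \<le> y" "n \<le> 80 * y ^ 2"
  shows "n + 2 * (p + q) + 9 \<le> 100 * y ^ 2"
proof -
  have "4 * y \<le> y ^ 2" using assms(3) by (simp add: power2_eq_square)
  moreover have "p \<le> y ^ 2" using assms(1) by (simp add: power2_eq_square)
  ultimately show ?thesis using assms(2-4) by simp
qed

text \<open>All heads except the flag are restored. This lets a quantifier run \<open>comp f\<close>
  again in each round, with its own counters untouched and those of the inner quantifiers back at
  0.\<close>

lemma ev_comp:
  assumes "okf f" "clean h" "\<And>j. j \<in> qvars f \<Longrightarrow> h (vart j) = 0 \<and> h (acct j) = 0"
  shows "ev C (comp f) h (comp_time m f)
    (h(9 := if sat inp rel m (\<lambda>j. nat (h (vart j))) f then 1 else 0))"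
  using assms
proof (induction f arbitrary: h)
  case (Inp s u a)
  let ?M = "m + 4" and ?U = "nat (h (vart u))"
  have h: "h 11 = 0" "h 10 = 0" "h 0 = 0" "h 9 = 0" "0 \<le> h (vart u)" "h (vart u) < int m"
    and u: "u < 12" "a \<le> 3" using Inp by (auto simp: clean_def)
  let ?h = "h(0 := h 0 + h (vart u) * int 1)"
  have 1: "ev C (forv (vart u) (Mv 0 1)) h (3 + ?U * (1 + 9)) ?h"
    by (rule ev_forv[OF adv_Mv]) (use h u in auto)
  have 2: "ev C (reps 0 a (Mv 0 1)) ?h (Suc (a * Suc 1)) (?h(0 := ?h 0 + int (a * 1)))"
    by (rule advD[OF adv_reps[OF adv_Mv]]) (use h in auto)
  have "?h(0 := ?h 0 + int (a * 1)) = h(0 := int (?U + a))" using h by auto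
  from ev_lookup[OF ev_Seq[OF 1 2, unfolded this] h(3,4), of s]
  have "ev C (comp (Inp s u a)) h (Suc (3 + ?U * (1 + 9) + Suc (a * Suc 1)) + 2 * (?U + a) + 9)
    (h(9 := if sat inp rel m (\<lambda>j. nat (h (vart j))) (Inp s u a) then 1 else 0))"
    by (simp add: inp_def)
  moreover have "Suc (3 + ?U * (1 + 9) + Suc (a * Suc 1)) + 2 * (?U + a) + 9 \<le> 100 * ?M ^ 2"
  proof -
    have *: "12 * x + 4 * a + 14 \<le> 100 * y ^ 2" if "x \<le> y" "4 \<le> y" for x y :: nat
    proof -
      have "y * 4 \<le> y * y" using that by simp
      then show ?thesis using that u unfolding power2_eq_square by linarith
    qed
    have "12 * ?U + 4 * a + 14 \<le> 100 * ?M ^ 2" by (rule *) (use h in linarith)+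
    then show ?thesis by simp
  qed
  ultimately show ?case unfolding comp_time.simps by (rule ev_mono)
next
  case (Rel k u a v b)
  let ?M = "m + 4" and ?U = "nat (h (vart u))" and ?V = "nat (h (vart v))"
  have h: "h 11 = 0" "h 10 = 0" "h (Suc k) = 0" "h 9 = 0" "0 \<le> h (vart u)" "h (vart u) < int m"
    "0 \<le> h (vart v)" "h (vart v) < int m"
    and u: "k < 8" "u < 12" "v < 12" "a \<le> 3" "b \<le> 3" using Rel by (auto simp: clean_def)
  let ?q = "(?U + a) * ?M + (?V + b)"
  obtain n where n: "ev C (goto (Suc k) (vart u) a (vart v) b) h n (h(Suc k := int ?q))" "n \<le> 80 * ?M ^ 2"
    using ev_goto[of h "Suc k" "vart u" "vart v" a b] h u by auto
  have "ev C (comp (Rel k u a v b)) h (n + 2 * ?q + 9)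
    (h(9 := if sat inp rel m (\<lambda>j. nat (h (vart j))) (Rel k u a v b) then 1 else 0))"
    using ev_lookup[OF n(1) h(3,4), of 2] u by (simp add: rel_def)
  moreover have "n + 2 * ?q + 9 \<le> 100 * ?M ^ 2"
  proof -
    show ?thesis
      by (rule lookup_time, rule mult_le_mono) (use h u n(2) in linarith)+
  qed
  ultimately show ?case unfolding comp_time.simps by (rule ev_mono)
next
  case (Not f)
  let ?s = "sat inp rel m (\<lambda>j. nat (h (vart j))) f"
  let ?h = "h(9 := if ?s then 1 else 0)"
  have 1: "ev C (comp f) h (comp_time m f) ?h" by (rule Not.IH) (use Not.prems in auto)
  have "ev C (If 9 3 (Mv 9 1) (Mv 9 (-1))) ?h (Suc 1) (h(9 := if \<not> ?s then 1 else 0))"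
    by (rule ev_If) (use ev_Mv[of C 9 1 ?h] ev_Mv[of C 9 "-1" ?h] counter in \<open>auto split: if_splits\<close>)
  from ev_Seq[OF 1 this] show ?case unfolding comp.simps comp_time.simps sat.simps by (rule ev_mono) simp
next
  case (Conj f g)
  let ?s = "\<lambda>f. sat inp rel m (\<lambda>j. nat (h (vart j))) f"
  let ?h = "h(9 := if ?s f then 1 else 0)"
  have h9: "h 9 = 0" using Conj.prems by (simp add: clean_def)
  have 1: "ev C (comp f) h (comp_time m f) ?h" by (rule Conj.IH) (use Conj.prems in auto)
  have g: "ev C (comp g) h (comp_time m g) (h(9 := if ?s g then 1 else 0))"
    by (rule Conj.IH) (use Conj.prems in auto)
  have "ev C (If 9 3 (Mv 9 0) (Seq (Mv 9 (-1)) (comp g))) ?h (Suc (Suc (1 + comp_time m g)))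
    (h(9 := if ?s f \<and> ?s g then 1 else 0))"
  proof (rule ev_If)
    assume "C 9 (?h 9) = 3"
    then have "\<not> ?s f" using counter(2)[of 9 1] by auto
    then show "ev C (Mv 9 0) ?h (Suc (1 + comp_time m g)) (h(9 := if ?s f \<and> ?s g then 1 else 0))"
      using ev_mono[OF ev_Mv0[of C 9 ?h]] by simp
  next
    assume "C 9 (?h 9) \<noteq> 3"
    then have s: "?s f" using counter(1)[of 9] by (auto split: if_splits)
    have "?h(9 := ?h 9 + - 1) = h" using s h9 by auto
    then show "ev C (Seq (Mv 9 (-1)) (comp g)) ?h (Suc (1 + comp_time m g)) (h(9 := if ?s f \<and> ?s g then 1 else 0))"
      using ev_Seq[OF ev_Mv[of C 9 "-1" ?h]] g s by simp
  qed
  from ev_Seq[OF 1 this] show ?case unfolding comp.simps comp_time.simps sat.simps by (rule ev_mono) simp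
next
  case (Ex j f)
  let ?v = "vart j" and ?a = "acct j"
  have j: "j < 12" "j \<notin> qvars f" "okf f" and h0: "h ?v = 0" "h ?a = 0" "h 9 = 0"
    using Ex.prems by (auto simp: clean_def)
  define S where "S k \<longleftrightarrow> sat inp rel m ((\<lambda>j. nat (h (vart j)))(j := k)) f" for k
  \<comment> \<open>The head positions after \<open>k\<close> rounds: the variable stands at
    \<open>k\<close>, and the partial result tells whether one of the first \<open>k\<close> values
    succeeded.\<close>
  define g where "g k = h(?v := int k, ?a := if \<exists>x<k. S x then 1 else 0)" for k
  have vv: "vart i \<noteq> ?a" "acct i \<noteq> ?v" for i by presburger+
  have env: "(\<lambda>i. nat (g k (vart i))) = (\<lambda>j. nat (h (vart j)))(j := k)" for k
    using vv by (auto simp: g_def fun_eq_iff)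
  have body: "ev C (Seq (comp f)
          (Seq (If 9 3 (Mv 9 0) (Seq (Mv 9 (-1)) (If ?a 3 (Mv ?a 1) (Mv ?a 0))))
            (Mv ?v 1))) (g k) (comp_time m f + 10) (g (Suc k))" if k: "k < m" for k
  proof -
    let ?g = "(g k)(9 := if S k then 1 else 0)"
    have "clean (g k)"
      using Ex.prems(2) k vv by (auto simp: clean_def g_def)
    moreover have "g k (vart i) = 0 \<and> g k (acct i) = 0" if "i \<in> qvars f" for i
      using Ex.prems(3)[of i] that j vv by (auto simp: g_def)
    ultimately have "ev C (comp f) (g k) (comp_time m f)
        ((g k)(9 := if sat inp rel m (\<lambda>i. nat (g k (vart i))) f then 1 else 0))"
      by (rule Ex.IH[OF j(3)])
    then have 1: "ev C (comp f) (g k) (comp_time m f) ?g" unfolding env S_def .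
    define g1 where "g1 = h(?v := int k, ?a := if \<exists>x<Suc k. S x then 1 else 0)"
    have 2: "ev C (If 9 3 (Mv 9 0) (Seq (Mv 9 (-1)) (If ?a 3 (Mv ?a 1) (Mv ?a 0)))) ?g 5 g1"
    proof (cases "S k")
      case False
      then have "?g = g1" using h0 vv by (auto simp: g1_def g_def less_Suc_eq fun_eq_iff)
      moreover have "C 9 (g1 9) = 3" using h0 counter(1)[of 9] by (simp add: g1_def)
      ultimately show ?thesis
        using ev_If[of C 9 ?g 3 "Mv 9 0" 4 g1] ev_mono[OF ev_Mv0[of C 9 g1], of 4] by simp
    next
      case True
      then have n3: "C 9 (?g 9) \<noteq> 3" using counter(2)[of 9 1] by simp
      have e: "?g(9 := ?g 9 + - 1) = g k" using True h0 by (auto simp: g_def)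
      have "ev C (If ?a 3 (Mv ?a 1) (Mv ?a 0)) (g k) (Suc 1) g1"
      proof (rule ev_If)
        assume "C ?a (g k ?a) = 3"
        then have "\<not> (\<exists>x<k. S x)" using counter(2)[of ?a 1] j by (auto simp: g_def split: if_splits)
        then have "(g k)(?a := g k ?a + 1) = g1" using True by (auto simp: g_def g1_def)
        then show "ev C (Mv ?a 1) (g k) 1 g1" using ev_Mv[of C ?a 1 "g k"] by simp
      next
        assume "C ?a (g k ?a) \<noteq> 3"
        then have "\<exists>x<k. S x" using counter(1)[of ?a] j by (auto simp: g_def split: if_splits)
        then have "g k = g1" using True by (auto simp: g_def g1_def less_Suc_eq)
        then show "ev C (Mv ?a 0) (g k) 1 g1" using ev_Mv0[of C ?a g1] by simp
      qed
      then have "ev C (Seq (Mv 9 (-1)) (If ?a 3 (Mv ?a 1) (Mv ?a 0))) ?g (Suc (1 + Suc 1)) g1"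
        using ev_Seq[OF ev_Mv[of C 9 "-1" ?g]] unfolding e by blast
      then show ?thesis
        using n3 ev_If[of C 9 ?g 3 "Mv 9 0" 4 g1] ev_mono[of C _ ?g "Suc (1 + Suc 1)" g1 4] by simp
    qed
    have 3: "ev C (Mv ?v 1) g1 1 (g (Suc k))"
    proof -
      have "g1(?v := g1 ?v + 1) = g (Suc k)" using vv by (auto simp: g1_def g_def fun_eq_iff)
      then show ?thesis using ev_Mv[of C ?v 1 g1] by simp
    qed
    show ?thesis
      by (rule ev_mono[OF ev_Seq[OF 1 ev_Seq[OF 2 3]]]) simp
  qed
  define r where "r \<longleftrightarrow> (\<exists>x<m. S x)"
  have 1: "ev C (While ?v 4 (Seq (comp f)
          (Seq (If 9 3 (Mv 9 0) (Seq (Mv 9 (-1)) (If ?a 3 (Mv ?a 1) (Mv ?a 0))))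
            (Mv ?v 1)))) h (Suc (m * Suc (comp_time m f + 10))) (g m)"
    by (rule ev_While[where f = g]) (use body end_mark j h0 vv in \<open>auto simp: g_def\<close>)
  have 2: "ev C (reset ?v) (g m) (Suc (nat (g m ?v - 0) * 2)) ((g m)(?v := 0))"
    by (rule ev_reset) (use counter j in \<open>auto simp: g_def\<close>)
  have gm: "(g m)(?v := 0) = h(?a := if r then 1 else 0)"
    using h0 vv by (auto simp: g_def r_def fun_eq_iff)
  let ?g = "h(?a := if r then 1 else 0)"
  have 3: "ev C (If ?a 3 (Mv 9 0) (Seq (Mv ?a (-1)) (Mv 9 1))) ?g 4 (h(9 := if r then 1 else 0))"
  proof (cases r)
    case False
    then have "C ?a (?g ?a) = 3" "?g = h(9 := if r then 1 else 0)" using h0 counter(1)[of ?a] j by auto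
    then have "ev C (If ?a 3 (Mv 9 0) (Seq (Mv ?a (-1)) (Mv 9 1))) ?g (Suc 1) (h(9 := if r then 1 else 0))"
      using ev_If_True[OF _ ev_Mv0] by metis
    then show ?thesis by (rule ev_mono) simp
  next
    case True
    then have n3: "C ?a (?g ?a) \<noteq> 3" using counter(2)[of ?a 1] j by simp
    have "?g(?a := ?g ?a + - 1) = h" using True h0 by auto
    then have "ev C (Seq (Mv ?a (-1)) (Mv 9 1)) ?g (Suc (1 + 1)) (h(9 := 1))"
      using ev_Seq[OF ev_Mv[of C ?a "-1" ?g] ev_Mv[of C 9 1]] h0 by simp
    from ev_If_False[OF n3 this] show ?thesis using True by (simp add: eval_nat_numeral)
  qed
  have A: "ev C (comp (Ex j f)) h
    (Suc (Suc (m * Suc (comp_time m f + 10)) + Suc (Suc (nat (g m ?v - 0) * 2) + 4))) (h(9 := if r then 1 else 0))"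
    unfolding comp.simps by (rule ev_Seq[OF 1 ev_Seq[OF 2[unfolded gm] 3]])
  have B: "Suc (Suc (m * Suc (comp_time m f + 10)) + Suc (Suc (nat (g m ?v - 0) * 2) + 4)) \<le> comp_time m (Ex j f)"
    using vv by (simp add: g_def algebra_simps)
  have D: "sat inp rel m (\<lambda>j. nat (h (vart j))) (Ex j f) = r" by (simp add: r_def S_def)
  show ?case unfolding D by (rule ev_mono[OF A B])
qed

end

section \<open>Separation as a first-order property\<close>

definition Orf where "Orf f g = Not (Conj (Not f) (Not g))"
definition Impf where "Impf f g = Not (Conj f (Not g))"
definition Iff where "Iff f g = Conj (Impf f g) (Impf g f)"
definition All where "All j f = Not (Ex j (Not f))"

lemmas fo_defs = Orf_def Impf_def Iff_def All_def

lemma sat_derived [simp]: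
  "sat inp X m e (Orf f g) \<longleftrightarrow> sat inp X m e f \<or> sat inp X m e g"
  "sat inp X m e (Impf f g) \<longleftrightarrow> (sat inp X m e f \<longrightarrow> sat inp X m e g)"
  "sat inp X m e (Iff f g) \<longleftrightarrow> (sat inp X m e f \<longleftrightarrow> sat inp X m e g)"
  "sat inp X m e (All j f) \<longleftrightarrow> (\<forall>x<m. sat inp X m (e(j := x)) f)"
  by (auto simp: fo_defs)

text \<open>Meaning of the guessed relations: \<open>EQ\<close> is equality; \<open>NM\<close> and \<open>FM\<close> say that a numeral
  or a formula extends from one position to another; \<open>SM\<close> that the numerals at two positions
  agree; \<open>SB\<close> that a position starts a subformula of the formula at another one; \<open>TR\<close> that the
  formula at a position is true at a world; \<open>RR\<close> and \<open>ZZ\<close> are accessibility and bisimulation.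
  Variable 0 is never quantified and has the value 0, and variable 1 is the position of the
  second formula.\<close>

abbreviation "EQ \<equiv> Rel 0"
abbreviation "NM \<equiv> Rel 1"
abbreviation "SM \<equiv> Rel 2"
abbreviation "FM \<equiv> Rel 3"
abbreviation "SB \<equiv> Rel 4"
abbreviation "TR \<equiv> Rel 5"
abbreviation "RR \<equiv> Rel 6"
abbreviation "ZZ \<equiv> Rel 7"

definition cd :: "nat \<Rightarrow> nat \<Rightarrow> nat \<Rightarrow> nat \<Rightarrow> fo" where
  "cd i a b c = Conj (Inp a i 0) (Conj (Inp b i 1) (Inp c i 2))"

definition bin :: "nat \<Rightarrow> fo" where
  "bin i = Orf (cd i 1 2 1) (Orf (cd i 1 2 2) (cd i 2 1 1))"

text \<open>Each relation is specified by its recursion equation. Recursive calls move along the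
  word in one direction, so the equations have a single solution on the relevant positions. Symbol 1
  stands for \<open>False\<close>, 2 for \<open>True\<close> and 0 for a place outside the
  word.\<close>

definition parse_fo :: fo where
  "parse_fo =
     Conj (EQ 0 0 0 0)
    (Conj (All 2 (Conj (Not (EQ 0 0 2 1)) (Not (EQ 2 1 0 0))))
    (Conj (All 2 (All 3 (Iff (EQ 2 1 3 1) (EQ 2 0 3 0))))
    (Conj (All 2 (All 3 (Iff (NM 2 0 3 0)
       (Orf (Conj (Inp 1 2 0) (EQ 2 1 3 0))
         (Conj (Inp 2 2 0) (Conj (Not (Inp 0 2 1)) (Conj (NM 2 2 3 0) (Impf (Inp 1 2 2) (Inp 2 2 1)))))))))
    (Conj (All 2 (All 3 (Iff (SM 2 0 3 0)
       (Orf (Conj (Inp 1 2 0) (Inp 1 3 0))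
         (Conj (Conj (Inp 2 2 0) (Inp 2 3 0)) (Conj (Iff (Inp 2 2 1) (Inp 2 3 1)) (SM 2 2 3 2)))))))
    (Conj (All 2 (All 3 (Iff (FM 2 0 3 0)
       (Orf (Conj (cd 2 1 1 1) (NM 2 3 3 0))
       (Orf (Conj (cd 2 1 1 2) (EQ 2 3 3 0))
       (Orf (Conj (bin 2) (Ex 4 (Conj (FM 2 3 4 0) (FM 4 0 3 0))))
            (Conj (cd 2 2 1 2) (FM 2 3 3 0))))))))
     (All 2 (All 3 (Iff (SB 2 0 3 0)
       (Orf (EQ 2 0 3 0)
         (Ex 4 (Conj (SB 2 0 4 0)
            (Orf (Conj (Orf (bin 4) (cd 4 2 1 2)) (EQ 4 3 3 0))
                 (Conj (bin 4) (FM 4 3 3 0))))))))))))))"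

text \<open>Truth is attached to positions of the word, not to formulas; the last conjunct therefore
  ties together all occurrences of the same variable.\<close>

definition truth_fo :: fo where
  "truth_fo =
     Conj (All 2 (All 3 (Impf (cd 2 1 1 2) (Not (TR 2 0 3 0)))))
    (Conj (All 2 (All 3 (All 4 (All 5 (Impf (Conj (bin 2) (Conj (FM 2 3 4 0) (FM 4 0 5 0)))
       (Conj (Impf (cd 2 1 2 1) (Iff (TR 2 0 3 0) (Conj (TR 2 3 3 0) (TR 4 0 3 0))))
       (Conj (Impf (cd 2 1 2 2) (Iff (TR 2 0 3 0) (Orf (TR 2 3 3 0) (TR 4 0 3 0))))
             (Impf (cd 2 2 1 1) (Iff (TR 2 0 3 0) (Impf (TR 2 3 3 0) (TR 4 0 3 0)))))))))))
    (Conj (All 2 (All 3 (All 4 (Impf (Conj (cd 2 2 1 2) (FM 2 3 4 0))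
       (Iff (TR 2 0 3 0) (All 5 (Impf (RR 3 0 5 0) (TR 2 3 5 0))))))))
     (All 2 (All 3 (All 4 (All 5 (All 6
       (Impf (Conj (cd 2 1 1 1) (Conj (cd 4 1 1 1) (Conj (FM 2 0 5 0) (Conj (FM 4 0 6 0) (SM 2 3 4 3)))))
         (Iff (TR 2 0 3 0) (TR 4 0 3 0))))))))))"

text \<open>A common variable is a pair of occurrences, one in each formula, with equal numerals.
  \<open>SB\<close> ensures that each occurrence belongs to the formula in question, so a variable
  of only one formula imposes no condition on \<open>ZZ\<close>.\<close>

definition bisim_fo :: fo where
  "bisim_fo =
     Conj (All 2 (All 3 (All 4 (Impf (Conj (RR 2 0 3 0) (RR 3 0 4 0)) (Orf (EQ 2 0 4 0) (RR 2 0 4 0))))))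
    (Conj (All 2 (All 3 (Impf (ZZ 2 0 3 0) (All 4 (All 5
       (Impf (Conj (SB 0 0 4 0) (Conj (SB 1 0 5 0) (Conj (cd 4 1 1 1) (Conj (cd 5 1 1 1) (SM 4 3 5 3)))))
         (Iff (TR 4 0 2 0) (TR 5 0 3 0))))))))
    (Conj (All 2 (All 3 (Impf (ZZ 2 0 3 0) (All 4 (Impf (RR 2 0 4 0) (Ex 5 (Conj (RR 3 0 5 0) (ZZ 4 0 5 0))))))))
    (Conj (All 2 (All 3 (Impf (ZZ 2 0 3 0) (All 4 (Impf (RR 3 0 4 0) (Ex 5 (Conj (RR 2 0 5 0) (ZZ 5 0 4 0))))))))
     (Ex 2 (Ex 3 (Conj (ZZ 2 0 3 0) (Conj (TR 0 0 2 0) (Not (TR 1 0 3 0)))))))))"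

definition rest_fo :: fo where
  "rest_fo = Ex 2 (Conj (FM 1 0 2 0) (Inp 0 2 0))"

text \<open>Words that encode no pair of formulas belong to the complement and are covered by the
  first disjunct. The syntactic relations must be right in either case, as they decide whether there
  is such a pair.\<close>

definition separated_fo :: fo where
  "separated_fo = Conj parse_fo
     (Orf (Not (Ex 1 (Conj (FM 0 0 1 0) rest_fo)))
          (Ex 1 (Conj (FM 0 0 1 0) (Conj rest_fo (Conj truth_fo bisim_fo)))))"

lemma okf_separated_fo: "okf separated_fo" and qvars_separated_fo: "qvars separated_fo \<subseteq> {1..<12}"
  by (simp_all add: separated_fo_def rest_fo_def bisim_fo_def truth_fo_def parse_fo_def bin_def cd_def fo_defs)

subsection \<open>Parsing\<close>

text \<open>Numerals are compared without knowing where they end; what follows their end marks may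
  differ.\<close>

fun same_num :: "bool list \<Rightarrow> bool list \<Rightarrow> bool" where
  "same_num (False # u) (False # v) = True"
| "same_num (True # a # u) (True # b # v) = (a = b \<and> same_num u v)"
| "same_num u v = False"

lemma enc_nat_0: "enc_nat 0 = [False]"
  and enc_nat_pos: "v \<noteq> 0 \<Longrightarrow> enc_nat v = True # odd v # enc_nat (v div 2)"
  by (simp_all add: enc_nat.simps)

lemma same_num_enc_nat: "same_num (enc_nat k @ u) (enc_nat l @ v) \<longleftrightarrow> k = l"
proof (induction k arbitrary: l rule: less_induct)
  case (less k)
  show ?case
  proof (cases "k = 0 \<or> l = 0")
    case True
    then show ?thesis by (auto simp: enc_nat.simps[of k] enc_nat.simps[of l])
  next
    case False
    have "k = l \<longleftrightarrow> odd k = odd l \<and> k div 2 = l div 2" by (metis bit_eq_rec)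
    then show ?thesis using False less[of "k div 2" "l div 2"]
      by (simp add: enc_nat.simps[of k] enc_nat.simps[of l])
  qed
qed

locale word =
  fixes w :: "bool list"
begin

abbreviation "n \<equiv> length w"

definition sym :: "nat \<Rightarrow> nat" where
  "sym z = (if z < n then if w ! z then 2 else 1 else 0)"

definition cN where "cN i j \<longleftrightarrow> j \<le> n \<and> (\<exists>v. drop i w = enc_nat v @ drop j w)"
definition parse where "parse i j \<chi> \<longleftrightarrow> j \<le> n \<and> drop i w = enc \<chi> @ drop j w"
definition cF where "cF i j \<longleftrightarrow> (\<exists>\<chi>. parse i j \<chi>)"
definition code where "code i a b c \<longleftrightarrow> sym i = a \<and> sym (i + 1) = b \<and> sym (i + 2) = c"
definition binary where "binary i \<longleftrightarrow> code i 1 2 1 \<or> code i 1 2 2 \<or> code i 2 1 1"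
text \<open>The second argument of a binary connective starts where the first one ends, which is
  what \<open>cF\<close> determines.\<close>

definition child where
  "child k i \<longleftrightarrow> (binary k \<or> code k 2 1 2) \<and> k + 3 = i \<or> binary k \<and> cF (k + 3) i"

inductive cB for r where
  "cB r r"
| "\<lbrakk>cB r k; child k i\<rbrakk> \<Longrightarrow> cB r i"

lemma sym_cases:
  "sym i = 1 \<longleftrightarrow> i < n \<and> drop i w = False # drop (i + 1) w"
  "sym i = 2 \<longleftrightarrow> i < n \<and> drop i w = True # drop (i + 1) w"
  "sym i = 0 \<longleftrightarrow> n \<le> i"
  by (auto simp: sym_def Cons_nth_drop_Suc[symmetric] simp del: drop_Suc_Cons)

lemma sym_range: "sym i = 0 \<or> sym i = 1 \<or> sym i = 2"
  by (simp add: sym_def)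

lemma drop_eq: "\<lbrakk>i \<le> n; j \<le> n\<rbrakk> \<Longrightarrow> drop i w = drop j w \<longleftrightarrow> i = j"
  by (metis diff_diff_cancel length_drop)

lemma drop_Cons_sym:
  "drop i w = b # u \<longleftrightarrow> sym i = (if b then 2 else 1) \<and> u = drop (i + 1) w"
  by (cases "i < n") (auto simp: sym_def Cons_nth_drop_Suc[symmetric])

text \<open>The least significant digit comes first, so a digit directly before the end mark is the
  leading one. The last condition forbids a leading zero, which \<open>enc_nat\<close> never
  produces.\<close>

lemma cN_step:
  "cN i j \<longleftrightarrow> sym i = 1 \<and> i + 1 = j \<or>
     sym i = 2 \<and> sym (i + 1) \<noteq> 0 \<and> cN (i + 2) j \<and> (sym (i + 2) = 1 \<longrightarrow> sym (i + 1) = 2)"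
proof
  assume "cN i j"
  then obtain v where v: "j \<le> n" "drop i w = enc_nat v @ drop j w" by (auto simp: cN_def)
  show "sym i = 1 \<and> i + 1 = j \<or>
     sym i = 2 \<and> sym (i + 1) \<noteq> 0 \<and> cN (i + 2) j \<and> (sym (i + 2) = 1 \<longrightarrow> sym (i + 1) = 2)"
  proof (cases "v = 0")
    case True
    then have "sym i = 1" "drop j w = drop (i + 1) w"
      using v(2) by (simp_all add: enc_nat_0 drop_Cons_sym)
    moreover have "i + 1 \<le> n" using \<open>sym i = 1\<close> by (simp add: sym_def split: if_splits)
    ultimately show ?thesis using drop_eq v(1) by metis
  next
    case False
    then have "drop i w = True # odd v # enc_nat (v div 2) @ drop j w"
      using v(2) by (simp add: enc_nat_pos)
    then have s: "sym i = 2" "sym (i + 1) = (if odd v then 2 else 1)"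
      and d: "drop (i + 2) w = enc_nat (v div 2) @ drop j w"
      unfolding drop_Cons_sym by (metis drop_Cons_sym add.assoc one_add_one)+
    have "sym (i + 1) = 2" if "sym (i + 2) = 1"
    proof -
      have "v div 2 = 0"
      proof (rule ccontr)
        assume "v div 2 \<noteq> 0"
        then have "\<exists>u. drop (i + 2) w = True # u" unfolding d using enc_nat_pos by fastforce
        then show False using that drop_Cons_sym[of "i + 2"] by auto
      qed
      then show ?thesis using s False by (cases "v = 1") auto
    qed
    then show ?thesis using s d v by (auto simp: cN_def)
  qed
next
  assume "sym i = 1 \<and> i + 1 = j \<or>
     sym i = 2 \<and> sym (i + 1) \<noteq> 0 \<and> cN (i + 2) j \<and> (sym (i + 2) = 1 \<longrightarrow> sym (i + 1) = 2)"
  then show "cN i j"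
  proof
    assume "sym i = 1 \<and> i + 1 = j"
    then have "j \<le> n" "drop i w = enc_nat 0 @ drop j w"
      using sym_cases(1)[of i] by (auto simp: enc_nat_0)
    then show ?thesis by (auto simp: cN_def)
  next
    assume a: "sym i = 2 \<and> sym (i + 1) \<noteq> 0 \<and> cN (i + 2) j \<and> (sym (i + 2) = 1 \<longrightarrow> sym (i + 1) = 2)"
    then obtain v where v: "j \<le> n" "drop (i + 2) w = enc_nat v @ drop j w" by (auto simp: cN_def)
    define b where "b \<longleftrightarrow> sym (i + 1) = 2"
    have "drop (i + 1) w = b # drop (i + 2) w"
      unfolding drop_Cons_sym using a sym_range[of "i + 1"] by (auto simp: b_def)
    moreover have "drop i w = True # drop (i + 1) w" unfolding drop_Cons_sym using a by simp
    ultimately have d: "drop i w = True # b # enc_nat v @ drop j w" unfolding v(2) by simp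
    have nz: "v \<noteq> 0 \<or> b"
    proof (rule ccontr)
      assume nz: "\<not> (v \<noteq> 0 \<or> b)"
      then have "drop (i + 2) w = False # drop j w" using v(2) by (simp add: enc_nat_0)
      then have "sym (i + 2) = 1" unfolding drop_Cons_sym by simp
      then show False using nz a by (simp add: b_def)
    qed
    define u where "u = 2 * v + (if b then 1 else 0)"
    have "enc_nat u = True # b # enc_nat v"
      using nz by (subst enc_nat.simps) (auto simp: u_def)
    then have "drop i w = enc_nat u @ drop j w" using d by simp
    then show ?thesis using v(1) by (auto simp: cN_def)
  qed
qed

lemma same_num_step:
  "same_num (drop i w) (drop i' w) \<longleftrightarrow> sym i = 1 \<and> sym i' = 1 \<or>
     (sym i = 2 \<and> sym i' = 2) \<and> (sym (i + 1) = 2 \<longleftrightarrow> sym (i' + 1) = 2) \<and>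
     same_num (drop (i + 2) w) (drop (i' + 2) w)"
proof -
  have d: "drop k w = (if k < n then w ! k # drop (Suc k) w else [])" for k
    by (simp add: Cons_nth_drop_Suc)
  have e: "\<not> same_num [] u" "\<not> same_num u []" "\<not> same_num [a] u" if "a" for u a
    using that by (cases u; auto)+
  show ?thesis
  proof (cases "i + 1 < n \<and> i' + 1 < n")
    case True
    then show ?thesis
      by (subst d[of i], subst d[of i'], subst d[of "Suc i"], subst d[of "Suc i'"])
        (auto simp: sym_def)
  next
    case False
    then show ?thesis
      by (subst d[of i], subst d[of i'], subst d[of "Suc i"], subst d[of "Suc i'"])
        (auto simp: sym_def elim!: same_num.elims)
  qed
qed

lemma drop_append: "drop i w = u @ v \<Longrightarrow> v = drop (i + length u) w"
  by (metis append_eq_conv_conj drop_drop add.commute)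

lemma drop_code:
  "drop i w = a # b # c # u \<longleftrightarrow>
     code i (if a then 2 else 1) (if b then 2 else 1) (if c then 2 else 1) \<and> u = drop (i + 3) w"
proof
  assume l: "drop i w = a # b # c # u"
  from drop_Cons_sym[THEN iffD1, OF this] have 1: "sym i = (if a then 2 else 1)"
    and "drop (i + 1) w = b # c # u" by simp_all
  from drop_Cons_sym[THEN iffD1, OF this(2)] have 2: "sym (i + 1) = (if b then 2 else 1)"
    and "drop (i + 2) w = c # u" by simp_all
  from drop_Cons_sym[THEN iffD1, OF this(2)] have 3: "sym (i + 2) = (if c then 2 else 1)"
    and "u = drop (i + 3) w" by (simp_all add: numeral_3_eq_3)
  with 1 2 show "code i (if a then 2 else 1) (if b then 2 else 1) (if c then 2 else 1) \<and> u = drop (i + 3) w"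
    by (simp add: code_def)
next
  assume r: "code i (if a then 2 else 1) (if b then 2 else 1) (if c then 2 else 1) \<and> u = drop (i + 3) w"
  then have 1: "drop (i + 2) w = c # u"
    unfolding drop_Cons_sym code_def by (simp add: numeral_3_eq_3 numeral_2_eq_2)
  have 2: "drop (i + 1) w = b # drop (i + 2) w"
    unfolding drop_Cons_sym using r by (simp add: code_def)
  have "drop i w = a # drop (i + 1) w"
    unfolding drop_Cons_sym using r by (simp add: code_def)
  then show "drop i w = a # b # c # u" unfolding 2 1 .
qed

lemma code_le: "\<lbrakk>code i a b c; c \<noteq> 0\<rbrakk> \<Longrightarrow> i + 3 \<le> n"
  by (auto simp: code_def sym_def split: if_splits)

lemma enc_length: "3 \<le> length (enc \<chi>)"
  by (cases \<chi>) auto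

lemma parse_lt: "parse i j \<chi> \<Longrightarrow> i + 3 \<le> j \<and> j \<le> n"
proof -
  assume p: "parse i j \<chi>"
  then have "length (drop i w) = length (enc \<chi>) + length (drop j w)" "j \<le> n"
    by (simp_all add: parse_def)
  then show ?thesis using enc_length[of \<chi>] by simp
qed

lemma parse_unique:
  assumes "parse i j \<chi>" "parse i j' \<chi>'"
  shows "\<chi> = \<chi>' \<and> j = j'"
proof -
  have "enc \<chi> @ drop j w = enc \<chi>' @ drop j' w" "j \<le> n" "j' \<le> n"
    using assms by (auto simp: parse_def)
  then show ?thesis using enc_prefix_free drop_eq by blast
qed

lemma parse_append: "(\<exists>k. parse i k \<phi> \<and> parse k j \<psi>) \<longleftrightarrow> j \<le> n \<and> drop i w = enc \<phi> @ enc \<psi> @ drop j w"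
proof
  assume r: "j \<le> n \<and> drop i w = enc \<phi> @ enc \<psi> @ drop j w"
  let ?k = "i + length (enc \<phi>)"
  have k: "drop ?k w = enc \<psi> @ drop j w" using drop_append[of i "enc \<phi>"] r by simp
  then have "drop ?k w \<noteq> []" using enc_length[of \<psi>] by auto
  then have "?k \<le> n" by simp
  then have "parse i ?k \<phi> \<and> parse ?k j \<psi>" using k r by (auto simp: parse_def)
  then show "\<exists>k. parse i k \<phi> \<and> parse k j \<psi>" by blast
qed (auto simp: parse_def)

lemma parse_Var: "parse i j (Var v) \<longleftrightarrow> code i 1 1 1 \<and> j \<le> n \<and> drop (i + 3) w = enc_nat v @ drop j w"
  by (simp only: parse_def enc.simps append_Cons append_Nil append_assoc drop_code if_True if_False)
    metis

lemma parse_Bot: "parse i j Bot \<longleftrightarrow> code i 1 1 2 \<and> j = i + 3"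
  unfolding parse_def enc.simps append_Cons append_Nil drop_code if_True if_False
  using code_le[of i 1 1 2] drop_eq[of j "i + 3"] by auto

lemma parse_bin:
  "parse i j (And \<phi> \<psi>) \<longleftrightarrow> code i 1 2 1 \<and> (\<exists>k. parse (i + 3) k \<phi> \<and> parse k j \<psi>)"
  "parse i j (Or \<phi> \<psi>) \<longleftrightarrow> code i 1 2 2 \<and> (\<exists>k. parse (i + 3) k \<phi> \<and> parse k j \<psi>)"
  "parse i j (Imp \<phi> \<psi>) \<longleftrightarrow> code i 2 1 1 \<and> (\<exists>k. parse (i + 3) k \<phi> \<and> parse k j \<psi>)"
  unfolding parse_append
  by (simp_all only: parse_def enc.simps append_Cons append_Nil append_assoc drop_code if_True if_False)
    metis+

lemma parse_Box: "parse i j (Box \<phi>) \<longleftrightarrow> code i 2 1 2 \<and> parse (i + 3) j \<phi>"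
  by (simp only: parse_def enc.simps append_Cons append_Nil append_assoc drop_code if_True if_False)
    metis

lemmas parse_simps = parse_Var parse_Bot parse_bin parse_Box

lemma cF_step:
  "cF i j \<longleftrightarrow> code i 1 1 1 \<and> cN (i + 3) j \<or> code i 1 1 2 \<and> i + 3 = j \<or>
     binary i \<and> (\<exists>k. cF (i + 3) k \<and> cF k j) \<or> code i 2 1 2 \<and> cF (i + 3) j" (is "_ \<longleftrightarrow> ?r")
proof
  assume "cF i j"
  then obtain \<chi> where "parse i j \<chi>" by (auto simp: cF_def)
  then show ?r by (cases \<chi>) (auto simp: parse_simps cF_def cN_def binary_def)
next
  assume ?r
  then consider "code i 1 1 1" "cN (i + 3) j" | "code i 1 1 2" "i + 3 = j"
    | k where "binary i" "cF (i + 3) k" "cF k j" | "code i 2 1 2" "cF (i + 3) j" by blast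
  then show "cF i j"
  proof cases
    case 1
    then show ?thesis using parse_Var by (auto simp: cF_def cN_def)
  next
    case 2
    then show ?thesis using parse_Bot by (auto simp: cF_def)
  next
    case 3
    then obtain \<phi> \<psi> where "parse (i + 3) k \<phi>" "parse k j \<psi>" by (auto simp: cF_def)
    then have "parse i j (And \<phi> \<psi>) \<or> parse i j (Or \<phi> \<psi>) \<or> parse i j (Imp \<phi> \<psi>)"
      using 3(1) unfolding parse_bin binary_def by blast
    then show ?thesis unfolding cF_def by blast
  next
    case 4
    then show ?thesis using parse_Box by (auto simp: cF_def)
  qed
qed

lemma binary_le: "binary i \<Longrightarrow> i + 3 \<le> n"
  using code_le by (fastforce simp: binary_def)

lemma cF_lt: "cF i j \<Longrightarrow> i + 3 \<le> j \<and> j \<le> n"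
  using parse_lt by (auto simp: cF_def)

lemma child_lt: "child k i \<Longrightarrow> k + 3 \<le> i \<and> i \<le> n"
  using cF_lt binary_le code_le[of k 2 1 2] by (fastforce simp: child_def)

lemma cB_step: "cB r i \<longleftrightarrow> r = i \<or> (\<exists>k. cB r k \<and> child k i)"
  by (subst cB.simps) auto

lemma child_parse:
  assumes "parse k j \<chi>" "child k i"
  shows "\<exists>\<chi>' j'. parse i j' \<chi>' \<and> vars \<chi>' \<subseteq> vars \<chi>"
proof (cases \<chi>)
  case (Var v)
  then show ?thesis using assms by (auto simp: parse_simps child_def binary_def code_def)
next
  case Bot
  then show ?thesis using assms by (auto simp: parse_simps child_def binary_def code_def)
next
  case (Box \<phi>)
  then show ?thesis using assms by (auto simp: parse_simps child_def binary_def code_def)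
next
  case (And \<phi> \<psi>)
  then obtain l where l: "parse (k + 3) l \<phi>" "parse l j \<psi>" using assms by (auto simp: parse_bin)
  have "k + 3 = i \<or> l = i" using assms(2) l(1) parse_unique by (fastforce simp: child_def cF_def)
  then show ?thesis using l And by (metis UnCI subsetI vars.simps(3))
next
  case (Or \<phi> \<psi>)
  then obtain l where l: "parse (k + 3) l \<phi>" "parse l j \<psi>" using assms by (auto simp: parse_bin)
  have "k + 3 = i \<or> l = i" using assms(2) l(1) parse_unique by (fastforce simp: child_def cF_def)
  then show ?thesis using l Or by (metis UnCI subsetI vars.simps(4))
next
  case (Imp \<phi> \<psi>)
  then obtain l where l: "parse (k + 3) l \<phi>" "parse l j \<psi>" using assms by (auto simp: parse_bin)
  have "k + 3 = i \<or> l = i" using assms(2) l(1) parse_unique by (fastforce simp: child_def cF_def)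
  then show ?thesis using l Imp by (metis UnCI subsetI vars.simps(5))
qed

lemma cB_parse:
  assumes "cB r i" "parse r j \<chi>"
  shows "\<exists>\<chi>' j'. parse i j' \<chi>' \<and> vars \<chi>' \<subseteq> vars \<chi>"
  using assms(1)
proof induction
  case 1
  then show ?case using assms(2) by blast
next
  case (2 k i)
  then show ?case using child_parse by (meson subset_trans)
qed

lemma cB_trans: "cB k i \<Longrightarrow> cB r k \<Longrightarrow> cB r i"
  by (induction rule: cB.induct) (auto intro: cB.intros)

lemma vars_cB: "\<lbrakk>parse r j \<chi>; v \<in> vars \<chi>\<rbrakk> \<Longrightarrow> \<exists>i j'. cB r i \<and> parse i j' (Var v)"
proof (induction \<chi> arbitrary: r j)
  case (Var v)
  then show ?case using cB.intros(1) by auto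
next
  case (Box \<chi>)
  then have "child r (r + 3)" by (simp add: parse_Box child_def)
  then have "cB r (r + 3)" using cB.intros by blast
  then show ?case using Box cB_trans by (fastforce simp: parse_Box)
next
  case (And \<phi> \<psi>)
  from And.prems(1) obtain k where k: "binary r" "parse (r + 3) k \<phi>" "parse k j \<psi>"
    by (auto simp: parse_bin binary_def)
  then have "child r (r + 3)" "child r k" by (auto simp: child_def cF_def)
  then have c: "cB r (r + 3)" "cB r k" using cB.intros by blast+
  show ?case using And.prems(2) And.IH k c cB_trans by (metis Un_iff vars.simps(3))
next
  case (Or \<phi> \<psi>)
  from Or.prems(1) obtain k where k: "binary r" "parse (r + 3) k \<phi>" "parse k j \<psi>"
    by (auto simp: parse_bin binary_def)
  then have "child r (r + 3)" "child r k" by (auto simp: child_def cF_def)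
  then have c: "cB r (r + 3)" "cB r k" using cB.intros by blast+
  show ?case using Or.prems(2) Or.IH k c cB_trans by (metis Un_iff vars.simps(4))
next
  case (Imp \<phi> \<psi>)
  from Imp.prems(1) obtain k where k: "binary r" "parse (r + 3) k \<phi>" "parse k j \<psi>"
    by (auto simp: parse_bin binary_def)
  then have "child r (r + 3)" "child r k" by (auto simp: child_def cF_def)
  then have c: "cB r (r + 3)" "cB r k" using cB.intros by blast+
  show ?case using Imp.prems(2) Imp.IH k c cB_trans by (metis Un_iff vars.simps(5))
qed simp

lemma parse_same_var:
  assumes "parse i j (Var v)" "parse i' j' (Var v')"
  shows "same_num (drop (i + 3) w) (drop (i' + 3) w) \<longleftrightarrow> v = v'"
  using assms by (simp add: parse_Var same_num_enc_nat)

lemma parse_code_Var: "\<lbrakk>parse i j \<chi>; code i 1 1 1\<rbrakk> \<Longrightarrow> \<exists>v. \<chi> = Var v"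
  by (cases \<chi>) (auto simp: parse_simps code_def)

subsection \<open>Correctness of the sentence\<close>

definition parse_ok :: "(nat \<Rightarrow> nat \<Rightarrow> nat \<Rightarrow> bool) \<Rightarrow> nat \<Rightarrow> bool" where
  "parse_ok X m \<longleftrightarrow>
     X 0 0 0 \<and> (\<forall>u<m. \<not> X 0 0 (u + 1) \<and> \<not> X 0 (u + 1) 0) \<and>
     (\<forall>u<m. \<forall>v<m. X 0 (u + 1) (v + 1) \<longleftrightarrow> X 0 u v) \<and>
     (\<forall>i<m. \<forall>j<m. X 1 i j \<longleftrightarrow> sym i = 1 \<and> X 0 (i + 1) j \<or>
        sym i = 2 \<and> sym (i + 1) \<noteq> 0 \<and> X 1 (i + 2) j \<and> (sym (i + 2) = 1 \<longrightarrow> sym (i + 1) = 2)) \<and>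
     (\<forall>i<m. \<forall>j<m. X 2 i j \<longleftrightarrow> sym i = 1 \<and> sym j = 1 \<or>
        (sym i = 2 \<and> sym j = 2) \<and> (sym (i + 1) = 2 \<longleftrightarrow> sym (j + 1) = 2) \<and> X 2 (i + 2) (j + 2)) \<and>
     (\<forall>i<m. \<forall>j<m. X 3 i j \<longleftrightarrow> code i 1 1 1 \<and> X 1 (i + 3) j \<or> code i 1 1 2 \<and> X 0 (i + 3) j \<or>
        binary i \<and> (\<exists>k<m. X 3 (i + 3) k \<and> X 3 k j) \<or> code i 2 1 2 \<and> X 3 (i + 3) j) \<and>
     (\<forall>r<m. \<forall>i<m. X 4 r i \<longleftrightarrow> X 0 r i \<or>
        (\<exists>k<m. X 4 r k \<and> ((binary k \<or> code k 2 1 2) \<and> X 0 (k + 3) i \<or> binary k \<and> X 3 (k + 3) i)))"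

definition truth_ok :: "(nat \<Rightarrow> nat \<Rightarrow> nat \<Rightarrow> bool) \<Rightarrow> nat \<Rightarrow> bool" where
  "truth_ok X m \<longleftrightarrow>
     (\<forall>i<m. \<forall>x<m. code i 1 1 2 \<longrightarrow> \<not> X 5 i x) \<and>
     (\<forall>i<m. \<forall>x<m. \<forall>k<m. \<forall>j<m. binary i \<and> X 3 (i + 3) k \<and> X 3 k j \<longrightarrow>
        (code i 1 2 1 \<longrightarrow> (X 5 i x \<longleftrightarrow> X 5 (i + 3) x \<and> X 5 k x)) \<and>
        (code i 1 2 2 \<longrightarrow> (X 5 i x \<longleftrightarrow> X 5 (i + 3) x \<or> X 5 k x)) \<and>
        (code i 2 1 1 \<longrightarrow> (X 5 i x \<longleftrightarrow> (X 5 (i + 3) x \<longrightarrow> X 5 k x)))) \<and>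
     (\<forall>i<m. \<forall>x<m. \<forall>j<m. code i 2 1 2 \<and> X 3 (i + 3) j \<longrightarrow>
        (X 5 i x \<longleftrightarrow> (\<forall>y<m. X 6 x y \<longrightarrow> X 5 (i + 3) y))) \<and>
     (\<forall>i<m. \<forall>x<m. \<forall>i'<m. \<forall>j<m. \<forall>j'<m.
        code i 1 1 1 \<and> code i' 1 1 1 \<and> X 3 i j \<and> X 3 i' j' \<and> X 2 (i + 3) (i' + 3) \<longrightarrow>
        (X 5 i x \<longleftrightarrow> X 5 i' x))"

definition bisim_ok :: "(nat \<Rightarrow> nat \<Rightarrow> nat \<Rightarrow> bool) \<Rightarrow> nat \<Rightarrow> nat \<Rightarrow> bool" where
  "bisim_ok X m r \<longleftrightarrow>
     (\<forall>x<m. \<forall>y<m. \<forall>z<m. X 6 x y \<and> X 6 y z \<longrightarrow> X 0 x z \<or> X 6 x z) \<and>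
     (\<forall>x<m. \<forall>y<m. X 7 x y \<longrightarrow> (\<forall>i<m. \<forall>j<m.
        X 4 0 i \<and> X 4 r j \<and> code i 1 1 1 \<and> code j 1 1 1 \<and> X 2 (i + 3) (j + 3) \<longrightarrow> (X 5 i x \<longleftrightarrow> X 5 j y))) \<and>
     (\<forall>x<m. \<forall>y<m. X 7 x y \<longrightarrow> (\<forall>x'<m. X 6 x x' \<longrightarrow> (\<exists>y'<m. X 6 y y' \<and> X 7 x' y'))) \<and>
     (\<forall>x<m. \<forall>y<m. X 7 x y \<longrightarrow> (\<forall>y'<m. X 6 y y' \<longrightarrow> (\<exists>x'<m. X 6 x x' \<and> X 7 x' y'))) \<and>
     (\<exists>x<m. \<exists>y<m. X 7 x y \<and> X 5 0 x \<and> \<not> X 5 r y)"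

lemma sat_cd [simp]: "sat sym X m e (cd i a b c) \<longleftrightarrow> code (e i) a b c"
  by (simp add: cd_def code_def)

lemma sat_bin [simp]: "sat sym X m e (bin i) \<longleftrightarrow> binary (e i)"
  by (simp add: bin_def binary_def)

lemma sat_parse_fo: "e 0 = 0 \<Longrightarrow> sat sym X m e parse_fo \<longleftrightarrow> parse_ok X m"
  by (simp add: parse_fo_def parse_ok_def)

lemma sat_truth_fo: "sat sym X m e truth_fo \<longleftrightarrow> truth_ok X m"
  by (simp add: truth_fo_def truth_ok_def)

lemma sat_bisim_fo: "e 0 = 0 \<Longrightarrow> sat sym X m e bisim_fo \<longleftrightarrow> bisim_ok X m (e 1)"
  by (simp add: bisim_fo_def bisim_ok_def)

lemma sat_rest_fo: "sat sym X m e rest_fo \<longleftrightarrow> (\<exists>l<m. X 3 (e 1) l \<and> sym l = 0)"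
  by (simp add: rest_fo_def)

lemma sat_separated_fo:
  "sat sym X m (\<lambda>_. 0) separated_fo \<longleftrightarrow> parse_ok X m \<and>
     (\<not> (\<exists>r<m. X 3 0 r \<and> (\<exists>l<m. X 3 r l \<and> sym l = 0)) \<or>
      (\<exists>r<m. X 3 0 r \<and> (\<exists>l<m. X 3 r l \<and> sym l = 0) \<and> truth_ok X m \<and> bisim_ok X m r))"
  by (simp add: separated_fo_def sat_parse_fo sat_truth_fo sat_bisim_fo sat_rest_fo)

context
  fixes X :: "nat \<Rightarrow> nat \<Rightarrow> nat \<Rightarrow> bool" and m :: nat
  assumes ok: "parse_ok X m" and m: "n + 3 \<le> m"
begin

text \<open>The conditions are recursion on the successor. They determine equality up to
  \<open>m\<close> itself, one beyond the quantified range, as needed for arguments with an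
  offset.\<close>

lemma X_EQ: "u \<le> m \<Longrightarrow> v \<le> m \<Longrightarrow> X 0 u v \<longleftrightarrow> u = v"
proof (induction u arbitrary: v)
  case 0
  have "X 0 0 0" "\<And>u. u < m \<Longrightarrow> \<not> X 0 0 (u + 1)" using ok by (auto simp: parse_ok_def)
  then show ?case using 0 by (cases v) auto
next
  case (Suc u)
  have "\<And>u. u < m \<Longrightarrow> \<not> X 0 (u + 1) 0"
    "\<And>u v. u < m \<Longrightarrow> v < m \<Longrightarrow> X 0 (u + 1) (v + 1) \<longleftrightarrow> X 0 u v" using ok by (auto simp: parse_ok_def)
  then show ?case using Suc by (cases v) auto
qed

text \<open>Induction from the end of the word. Recursive calls concern later positions and occur
  only where a symbol is present, and the margin in \<open>n + 3 \<le> m\<close> keeps the shifted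
  positions within the range. The same argument serves \<open>X_SM\<close> and
  \<open>X_FM\<close>.\<close>

lemma X_NM: "i < m \<Longrightarrow> j < m \<Longrightarrow> X 1 i j \<longleftrightarrow> cN i j"
proof (induction "m - i" arbitrary: i rule: less_induct)
  case less
  have "\<forall>i<m. \<forall>j<m. X 1 i j \<longleftrightarrow> sym i = 1 \<and> X 0 (i + 1) j \<or>
        sym i = 2 \<and> sym (i + 1) \<noteq> 0 \<and> X 1 (i + 2) j \<and> (sym (i + 2) = 1 \<longrightarrow> sym (i + 1) = 2)"
    using ok unfolding parse_ok_def by (elim conjE)
  note this[rule_format, OF less.prems]
  moreover have "X 0 (i + 1) j \<longleftrightarrow> i + 1 = j" using X_EQ less.prems by simp
  moreover have "X 1 (i + 2) j \<longleftrightarrow> cN (i + 2) j" if "sym (i + 1) \<noteq> 0"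
    by (rule less.hyps) (use that m less.prems in \<open>auto simp: sym_def split: if_splits\<close>)
  ultimately show ?case unfolding cN_step[of i j] by blast
qed

lemma X_SM: "i < m \<Longrightarrow> j < m \<Longrightarrow> X 2 i j \<longleftrightarrow> same_num (drop i w) (drop j w)"
proof (induction "m - i" arbitrary: i j rule: less_induct)
  case less
  have "\<forall>i<m. \<forall>j<m. X 2 i j \<longleftrightarrow> sym i = 1 \<and> sym j = 1 \<or>
        (sym i = 2 \<and> sym j = 2) \<and> (sym (i + 1) = 2 \<longleftrightarrow> sym (j + 1) = 2) \<and> X 2 (i + 2) (j + 2)"
    using ok unfolding parse_ok_def by (elim conjE)
  note this[rule_format, OF less.prems]
  moreover have "X 2 (i + 2) (j + 2) \<longleftrightarrow> same_num (drop (i + 2) w) (drop (j + 2) w)" if "sym i = 2 \<and> sym j = 2"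
    by (rule less.hyps) (use that m less.prems in \<open>auto simp: sym_def split: if_splits\<close>)
  ultimately show ?case unfolding same_num_step[of i j] by blast
qed

lemma X_FM: "i < m \<Longrightarrow> j < m \<Longrightarrow> X 3 i j \<longleftrightarrow> cF i j"
proof (induction "m - i" arbitrary: i j rule: less_induct)
  case less
  have "\<forall>i<m. \<forall>j<m. X 3 i j \<longleftrightarrow> code i 1 1 1 \<and> X 1 (i + 3) j \<or> code i 1 1 2 \<and> X 0 (i + 3) j \<or>
        binary i \<and> (\<exists>k<m. X 3 (i + 3) k \<and> X 3 k j) \<or> code i 2 1 2 \<and> X 3 (i + 3) j"
    using ok unfolding parse_ok_def by (elim conjE)
  note X = this[rule_format, OF less.prems]
  have "X 1 (i + 3) j \<longleftrightarrow> cN (i + 3) j" if "i + 3 \<le> n" using X_NM that m less.prems by simp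
  moreover have "X 0 (i + 3) j \<longleftrightarrow> i + 3 = j" if "i + 3 \<le> n" using X_EQ that m less.prems by simp
  moreover have a: "X 3 (i + 3) k \<longleftrightarrow> cF (i + 3) k" if "i + 3 \<le> n" "k < m" for k
    by (rule less.hyps) (use that m less.prems in auto)
  moreover have "(\<exists>k<m. X 3 (i + 3) k \<and> X 3 k j) \<longleftrightarrow> (\<exists>k. cF (i + 3) k \<and> cF k j)" if n: "i + 3 \<le> n"
  proof -
    have b: "X 3 k j \<longleftrightarrow> cF k j" if "cF (i + 3) k" for k
      by (rule less.hyps) (use cF_lt[OF that] m less.prems in auto)
    have "k < m" if "cF (i + 3) k" for k using cF_lt[OF that] m by simp
    then show ?thesis using a[OF n] b by blast
  qed
  moreover have "i + 3 \<le> n" if "code i 1 1 1 \<or> code i 1 1 2 \<or> code i 2 1 2 \<or> binary i"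
    using that code_le[of i 1 1 1] code_le[of i 1 1 2] code_le[of i 2 1 2] binary_le by auto
  ultimately show ?case unfolding X cF_step[of i j] using less.prems by blast
qed

text \<open>Here the recursion runs towards the beginning, since a formula starts before its
  arguments.\<close>

lemma X_SB: "r < m \<Longrightarrow> i < m \<Longrightarrow> X 4 r i \<longleftrightarrow> cB r i"
proof (induction i rule: less_induct)
  case (less i)
  let ?c = "\<lambda>k. (binary k \<or> code k 2 1 2) \<and> X 0 (k + 3) i \<or> binary k \<and> X 3 (k + 3) i"
  have "\<forall>r<m. \<forall>i<m. X 4 r i \<longleftrightarrow> X 0 r i \<or>
        (\<exists>k<m. X 4 r k \<and> ((binary k \<or> code k 2 1 2) \<and> X 0 (k + 3) i \<or> binary k \<and> X 3 (k + 3) i))"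
    using ok unfolding parse_ok_def by (elim conjE)
  note this[rule_format, OF less.prems]
  moreover have "X 0 r i \<longleftrightarrow> r = i" using X_EQ less.prems by simp
  moreover have c: "?c k \<longleftrightarrow> child k i" if "k < m" for k
  proof (cases "k + 3 \<le> n")
    case True
    then show ?thesis using X_EQ[of "k + 3" i] X_FM[of "k + 3" i] m less.prems by (auto simp: child_def)
  next
    case False
    then show ?thesis using binary_le[of k] code_le[of k 2 1 2] by (auto simp: child_def)
  qed
  moreover have "(\<exists>k<m. X 4 r k \<and> child k i) \<longleftrightarrow> (\<exists>k. cB r k \<and> child k i)"
  proof -
    have "k < i" if "child k i" for k using child_lt[OF that] by simp
    then show ?thesis using less.IH less.prems by (metis order_less_trans)
  qed
  ultimately show ?case unfolding cB_step[of r i] by auto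
qed

lemma X_root:
  "(r < m \<and> X 3 0 r \<and> (\<exists>l<m. X 3 r l \<and> sym l = 0)) \<longleftrightarrow> (\<exists>\<phi> \<psi>. parse 0 r \<phi> \<and> parse r n \<psi>)"
proof
  assume a: "r < m \<and> X 3 0 r \<and> (\<exists>l<m. X 3 r l \<and> sym l = 0)"
  then obtain l where l: "l < m" "cF 0 r" "cF r l" "sym l = 0" using X_FM by auto
  \<comment> \<open>A parsed formula ends at a position at most \<open>n\<close>, and the symbol
    there is blank only at \<open>n\<close>.\<close>
  then have "l = n" using cF_lt[of r l] by (auto simp: sym_def split: if_splits)
  then show "\<exists>\<phi> \<psi>. parse 0 r \<phi> \<and> parse r n \<psi>" using l by (auto simp: cF_def)
next
  assume "\<exists>\<phi> \<psi>. parse 0 r \<phi> \<and> parse r n \<psi>"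
  then have c: "cF 0 r" "cF r n" by (auto simp: cF_def)
  then have "r < m" using cF_lt m by fastforce
  then have "X 3 0 r" "X 3 r n" "n < m" "sym n = 0" using X_FM c m by (auto simp: sym_def)
  then show "r < m \<and> X 3 0 r \<and> (\<exists>l<m. X 3 r l \<and> sym l = 0)" using \<open>r < m\<close> by blast
qed

lemma separated_sound:
  assumes tr: "truth_ok X m" and bi: "bisim_ok X m r" and p: "parse 0 r \<phi>" "parse r n \<psi>"
  shows "separated m \<phi> \<psi>"
proof -
  define R where "R x y \<longleftrightarrow> x < m \<and> y < m \<and> X 6 x y" for x y
  define Z where "Z x y \<longleftrightarrow> x < m \<and> y < m \<and> X 7 x y" for x y
  \<comment> \<open>A variable takes its value from any position at which it parses, even one inside
    a numeral; \<open>var\<close> shows that all these positions agree.\<close>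
  define V where "V x v \<longleftrightarrow> (\<exists>i j. parse i j (Var v) \<and> X 5 i x)" for x v
  have lt: "i < m" "j < m" if "parse i j \<chi>" for i j \<chi> using parse_lt[OF that] m by auto
  have F: "X 3 i j" if "parse i j \<chi>" for i j \<chi> using X_FM lt[OF that] that by (auto simp: cF_def)
  have var: "V x v \<longleftrightarrow> X 5 i x" if "parse i j (Var v)" "x < m" for i j v x
  proof
    assume "V x v"
    then obtain i' j' where i': "parse i' j' (Var v)" "X 5 i' x" by (auto simp: V_def)
    have "code i 1 1 1" "code i' 1 1 1" using that(1) i'(1) by (simp_all add: parse_Var)
    moreover have "X 2 (i + 3) (i' + 3)"
      using X_SM[of "i + 3" "i' + 3"] parse_lt[OF that(1)] parse_lt[OF i'(1)] m
        parse_same_var[OF that(1) i'(1)] by simp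
    moreover have "\<forall>i<m. \<forall>x<m. \<forall>i'<m. \<forall>j<m. \<forall>j'<m.
        code i 1 1 1 \<and> code i' 1 1 1 \<and> X 3 i j \<and> X 3 i' j' \<and> X 2 (i + 3) (i' + 3) \<longrightarrow>
        (X 5 i x \<longleftrightarrow> X 5 i' x)" using tr unfolding truth_ok_def by (elim conjE)
    ultimately show "X 5 i x"
      using i'(2) F[OF that(1)] F[OF i'(1)] lt[OF that(1)] lt[OF i'(1)] that(2) by blast
  qed (use that in \<open>auto simp: V_def\<close>)
  have "\<forall>i<m. \<forall>x<m. \<forall>k<m. \<forall>j<m. binary i \<and> X 3 (i + 3) k \<and> X 3 k j \<longrightarrow>
        (code i 1 2 1 \<longrightarrow> (X 5 i x \<longleftrightarrow> X 5 (i + 3) x \<and> X 5 k x)) \<and>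
        (code i 1 2 2 \<longrightarrow> (X 5 i x \<longleftrightarrow> X 5 (i + 3) x \<or> X 5 k x)) \<and>
        (code i 2 1 1 \<longrightarrow> (X 5 i x \<longleftrightarrow> (X 5 (i + 3) x \<longrightarrow> X 5 k x)))"
    using tr unfolding truth_ok_def by (elim conjE)
  note bin = this[rule_format]
  have truth: "sem R V x \<chi> \<longleftrightarrow> X 5 i x" if "parse i j \<chi>" "x < m" for x i j \<chi>
    using that
  proof (induction \<chi> arbitrary: x i j)
    case (Var v)
    then show ?case using var by simp
  next
    case Bot
    have "\<forall>i<m. \<forall>x<m. code i 1 1 2 \<longrightarrow> \<not> X 5 i x" using tr unfolding truth_ok_def by (elim conjE)
    then show ?case using Bot lt[OF Bot(1)] by (auto simp: parse_Bot)
  next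
    case (Box \<chi>)
    then have b: "code i 2 1 2" "parse (i + 3) j \<chi>" by (auto simp: parse_Box)
    have "\<forall>i<m. \<forall>x<m. \<forall>j<m. code i 2 1 2 \<and> X 3 (i + 3) j \<longrightarrow>
        (X 5 i x \<longleftrightarrow> (\<forall>y<m. X 6 x y \<longrightarrow> X 5 (i + 3) y))" using tr unfolding truth_ok_def by (elim conjE)
    then have "X 5 i x \<longleftrightarrow> (\<forall>y<m. X 6 x y \<longrightarrow> X 5 (i + 3) y)"
      using b F[OF b(2)] lt[OF Box.prems(1)] Box.prems(2) by blast
    then show ?case using Box.IH[OF b(2)] Box.prems(2) by (auto simp: R_def)
  next
    case (And a b)
    then obtain k where k: "code i 1 2 1" "parse (i + 3) k a" "parse k j b" by (auto simp: parse_bin)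
    then have "binary i" by (simp add: binary_def)
    then have "X 5 i x \<longleftrightarrow> X 5 (i + 3) x \<and> X 5 k x"
      using bin[of i x k j] k(1) F[OF k(2)] F[OF k(3)] lt[OF And.prems(1)] lt[OF k(2)] And.prems(2)
      by simp
    then show ?case using And.IH k And.prems(2) by simp
  next
    case (Or a b)
    then obtain k where k: "code i 1 2 2" "parse (i + 3) k a" "parse k j b" by (auto simp: parse_bin)
    then have "binary i" by (simp add: binary_def)
    then have "X 5 i x \<longleftrightarrow> X 5 (i + 3) x \<or> X 5 k x"
      using bin[of i x k j] k(1) F[OF k(2)] F[OF k(3)] lt[OF Or.prems(1)] lt[OF k(2)] Or.prems(2)
      by simp
    then show ?case using Or.IH k Or.prems(2) by simp
  next
    case (Imp a b)
    then obtain k where k: "code i 2 1 1" "parse (i + 3) k a" "parse k j b" by (auto simp: parse_bin)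
    then have "binary i" by (simp add: binary_def)
    then have "X 5 i x \<longleftrightarrow> (X 5 (i + 3) x \<longrightarrow> X 5 k x)"
      using bin[of i x k j] k(1) F[OF k(2)] F[OF k(3)] lt[OF Imp.prems(1)] lt[OF k(2)] Imp.prems(2)
      by simp
    then show ?case using Imp.IH k Imp.prems(2) by simp
  qed
  have "wtrans R"
    unfolding wtrans_def
  proof (intro allI impI)
    fix x y z assume "R x y" "R y z"
    moreover have "\<forall>x<m. \<forall>y<m. \<forall>z<m. X 6 x y \<and> X 6 y z \<longrightarrow> X 0 x z \<or> X 6 x z"
      using bi unfolding bisim_ok_def by (elim conjE)
    note this[rule_format, of x y z]
    ultimately have "x < m" "z < m" "X 0 x z \<or> X 6 x z" unfolding R_def by simp_all
    then show "x = z \<or> R x z" using X_EQ[of x z] by (auto simp: R_def)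
  qed
  moreover have "bisim (vars \<phi> \<inter> vars \<psi>) R V Z"
    unfolding bisim_def
  proof (intro allI impI conjI ballI)
    fix x y v assume z: "Z x y" and v: "v \<in> vars \<phi> \<inter> vars \<psi>"
    obtain i j where i: "cB 0 i" "parse i j (Var v)" using vars_cB[OF p(1)] v by blast
    obtain i' j' where i': "cB r i'" "parse i' j' (Var v)" using vars_cB[OF p(2)] v by blast
    have "X 4 0 i" "X 4 r i'"
      using X_SB i i' lt[OF i(2)] lt[OF i'(2)] lt[OF p(1)] lt[OF p(2)] by auto
    moreover have "code i 1 1 1" "code i' 1 1 1" using i(2) i'(2) by (simp_all add: parse_Var)
    moreover have "X 2 (i + 3) (i' + 3)"
      using X_SM[of "i + 3" "i' + 3"] parse_lt[OF i(2)] parse_lt[OF i'(2)] m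
        parse_same_var[OF i(2) i'(2)] by simp
    moreover have "\<forall>x<m. \<forall>y<m. X 7 x y \<longrightarrow> (\<forall>i<m. \<forall>j<m. X 4 0 i \<and> X 4 r j \<and>
        code i 1 1 1 \<and> code j 1 1 1 \<and> X 2 (i + 3) (j + 3) \<longrightarrow> (X 5 i x \<longleftrightarrow> X 5 j y))"
      using bi unfolding bisim_ok_def by (elim conjE)
    note this[rule_format, of x y i i']
    ultimately have "X 5 i x \<longleftrightarrow> X 5 i' y"
      using z lt(1)[OF i(2)] lt(1)[OF i'(2)] unfolding Z_def by simp
    then show "V x v = V y v" using var[OF i(2)] var[OF i'(2)] z by (simp add: Z_def)
  next
    fix x y x' assume "Z x y" "R x x'"
    moreover have "\<forall>x<m. \<forall>y<m. X 7 x y \<longrightarrow> (\<forall>x'<m. X 6 x x' \<longrightarrow> (\<exists>y'<m. X 6 y y' \<and> X 7 x' y'))"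
      using bi unfolding bisim_ok_def by (elim conjE)
    note this[rule_format, of x y x']
    ultimately show "\<exists>y'. R y y' \<and> Z x' y'" unfolding R_def Z_def by auto
  next
    fix x y y' assume "Z x y" "R y y'"
    moreover have "\<forall>x<m. \<forall>y<m. X 7 x y \<longrightarrow> (\<forall>y'<m. X 6 y y' \<longrightarrow> (\<exists>x'<m. X 6 x x' \<and> X 7 x' y'))"
      using bi unfolding bisim_ok_def by (elim conjE)
    note this[rule_format, of x y y']
    ultimately show "\<exists>x'. R x x' \<and> Z x' y'" unfolding R_def Z_def by auto
  qed
  moreover obtain x y where xy: "x < m" "y < m" "X 7 x y" "X 5 0 x" "\<not> X 5 r y"
  proof -
    have "\<exists>x<m. \<exists>y<m. X 7 x y \<and> X 5 0 x \<and> \<not> X 5 r y"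
      using bi unfolding bisim_ok_def by (elim conjE)
    then show thesis using that by blast
  qed
  moreover have "sem R V x \<phi>" "\<not> sem R V y \<psi>" using truth p xy by simp_all
  ultimately show ?thesis
    unfolding separated_def
    by (intro exI[of _ R] exI[of _ V] exI[of _ Z] exI[of _ x] exI[of _ y]) (auto simp: R_def Z_def)
qed

end

section \<open>Relations obtained from a given model\<close>

definition canonical_rel where
  "canonical_rel T R Z k u v \<longleftrightarrow>
     (if k = (0 :: nat) then u = v else if k = 1 then cN u v
      else if k = 2 then same_num (drop u w) (drop v w) else if k = 3 then cF u v
      else if k = 4 then cB u v else if k = 5 then (T :: nat \<Rightarrow> nat \<Rightarrow> bool) u v
      else if k = 6 then (R :: nat \<Rightarrow> nat \<Rightarrow> bool) u v else (Z :: nat \<Rightarrow> nat \<Rightarrow> bool) u v)"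

lemma canonical_rel_simps [simp]:
  "canonical_rel T R Z 0 = (=)" "canonical_rel T R Z 1 = cN"
  "canonical_rel T R Z (Suc 0) = cN"
  "canonical_rel T R Z 2 = (\<lambda>u v. same_num (drop u w) (drop v w))" "canonical_rel T R Z 3 = cF"
  "canonical_rel T R Z 4 = cB" "canonical_rel T R Z 5 = T" "canonical_rel T R Z 6 = R"
  "canonical_rel T R Z 7 = Z"
  by (simp_all add: canonical_rel_def fun_eq_iff)

lemma canonical_parse_ok:
  assumes "n + 3 \<le> m"
  shows "parse_ok (canonical_rel T R Z) m"
proof -
  have 1: "(\<exists>k<m. cF (i + 3) k \<and> cF k j) \<longleftrightarrow> (\<exists>k. cF (i + 3) k \<and> cF k j)" for i j
  proof -
    have "k < m" if "cF (i + 3) k" for k using cF_lt[OF that] assms by simp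
    then show ?thesis by blast
  qed
  have 2: "(\<exists>k<m. cB r k \<and> child k i) \<longleftrightarrow> (\<exists>k. cB r k \<and> child k i)" if "i < m" for r i
  proof -
    have "k < m" if "child k i" for k using child_lt[OF that] \<open>i < m\<close> by simp
    then show ?thesis by blast
  qed
  show ?thesis
    unfolding parse_ok_def canonical_rel_simps child_def[symmetric] 1
    by (intro conjI allI impI, simp, simp, simp, simp, rule cN_step, rule same_num_step, rule cF_step)
      (simp only: 2 cB_step[symmetric])
qed

lemma separated_complete:
  assumes m: "n + 3 \<le> m" and p: "parse 0 r \<phi>" "parse r n \<psi>" and s: "separated m \<phi> \<psi>"
  shows "\<exists>X. parse_ok X m \<and> truth_ok X m \<and> bisim_ok X m r"
proof -
  obtain R V Z x y where
    lt: "\<And>i j. R i j \<Longrightarrow> i < m \<and> j < m" "\<And>i j. Z i j \<Longrightarrow> i < m \<and> j < m"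
    and RZ: "wtrans R" "bisim (vars \<phi> \<inter> vars \<psi>) R V Z" "Z x y" "sem R V x \<phi>" "\<not> sem R V y \<psi>"
    using s unfolding separated_def by metis
  \<comment> \<open>Truth is assigned at every position where some formula parses; the choice is
    unambiguous by \<open>parse_unique\<close>.\<close>
  define T where "T i x \<longleftrightarrow> (\<exists>\<chi> j. parse i j \<chi> \<and> sem R V x \<chi>)" for i x
  let ?X = "canonical_rel T R Z"
  have T: "T i x \<longleftrightarrow> sem R V x \<chi>" if "parse i j \<chi>" for i j x \<chi>
    using that parse_unique unfolding T_def by metis
  have "truth_ok ?X m"
    unfolding truth_ok_def canonical_rel_simps
  proof (intro conjI allI impI)
    fix i x assume "code i 1 1 2"
    then have "parse i (i + 3) Bot" by (simp add: parse_Bot)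
    then show "\<not> T i x" using T by simp
  next
    fix i x k j assume "binary i \<and> cF (i + 3) k \<and> cF k j" "code i 1 2 1"
    then obtain a b where "parse (i + 3) k a" "parse k j b" "parse i j (And a b)"
      by (auto simp: cF_def parse_bin)
    then show "T i x = (T (i + 3) x \<and> T k x)" using T by simp
  next
    fix i x k j assume "binary i \<and> cF (i + 3) k \<and> cF k j" "code i 1 2 2"
    then obtain a b where "parse (i + 3) k a" "parse k j b" "parse i j (Or a b)"
      by (auto simp: cF_def parse_bin)
    then show "T i x = (T (i + 3) x \<or> T k x)" using T by simp
  next
    fix i x k j assume "binary i \<and> cF (i + 3) k \<and> cF k j" "code i 2 1 1"
    then obtain a b where "parse (i + 3) k a" "parse k j b" "parse i j (Imp a b)"
      by (auto simp: cF_def parse_bin)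
    then show "T i x = (T (i + 3) x \<longrightarrow> T k x)" using T by simp
  next
    fix i x j assume "code i 2 1 2 \<and> cF (i + 3) j"
    then obtain a where "parse (i + 3) j a" "parse i j (Box a)" by (auto simp: cF_def parse_Box)
    then show "T i x = (\<forall>y<m. R x y \<longrightarrow> T (i + 3) y)" using T lt(1) by simp blast
  next
    fix i x i' j j'
    assume a: "code i 1 1 1 \<and> code i' 1 1 1 \<and> cF i j \<and> cF i' j' \<and>
      same_num (drop (i + 3) w) (drop (i' + 3) w)"
    then obtain v v' where v: "parse i j (Var v)" "parse i' j' (Var v')"
      using parse_code_Var unfolding cF_def by metis
    then have "v = v'" using a parse_same_var by blast
    then show "T i x = T i' x" using v T by simp
  qed
  moreover have "bisim_ok ?X m r"
    unfolding bisim_ok_def canonical_rel_simps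
  proof (intro conjI allI impI)
    fix x y z assume "R x y \<and> R y z"
    then show "x = z \<or> R x z" using RZ(1) unfolding wtrans_def by blast
  next
    fix x y i j assume z: "Z x y" and a: "cB 0 i \<and> cB r j \<and> code i 1 1 1 \<and> code j 1 1 1 \<and>
      same_num (drop (i + 3) w) (drop (j + 3) w)"
    obtain \<chi> i' where \<chi>: "parse i i' \<chi>" "vars \<chi> \<subseteq> vars \<phi>" using cB_parse[of 0 i] a p(1) by blast
    obtain \<chi>' j' where \<chi>': "parse j j' \<chi>'" "vars \<chi>' \<subseteq> vars \<psi>" using cB_parse[of r j] a p(2) by blast
    obtain v v' where v: "\<chi> = Var v" "\<chi>' = Var v'" using parse_code_Var \<chi> \<chi>' a by metis
    then have "v = v'" using parse_same_var \<chi>(1) \<chi>'(1) a by blast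
    then have "V x v = V y v" using v \<chi>(2) \<chi>'(2) z RZ(2) unfolding bisim_def by simp
    then show "T i x = T j y" using T[OF \<chi>(1)] T[OF \<chi>'(1)] v \<open>v = v'\<close> by simp
  next
    fix x y x' assume "Z x y" "R x x'"
    then show "\<exists>y'<m. R y y' \<and> Z x' y'" using RZ(2) lt(1) unfolding bisim_def by meson
  next
    fix x y y' assume "Z x y" "R y y'"
    then show "\<exists>x'<m. R x x' \<and> Z x' y'" using RZ(2) lt(1) unfolding bisim_def by meson
  next
    show "\<exists>x<m. \<exists>y<m. Z x y \<and> T 0 x \<and> \<not> T r y"
      using RZ(3-5) lt(2)[OF RZ(3)] T[OF p(1)] T[OF p(2)] by blast
  qed
  ultimately show ?thesis using canonical_parse_ok[OF m] by blast
qed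

theorem separated_fo_iff:
  assumes m: "n + 3 \<le> m"
  shows "(\<exists>X. sat sym X m (\<lambda>_. 0) separated_fo) \<longleftrightarrow>
    \<not> (\<exists>\<phi> \<psi>. w = enc \<phi> @ enc \<psi> \<and> \<not> separated m \<phi> \<psi>)"
proof -
  have root: "(\<exists>r. parse 0 r \<phi> \<and> parse r n \<psi>) \<longleftrightarrow> w = enc \<phi> @ enc \<psi>" for \<phi> \<psi>
    using parse_append[of 0 \<phi> n \<psi>] by simp
  show ?thesis
  proof
    assume "\<exists>X. sat sym X m (\<lambda>_. 0) separated_fo"
    then obtain X where ok: "parse_ok X m" and
      X: "\<not> (\<exists>r \<phi> \<psi>. parse 0 r \<phi> \<and> parse r n \<psi>) \<or>
        (\<exists>r \<phi> \<psi>. parse 0 r \<phi> \<and> parse r n \<psi> \<and> truth_ok X m \<and> bisim_ok X m r)"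
      unfolding sat_separated_fo using X_root[OF _ m] by metis
    show "\<not> (\<exists>\<phi> \<psi>. w = enc \<phi> @ enc \<psi> \<and> \<not> separated m \<phi> \<psi>)"
    proof (intro notI, elim exE conjE)
      fix \<phi> \<psi> assume w: "w = enc \<phi> @ enc \<psi>" "\<not> separated m \<phi> \<psi>"
      then obtain r \<phi>' \<psi>' where r: "parse 0 r \<phi>'" "parse r n \<psi>'" "truth_ok X m" "bisim_ok X m r"
        using X root by blast
      then have "w = enc \<phi>' @ enc \<psi>'" using root by blast
      then have "\<phi>' = \<phi>" "\<psi>' = \<psi>" using w(1) enc_pair_inject by metis+
      then show False using separated_sound[OF ok m r(3,4,1,2)] w(2) by simp
    qed
  next
    assume ns: "\<not> (\<exists>\<phi> \<psi>. w = enc \<phi> @ enc \<psi> \<and> \<not> separated m \<phi> \<psi>)"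
    show "\<exists>X. sat sym X m (\<lambda>_. 0) separated_fo"
    proof (cases "\<exists>\<phi> \<psi>. w = enc \<phi> @ enc \<psi>")
      case True
      then obtain \<phi> \<psi> r where r: "parse 0 r \<phi>" "parse r n \<psi>" "separated m \<phi> \<psi>"
        using ns root by metis
      then obtain X where "parse_ok X m" "truth_ok X m" "bisim_ok X m r"
        using separated_complete[OF m] by blast
      then show ?thesis unfolding sat_separated_fo using X_root[of X m r] m r by blast
    next
      case False
      \<comment> \<open>For a word that encodes no pair only the syntactic relations matter; truth,
        accessibility and bisimulation may be empty.\<close>
      have "parse_ok (canonical_rel (\<lambda>_ _. False) (\<lambda>_ _. False) (\<lambda>_ _. False)) m"
        by (rule canonical_parse_ok[OF m])
      then show ?thesis unfolding sat_separated_fo using X_root[OF _ m] False root by blast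
    qed
  qed
qed

end

section \<open>The machine\<close>

text \<open>In contrast to \<open>ev\<close> the tape contents may change, as happens while marks
  are written.\<close>

definition evs :: "prog \<Rightarrow> mstate \<Rightarrow> nat \<Rightarrow> mstate \<Rightarrow> bool" where
  "evs p s n s' \<longleftrightarrow> tri p s n (\<lambda>t. t = s')"

lemma ev_evs: "ev C p h n h' \<longleftrightarrow> evs p (h, C) n (h', C)"
  by (simp add: ev_def evs_def)

lemma evs_Seq: "evs p s a s1 \<Longrightarrow> evs q s1 b s2 \<Longrightarrow> evs (Seq p q) s (Suc (a + b)) s2"
  unfolding evs_def by (erule tri_Seq) simp

lemma evs_mono: "evs p s n s' \<Longrightarrow> n \<le> n' \<Longrightarrow> evs p s n' s'"
  unfolding evs_def by (erule tri_mono)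

lemma evs_Wr: "evs (Wr i a) (h, C) 1 (h, C(i := (C i)(h i := a)))"
  unfolding evs_def by (rule tri_Wr) simp

primrec each :: "(nat \<Rightarrow> prog) \<Rightarrow> nat list \<Rightarrow> prog" where
  "each f [] = Mv 0 0"
| "each f (i # is) = Seq (f i) (each f is)"

lemma evs_each:
  assumes "\<And>i C. i \<in> set is \<Longrightarrow> P C \<Longrightarrow> evs (f i) (h, C) n (h, C(i := u i (C i))) \<and> P (C(i := u i (C i)))"
    and "distinct is" "P C"
  shows "evs (each f is) (h, C) (Suc (length is * Suc n)) (h, \<lambda>i. if i \<in> set is then u i (C i) else C i)"
  using assms
proof (induction "is" arbitrary: C)
  case Nil
  then show ?case using ev_Mv0[of C 0 h] by (simp add: ev_evs)
next
  case (Cons i "is")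
  let ?C = "C(i := u i (C i))"
  have "evs (f i) (h, C) n (h, ?C) \<and> P ?C" by (rule Cons.prems(1)) (use Cons.prems in auto)
  then have 1: "evs (f i) (h, C) n (h, ?C)" and P: "P ?C" by blast+
  have "evs (each f is) (h, ?C) (Suc (length is * Suc n)) (h, \<lambda>j. if j \<in> set is then u j (?C j) else ?C j)"
  proof (rule Cons.IH)
    show "evs (f j) (h, D) n (h, D(j := u j (D j))) \<and> P (D(j := u j (D j)))"
      if "j \<in> set is" "P D" for j D
      by (rule Cons.prems(1)) (use that in simp_all)
    show "distinct is" using Cons.prems(2) by simp
  qed (rule P)
  from evs_Seq[OF 1 this]
  have "evs (each f (i # is)) (h, C) (Suc (n + Suc (length is * Suc n)))
    (h, \<lambda>j. if j \<in> set is then u j (?C j) else ?C j)" by simp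
  moreover have "(\<lambda>j. if j \<in> set is then u j (?C j) else ?C j) =
      (\<lambda>j. if j \<in> set (i # is) then u j (C j) else C j)"
    using Cons.prems(2) by auto
  ultimately show ?case by (simp add: add_ac)
qed

definition mark :: "nat \<Rightarrow> prog" where
  "mark i = (if i \<le> 8 then Seq (Mv i (-1)) (Seq (Wr i 3) (Mv i 1)) else Wr i 3)"

lemma evs_mark:
  assumes "h i = 0"
  shows "evs (mark i) (h, C) 5 (h, C(i := (C i)((if i \<le> 8 then -1 else 0) := 3)))"
proof (cases "i \<le> 8")
  case True
  have 1: "evs (Mv i (-1)) (h, C) 1 (h(i := -1), C)"
    using ev_Mv[of C i "-1" h] assms by (simp add: ev_evs)
  have 2: "evs (Wr i 3) (h(i := -1), C) 1 (h(i := -1), C(i := (C i)(-1 := 3)))"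
    using evs_Wr[of i 3 "h(i := -1)" C] by simp
  have "h(i := 0) = h" using assms by auto
  then have 3: "evs (Mv i 1) (h(i := -1), C(i := (C i)(-1 := 3))) 1 (h, C(i := (C i)(-1 := 3)))"
    using ev_Mv[of _ i 1 "h(i := -1)"] by (simp add: ev_evs)
  have "evs (Seq (Mv i (-1)) (Seq (Wr i 3) (Mv i 1))) (h, C) (Suc (1 + Suc (1 + 1))) (h, C(i := (C i)(-1 := 3)))"
    by (rule evs_Seq[OF 1 evs_Seq[OF 2 3]])
  then show ?thesis using True by (simp add: mark_def eval_nat_numeral)
next
  case False
  then show ?thesis using evs_mono[OF evs_Wr[of i 3 h C], of 5] assms by (simp add: mark_def)
qed

definition marked :: "bool list \<Rightarrow> nat \<Rightarrow> int \<Rightarrow> nat" where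
  "marked w i = (if i < 40 then (snd (input_state w) i)((if i \<le> 8 then -1 else 0) := 3)
     else snd (input_state w) i)"

lemma evs_marks: "evs (each mark [0..<40]) (input_state w) 241 (\<lambda>_. 0, marked w)"
proof -
  have 1: "evs (each mark [0..<40]) (\<lambda>_. 0, snd (input_state w)) (Suc (length [0..<40] * Suc 5))
    (\<lambda>_. 0, \<lambda>i. if i \<in> set [0..<40] then (snd (input_state w) i)((if i \<le> 8 then -1 else 0) := 3)
       else snd (input_state w) i)"
    by (rule evs_each[where P = "\<lambda>_. True" and u = "\<lambda>i c. c((if i \<le> 8 then -1 else 0) := 3)"])
      (use evs_mark in auto)
  have 2: "(\<lambda>i. if i \<in> set [0..<40] then (snd (input_state w) i)((if i \<le> 8 then -1 else 0) := 3)
       else snd (input_state w) i) = marked w"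
    by (auto simp: marked_def fun_eq_iff)
  have 3: "(\<lambda>_. 0, snd (input_state w)) = input_state w" by (simp add: input_state_def)
  have "Suc (length [0..<40] * Suc 5) = 241" by simp
  with 1 show ?thesis unfolding 2 3 by (simp only:)
qed

subsection \<open>Exponentials\<close>

definition dbl :: "nat \<Rightarrow> prog" where
  "dbl a = Seq (While a 3 (Seq (Mv a (-1)) (Seq (Mv 10 1) (Mv 10 1))))
     (While 10 3 (Seq (Mv 10 (-1)) (Mv a 1)))"

context counters
begin

lemma ev_dbl:
  assumes a: "10 < a" "a < 40" and h: "h 10 = 0" "h a = int k"
  shows "ev C (dbl a) h (3 + 14 * k) (h(a := int (2 * k)))"
proof -
  define f where "f j = h(a := int k - int j, 10 := int (2 * j))" for j
  define g where "g j = h(a := int j, 10 := int (2 * k) - int j)" for j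
  have f: "ev C (Seq (Mv a (-1)) (Seq (Mv 10 1) (Mv 10 1))) (f j) (Suc (1 + Suc (1 + 1))) (f (Suc j))" for j
  proof -
    let ?h1 = "(f j)(a := f j a + - 1)"
    let ?h2 = "?h1(10 := ?h1 10 + 1)"
    have "?h2(10 := ?h2 10 + 1) = f (Suc j)" using a by (auto simp: f_def fun_eq_iff)
    then show ?thesis
      using ev_Seq[OF ev_Mv[of C a "-1" "f j"] ev_Seq[OF ev_Mv[of C 10 1 ?h1] ev_Mv[of C 10 1 ?h2]]] by simp
  qed
  have g: "ev C (Seq (Mv 10 (-1)) (Mv a 1)) (g j) (Suc (1 + 1)) (g (Suc j))" for j
  proof -
    let ?h1 = "(g j)(10 := g j 10 + - 1)"
    have "?h1(a := ?h1 a + 1) = g (Suc j)" using a by (auto simp: g_def fun_eq_iff)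
    then show ?thesis using ev_Seq[OF ev_Mv[of C 10 "-1" "g j"] ev_Mv[of C a 1 ?h1]] by simp
  qed
  have 1: "ev C (While a 3 (Seq (Mv a (-1)) (Seq (Mv 10 1) (Mv 10 1)))) h
      (Suc (k * Suc (Suc (1 + Suc (1 + 1))))) (f k)"
    by (rule ev_While[where f = f]) (use f h a counter in \<open>auto simp: f_def\<close>)
  have 2: "ev C (While 10 3 (Seq (Mv 10 (-1)) (Mv a 1))) (f k) (Suc (2 * k * Suc (Suc (1 + 1)))) (g (2 * k))"
    by (rule ev_While[where f = g]) (use g h a counter in \<open>auto simp: f_def g_def\<close>)
  have "g (2 * k) = h(a := int (2 * k))" using h a by (auto simp: g_def)
  then show ?thesis using ev_Seq[OF 1 2] unfolding dbl_def by (simp add: algebra_simps eval_nat_numeral)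
qed

lemma ev_power:
  assumes b: "10 < b" "b < 40" "i \<noteq> b" "i \<noteq> 10" and h: "h 10 = 0" "h b = 1"
    and C: "\<And>k. k < N \<Longrightarrow> C i (h i + d * int k) \<noteq> a" "C i (h i + d * int N) = a"
  shows "ev C (While i a (Seq (Mv i d) (dbl b))) h (Suc (N * (6 + 14 * 2 ^ N)))
    (h(i := h i + d * int N, b := 2 ^ N))"
proof -
  define f where "f k = h(i := h i + d * int k, b := 2 ^ k)" for k
  have f: "ev C (Seq (Mv i d) (dbl b)) (f k) (5 + 14 * 2 ^ N) (f (Suc k))" if "k < N" for k
  proof -
    let ?h = "(f k)(i := f k i + d)"
    have "ev C (dbl b) ?h (3 + 14 * 2 ^ k) (?h(b := int (2 * 2 ^ k)))"
      by (rule ev_dbl) (use b h in \<open>auto simp: f_def\<close>)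
    moreover have "?h(b := int (2 * 2 ^ k)) = f (Suc k)" using b by (auto simp: f_def fun_eq_iff algebra_simps)
    ultimately have "ev C (Seq (Mv i d) (dbl b)) (f k) (Suc (1 + (3 + 14 * 2 ^ k))) (f (Suc k))"
      using ev_Seq[OF ev_Mv[of C i d "f k"]] by metis
    moreover have "(2::nat) ^ k \<le> 2 ^ N" using that by (simp add: power_increasing)
    ultimately show ?thesis by (auto elim: ev_mono)
  qed
  have "f 0 = h" using h by (auto simp: f_def)
  then have "ev C (While i a (Seq (Mv i d) (dbl b))) h (Suc (N * Suc (5 + 14 * 2 ^ N))) (f N)"
    by (intro ev_While[where f = f]) (use f C b in \<open>auto simp: f_def\<close>)
  then show ?thesis by (simp add: f_def)
qed

end

text \<open>Each stage starts a counter at 1 and doubles it once per unit of the preceding stage, so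
  the value reached becomes the next exponent. The first exponent is the length of the
  input.\<close>

definition powers :: prog where
  "powers =
     Seq (Mv 36 1) (Seq (While 0 0 (Seq (Mv 0 1) (dbl 36))) (Seq (Seq (reset 0) (Mv 0 1))
    (Seq (Mv 37 1) (Seq (While 36 3 (Seq (Mv 36 (-1)) (dbl 37)))
    (Seq (Mv 38 1) (While 37 3 (Seq (Mv 37 (-1)) (dbl 38))))))))"

abbreviation tower :: "nat \<Rightarrow> nat" where
  "tower n \<equiv> 2 ^ (2 ^ (2 ^ n))"

lemma counters_marked: "counters (marked w)"
  by unfold_locales (auto simp: marked_def input_state_def)

lemma le_self_power: "k \<le> 2 ^ (k :: nat)"
  by (simp add: less_imp_le)

lemma ev_powers:
  "ev (marked w) powers (\<lambda>_. 0) (200 * tower (length w) ^ 2) ((\<lambda>_. 0)(38 := int (tower (length w))))"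
proof -
  let ?n = "length w" and ?C = "marked w" and ?z = "(\<lambda>_. 0) :: nat \<Rightarrow> int"
  let ?B = "tower ?n"
  interpret counters ?C by (rule counters_marked)
  have C0: "?C 0 z = (if z = -1 then 3 else if 0 \<le> z \<and> z < int ?n then if w ! nat z then 2 else 1 else 0)" for z
    by (auto simp: marked_def input_state_def input_tape_def)
  let ?a1 = "?z(36 := 1)"
  let ?a2 = "?z(0 := int ?n, 36 := 2 ^ ?n)"
  let ?a3 = "?z(36 := 2 ^ ?n)"
  let ?a4 = "?z(36 := 2 ^ ?n, 37 := 1)"
  let ?a5 = "?z(37 := 2 ^ (2 ^ ?n))"
  let ?a6 = "?z(37 := 2 ^ (2 ^ ?n), 38 := 1)"
  have 1: "ev ?C (Mv 36 1) ?z 1 ?a1" using ev_Mv[of ?C 36 1 ?z] by simp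
  have 2: "ev ?C (While 0 0 (Seq (Mv 0 1) (dbl 36))) ?a1 (Suc (?n * (6 + 14 * 2 ^ ?n))) ?a2"
  proof -
    have "?a1(0 := ?a1 0 + 1 * int ?n, 36 := 2 ^ ?n) = ?a2" by (simp add: fun_upd_twist)
    then show ?thesis using ev_power[of 36 0 ?a1 ?n 1 0] C0 by (simp add: fun_upd_twist)
  qed
  have 3: "ev ?C (Seq (reset 0) (Mv 0 1)) ?a2 (Suc (Suc ((?n + 1) * 2) + 1)) ?a3"
  proof -
    have "ev ?C (reset 0) ?a2 (Suc (nat (?a2 0 - -1) * 2)) (?a2(0 := -1))"
      by (rule ev_reset) (use C0 in auto)
    moreover have "ev ?C (Mv 0 1) (?a2(0 := -1)) 1 ?a3"
    proof -
      have "?a2(0 := -1, 0 := (?a2(0 := -1)) 0 + 1) = ?a3" by (auto simp: fun_eq_iff)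
      then show ?thesis using ev_Mv[of ?C 0 1 "?a2(0 := -1)"] by simp
    qed
    moreover have "nat (?a2 0 - -1) = ?n + 1" by simp
    ultimately show ?thesis using ev_Seq by metis
  qed
  have 4: "ev ?C (Mv 37 1) ?a3 1 ?a4" using ev_Mv[of ?C 37 1 ?a3] by simp
  have 5: "ev ?C (While 36 3 (Seq (Mv 36 (-1)) (dbl 37))) ?a4
      (Suc (2 ^ ?n * (6 + 14 * 2 ^ (2 ^ ?n)))) ?a5"
  proof -
    have "?a4(36 := ?a4 36 + - 1 * int (2 ^ ?n), 37 := 2 ^ (2 ^ ?n)) = ?a5" by (auto simp: fun_eq_iff)
    moreover have "?C 36 (?a4 36 + - 1 * int k) \<noteq> 3" if "k < 2 ^ ?n" for k
    proof (rule counter(2))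
      have "int k < int (2 ^ ?n)" using that by (simp only: of_nat_less_iff)
      then show "0 < ?a4 36 + - 1 * int k" by simp
    qed simp_all
    ultimately show ?thesis using ev_power[of 37 36 ?a4 "2 ^ ?n" "-1" 3] counter(1)[of 36] by simp
  qed
  have 6: "ev ?C (Mv 38 1) ?a5 1 ?a6" using ev_Mv[of ?C 38 1 ?a5] by simp
  have 7: "ev ?C (While 37 3 (Seq (Mv 37 (-1)) (dbl 38))) ?a6
      (Suc (2 ^ (2 ^ ?n) * (6 + 14 * 2 ^ (2 ^ (2 ^ ?n))))) (?z(38 := int ?B))"
  proof -
    have "?a6(37 := ?a6 37 + - 1 * int (2 ^ (2 ^ ?n)), 38 := 2 ^ (2 ^ (2 ^ ?n))) = ?z(38 := int ?B)"
      by (auto simp: fun_eq_iff)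
    moreover have "?C 37 (?a6 37 + - 1 * int k) \<noteq> 3" if "k < 2 ^ (2 ^ ?n)" for k
    proof (rule counter(2))
      have "int k < int (2 ^ (2 ^ ?n))" using that by (simp only: of_nat_less_iff)
      then show "0 < ?a6 37 + - 1 * int k" by simp
    qed simp_all
    ultimately show ?thesis using ev_power[of 38 37 ?a6 "2 ^ (2 ^ ?n)" "-1" 3] counter(1)[of 37] by simp
  qed
  have time: "Suc (1 + Suc (Suc (?n * (6 + 14 * 2 ^ ?n)) + Suc (Suc (Suc ((?n + 1) * 2) + 1) +
      Suc (1 + Suc (Suc (2 ^ ?n * (6 + 14 * 2 ^ (2 ^ ?n))) +
      Suc (1 + Suc (2 ^ (2 ^ ?n) * (6 + 14 * 2 ^ (2 ^ (2 ^ ?n))))))))) ) \<le> 200 * ?B ^ 2"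
  proof -
    \<comment> \<open>As every stage is bounded by the last value \<open>b\<close>, the loop costs
      \<open>u\<close>, \<open>v\<close> and \<open>x\<close> are each at most
      \<open>6 * b + 14 * Y\<close>; the other terms are linear in \<open>b\<close>.\<close>
    have *: "Suc (1 + Suc (Suc (p * (6 + 14 * q)) + Suc (Suc (Suc ((p + 1) * 2) + 1) +
      Suc (1 + Suc (Suc (q * (6 + 14 * r)) + Suc (1 + Suc (r * (6 + 14 * b)))))))) \<le> 200 * b ^ 2"
      if "p \<le> q" "q \<le> r" "r \<le> b" "1 \<le> b" for p q r b :: nat
    proof -
      define Y where "Y = b * b"
      have Y: "b * (6 + 14 * b) = 6 * b + 14 * Y" by (simp add: Y_def algebra_simps)
      define u v x where "u = p * (6 + 14 * q)" and "v = q * (6 + 14 * r)" and "x = r * (6 + 14 * b)"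
      have "u \<le> 6 * b + 14 * Y" "v \<le> 6 * b + 14 * Y" "x \<le> 6 * b + 14 * Y"
        unfolding u_def v_def x_def Y[symmetric] using that by (intro mult_le_mono; simp)+
      moreover have "b \<le> Y" using that by (auto simp: Y_def)
      moreover have "p \<le> b" "1 \<le> b" using that by simp_all
      ultimately show ?thesis
        unfolding power2_eq_square Y_def[symmetric] u_def[symmetric] v_def[symmetric] x_def[symmetric]
        by simp
    qed
    show ?thesis by (rule *) (simp_all add: le_self_power)
  qed
  show ?thesis
    unfolding powers_def
    by (rule ev_mono[OF ev_Seq[OF 1 ev_Seq[OF 2 ev_Seq[OF 3 ev_Seq[OF 4 ev_Seq[OF 5 ev_Seq[OF 6 7]]]]]] time])
qed

subsection \<open>Range marks and guesses\<close>

definition limit :: "nat \<Rightarrow> prog" where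
  "limit i = Seq (forv 38 (Mv i 1)) (Seq (Wr i 4) (reset i))"

lemma (in counters) evs_limit:
  assumes i: "11 \<le> i" "i < 36" and h: "\<And>j. j < 36 \<Longrightarrow> h j = 0" "h 38 = int m" and m: "0 < m"
  shows "evs (limit i) (h, C) (12 * m + 10) (h, C(i := (C i)(int m := 4)))"
proof -
  let ?h = "h(i := int m)"
  have 1: "evs (forv 38 (Mv i 1)) (h, C) (3 + m * (1 + 9)) (?h, C)"
    using ev_forv[OF adv_Mv[of i], of h 38] i h by (simp add: ev_evs)
  have 2: "evs (Wr i 4) (?h, C) 1 (?h, C(i := (C i)(int m := 4)))"
    using evs_Wr[of i 4 ?h C] by simp
  have "ev (C(i := (C i)(int m := 4))) (reset i) ?h (Suc (nat (?h i - 0) * 2)) (?h(i := 0))"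
    by (rule ev_reset) (use counter i m in auto)
  moreover have "?h(i := 0) = h" using h(1)[of i] i by auto
  ultimately have 3: "evs (reset i) (?h, C(i := (C i)(int m := 4))) (Suc (m * 2)) (h, C(i := (C i)(int m := 4)))"
    by (simp add: ev_evs)
  have "evs (limit i) (h, C) (Suc (3 + m * (1 + 9) + Suc (1 + Suc (m * 2)))) (h, C(i := (C i)(int m := 4)))"
    unfolding limit_def by (rule evs_Seq[OF 1 evs_Seq[OF 2 3]])
  then show ?thesis by (auto elim: evs_mono)
qed

definition range_tapes :: "nat list" where
  "range_tapes = 11 # map (\<lambda>j. 12 + 2 * j) [0..<12]"

definition limited :: "bool list \<Rightarrow> nat \<Rightarrow> int \<Rightarrow> nat" where
  "limited w = (\<lambda>i. if i \<in> set range_tapes then (marked w i)(int (tower (length w)) := 4) else marked w i)"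

lemma range_tapes: "i \<in> set range_tapes \<Longrightarrow> 11 \<le> i \<and> i < 36"
  "11 \<le> i \<Longrightarrow> i < 36 \<Longrightarrow> i = 11 \<or> even i \<Longrightarrow> i \<in> set range_tapes"
proof -
  show "i \<in> set range_tapes \<Longrightarrow> 11 \<le> i \<and> i < 36" by (auto simp: range_tapes_def)
  assume i: "11 \<le> i" "i < 36" "i = 11 \<or> even i"
  show "i \<in> set range_tapes"
  proof (cases "i = 11")
    case False
    define j where "j = (i - 12) div 2"
    have "i = 12 + 2 * j" "j < 12" using i False unfolding j_def by presburger+
    then show ?thesis by (auto simp: range_tapes_def)
  qed (simp add: range_tapes_def)
qed

lemma evs_limits:
  fixes w defines "m \<equiv> tower (length w)"
  shows "evs (each limit range_tapes) ((\<lambda>_. 0)(38 := int m), marked w) (Suc (13 * Suc (12 * m + 10)))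
    ((\<lambda>_. 0)(38 := int m), limited w)"
proof -
  have m: "0 < m" by (simp add: m_def)
  have "evs (each limit range_tapes) ((\<lambda>_. 0)(38 := int m), marked w)
    (Suc (length range_tapes * Suc (12 * m + 10))) ((\<lambda>_. 0)(38 := int m),
    \<lambda>i. if i \<in> set range_tapes then (marked w i)(int m := 4) else marked w i)"
  proof (rule evs_each[where P = counters and u = "\<lambda>i c. c(int m := 4)"])
    fix i C assume i: "i \<in> set range_tapes" and C: "counters C"
    show "evs (limit i) ((\<lambda>_. 0)(38 := int m), C) (12 * m + 10) ((\<lambda>_. 0)(38 := int m), C(i := (C i)(int m := 4))) \<and>
      counters (C(i := (C i)(int m := 4)))"
    proof
      show "evs (limit i) ((\<lambda>_. 0)(38 := int m), C) (12 * m + 10) ((\<lambda>_. 0)(38 := int m), C(i := (C i)(int m := 4)))"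
        by (rule counters.evs_limit[OF C]) (use range_tapes(1)[OF i] m in auto)
      show "counters (C(i := (C i)(int m := 4)))"
        using C m unfolding counters_def by auto
    qed
  qed (use counters_marked in \<open>auto simp: range_tapes_def distinct_map inj_on_def\<close>)
  moreover have "length range_tapes = 13" by (simp add: range_tapes_def)
  ultimately show ?thesis unfolding limited_def m_def[symmetric] by simp
qed

lemma layout_limited: "layout (limited w) (tower (length w))"
proof -
  let ?m = "tower (length w)"
  have m: "0 < ?m" by simp
  have 9: "i \<in> set range_tapes \<Longrightarrow> \<not> i \<le> 8" for i using range_tapes(1)[of i] by auto
  show ?thesis
  proof unfold_locales
    fix i :: nat and z :: int
    show "9 \<le> i \<Longrightarrow> i < 40 \<Longrightarrow> limited w i 0 = 3"
      using counters.counter(1)[OF counters_marked, of i w] by (auto simp: limited_def)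
    show "9 \<le> i \<Longrightarrow> i < 40 \<Longrightarrow> 0 < z \<Longrightarrow> limited w i z \<noteq> 3"
      using counters.counter(2)[OF counters_marked, of i z w] by (auto simp: limited_def)
    show "11 \<le> i \<Longrightarrow> i < 36 \<Longrightarrow> i = 11 \<or> even i \<Longrightarrow> limited w i (int ?m) = 4"
      using range_tapes(2)[of i] by (auto simp: limited_def)
    show "11 \<le> i \<Longrightarrow> i < 36 \<Longrightarrow> i = 11 \<or> even i \<Longrightarrow> 0 \<le> z \<Longrightarrow> z < int ?m \<Longrightarrow> limited w i z \<noteq> 4"
      by (auto simp: limited_def marked_def input_state_def)
    show "i \<le> 8 \<Longrightarrow> limited w i (-1) = 3"
      using 9[of i] by (auto simp: limited_def marked_def)
    show "i \<le> 8 \<Longrightarrow> 0 \<le> z \<Longrightarrow> limited w i z \<noteq> 3"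
      using 9[of i] by (auto simp: limited_def marked_def input_state_def input_tape_def)
  qed
qed

text \<open>Counter 39 is first set to the number of table cells, the square of
  \<open>m + 4\<close>, and then counted down with one binary choice per cell.\<close>

definition guess :: "nat \<Rightarrow> prog" where
  "guess X = Seq (Seq (forv 38 (stride 39)) (reps 39 4 (stride 39)))
    (Seq (While 39 3 (Seq (Mv 39 (-1)) (Seq (Choose (Wr X 1) (Wr X 2)) (Mv X 1))))
      (Seq (reset X) (Mv X 1)))"

definition fill :: "nat \<Rightarrow> (nat \<Rightarrow> nat) \<Rightarrow> (int \<Rightarrow> nat) \<Rightarrow> int \<Rightarrow> nat" where
  "fill k G c = (\<lambda>z. if 0 \<le> z \<and> z < int k then G (nat z) else c z)"

context layout
begin

lemma layout_upd: "\<lbrakk>X \<le> 8; D (-1) = 3; \<And>z. 0 \<le> z \<Longrightarrow> D z \<noteq> 3\<rbrakk> \<Longrightarrow> layout (C(X := D)) m"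
  using counter end_mark work by unfold_locales auto

lemma layout_fill:
  assumes "1 \<le> X" "X \<le> 8" "\<And>z. G z \<in> {1, 2}"
  shows "layout (C(X := fill k G (C X))) m"
proof (rule layout_upd)
  show "fill k G (C X) z \<noteq> 3" if "0 \<le> z" for z
    using work(2)[OF assms(2) that] assms(3)[of "nat z"] by (auto simp: fill_def)
qed (use assms work in \<open>auto simp: fill_def\<close>)

abbreviation "side \<equiv> m + 4"

lemma ev_size:
  assumes h: "h 10 = 0" "h 11 = 0" "h 38 = int m" "h 39 = 0"
  shows "ev C (Seq (forv 38 (stride 39)) (reps 39 4 (stride 39))) h (40 * side ^ 2)
    (h(39 := int (side * side)))"
proof -
  let ?h = "h(39 := h 39 + h 38 * int side)"
  have 1: "ev C (forv 38 (stride 39)) h (3 + nat (h 38) * (6 * m + 13 + 9)) ?h"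
    by (rule ev_forv[OF adv_stride]) (use h in auto)
  have 2: "ev C (reps 39 4 (stride 39)) ?h (Suc (4 * Suc (6 * m + 13))) (?h(39 := ?h 39 + int (4 * side)))"
    by (rule advD[OF adv_reps[OF adv_stride]]) (use h in auto)
  have "?h(39 := ?h 39 + int (4 * side)) = h(39 := int (side * side))"
    using h by (simp add: algebra_simps)
  moreover have "Suc (3 + nat (h 38) * (6 * m + 13 + 9) + Suc (4 * Suc (6 * m + 13))) \<le> 40 * side ^ 2"
    using h by (simp add: power2_eq_square algebra_simps)
  ultimately show ?thesis using ev_mono[OF ev_Seq[OF 1 2]] by simp
qed

lemma tri_guess:
  assumes X: "1 \<le> X" "X \<le> 8" and h: "\<And>i. i \<le> 11 \<Longrightarrow> h i = 0" "h 38 = int m" "h 39 = 0"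
  shows "tri (guess X) (h, C) (100 * side ^ 2)
    (\<lambda>s. \<exists>G. (\<forall>z. G z \<in> {1, 2}) \<and> s = (h, C(X := fill (side * side) G (C X))))"
proof -
  let ?N = "side * side"
  define st where "st k G = (h(39 := int ?N - int k, X := int k), C(X := fill k G (C X)))" for k G
  define I where "I k s \<longleftrightarrow> (\<exists>G. (\<forall>z. G z \<in> {1, 2}) \<and> s = st k G)" for k and s :: mstate
  have 1: "tri (Seq (forv 38 (stride 39)) (reps 39 4 (stride 39))) (h, C) (40 * side ^ 2) (I 0)"
  proof -
    have "h X = 0" using h(1)[of X] X by simp
    \<comment> \<open>Before the first cell is written any table is consistent with the tape, so a
      constant one is a witness.\<close>
    then have "st 0 (\<lambda>_. 1) = (h(39 := int ?N), C)"
      using X by (auto simp: st_def fill_def fun_eq_iff)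
    then have "I 0 (h(39 := int ?N), C)" unfolding I_def by (intro exI[of _ "\<lambda>_. 1"]) simp
    moreover have "tri (Seq (forv 38 (stride 39)) (reps 39 4 (stride 39))) (h, C) (40 * side ^ 2)
        (\<lambda>s. s = (h(39 := int ?N), C))"
      by (rule ev_size[unfolded ev_def]) (use h in auto)
    ultimately show ?thesis by (auto elim: tri_mono)
  qed
  have body: "tri (Seq (Mv 39 (-1)) (Seq (Choose (Wr X 1) (Wr X 2)) (Mv X 1))) (st k G) 6 (I (Suc k))"
    if G: "\<And>z. G z \<in> {1, 2}" for k G
  proof -
    let ?h = "h(39 := int ?N - int (Suc k), X := int k)" and ?C = "C(X := fill k G (C X))"
    have w: "tri (Wr X a) (?h, ?C) 1 (\<lambda>s. \<exists>a\<in>{1, 2}. s = (?h, ?C(X := (?C X)(int k := a))))"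
      if "a \<in> {1, 2}" for a
      by (rule tri_Wr) (use that in auto)
    have c: "tri (Choose (Wr X 1) (Wr X 2)) (?h, ?C) (Suc 1)
        (\<lambda>s. \<exists>a\<in>{1, 2}. s = (?h, ?C(X := (?C X)(int k := a))))"
      by (rule tri_Choose; rule w) simp_all
    have m: "tri (Mv X 1) s 1 (I (Suc k))" if "\<exists>a\<in>{1, 2}. s = (?h, ?C(X := (?C X)(int k := a)))" for s
    proof -
      obtain a where a: "a \<in> {1, 2}" "s = (?h, ?C(X := (?C X)(int k := a)))" using \<open>\<exists>a\<in>_. _\<close> by blast
      have "(?C X)(int k := a) = fill (Suc k) (G(k := a)) (C X)"
        by (auto simp: fill_def fun_eq_iff nat_less_iff)
      moreover have "?h(X := ?h X + 1) = h(39 := int ?N - int (Suc k), X := int (Suc k))"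
        by (simp add: add.commute)
      ultimately have "(?h(X := ?h X + 1), ?C(X := (?C X)(int k := a))) = st (Suc k) (G(k := a))"
        by (simp add: st_def)
      moreover have "\<forall>z. (G(k := a)) z \<in> {1, 2}" using G a by simp
      ultimately have "I (Suc k) (?h(X := ?h X + 1), ?C(X := (?C X)(int k := a)))" unfolding I_def by metis
      then show ?thesis unfolding a(2) by (rule tri_Mv)
    qed
    have e: "(\<lambda>h'. h'(39 := h' 39 + - 1)) (fst (st k G)) = ?h" using X by (auto simp: st_def fun_eq_iff)
    have "tri (Mv 39 (-1)) (st k G) 1 (\<lambda>s. s = (?h, ?C))"
      using tri_Mv[of "\<lambda>s. s = (?h, ?C)" "fst (st k G)" 39 "-1" "snd (st k G)"] e by (simp add: st_def)
    then have "tri (Seq (Mv 39 (-1)) (Seq (Choose (Wr X 1) (Wr X 2)) (Mv X 1))) (st k G)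
        (Suc (1 + Suc (Suc 1 + 1))) (I (Suc k))"
      by (rule tri_Seq) (use tri_Seq[OF c m] in blast)
    then show ?thesis by (rule tri_mono) simp_all
  qed
  have 2: "tri (While 39 3 (Seq (Mv 39 (-1)) (Seq (Choose (Wr X 1) (Wr X 2)) (Mv X 1)))) s
      (Suc ((?N - 0) * Suc 6)) (I ?N)" if "I 0 s" for s
  proof (rule tri_While[where I = I])
    fix k s assume k: "k < ?N" and "I k s"
    then obtain G where G: "\<And>z. G z \<in> {1, 2}" "s = st k G" by (auto simp: I_def)
    have "int k < int ?N" using k by (simp only: of_nat_less_iff)
    then have "0 < int ?N - int k" by simp
    then have "reads (st k G) 39 \<noteq> 3"
      using counter(2)[of 39 "int ?N - int k"] X by (simp add: reads_def st_def)
    then show "reads s 39 \<noteq> 3 \<and> tri (Seq (Mv 39 (-1)) (Seq (Choose (Wr X 1) (Wr X 2)) (Mv X 1))) s 6 (I (Suc k))"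
      using body[of G k] G by simp
  next
    fix s assume "I ?N s"
    then obtain G where "s = st ?N G" by (auto simp: I_def)
    then show "reads s 39 = 3" using counter(1)[of 39] X by (simp add: reads_def st_def)
  qed (use that in auto)
  have 3: "tri (Seq (reset X) (Mv X 1)) s (2 * ?N + 5)
      (\<lambda>s. \<exists>G. (\<forall>z. G z \<in> {1, 2}) \<and> s = (h, C(X := fill ?N G (C X))))" if I: "I ?N s" for s
  proof -
    obtain G where G: "\<And>z. G z \<in> {1, 2}" and s: "s = st ?N G" using I by (auto simp: I_def)
    let ?C = "C(X := fill ?N G (C X))" and ?h = "h(39 := int ?N - int ?N, X := int ?N)"
    interpret l: layout ?C m by (rule layout_fill[OF X]) (rule G)
    have "ev ?C (reset X) ?h (Suc (nat (?h X - (-1)) * 2)) (?h(X := -1))"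
    proof (rule ev_reset)
      show "?C X (-1) = 3" by (rule l.work(1)[OF X(2)])
      show "?C X y \<noteq> 3" if "-1 < y" for y by (rule l.work(2)[OF X(2)]) (use that in simp)
      have "(0::int) \<le> int ?N" by (rule of_nat_0_le_iff)
      then show "-1 \<le> ?h X" by (simp del: of_nat_mult)
    qed
    from ev_Seq[OF this ev_Mv[of ?C X 1]]
    have "ev ?C (Seq (reset X) (Mv X 1)) ?h (Suc (Suc (nat (?h X - (-1)) * 2) + 1)) h"
    proof -
      have "?h(X := -1, X := (?h(X := -1)) X + 1) = h" using X h by (auto simp: fun_eq_iff)
      then show ?thesis using \<open>ev ?C (Seq (reset X) (Mv X 1)) ?h _ _\<close> by metis
    qed
    moreover have "nat (?h X - (-1)) = ?N + 1" by (simp add: nat_add_distrib nat_mult_distrib)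
    ultimately have "ev ?C (Seq (reset X) (Mv X 1)) ?h (2 * ?N + 5) h" by (simp add: algebra_simps)
    then show ?thesis unfolding ev_def s st_def by (rule tri_mono) (use G in auto)
  qed
  have "tri (guess X) (h, C) (Suc (40 * side ^ 2 + Suc (Suc ((?N - 0) * Suc 6) + (2 * ?N + 5))))
    (\<lambda>s. \<exists>G. (\<forall>z. G z \<in> {1, 2}) \<and> s = (h, C(X := fill ?N G (C X))))"
    unfolding guess_def by (rule tri_Seq[OF 1 tri_Seq[OF 2 3]])
  then show ?thesis
  proof (rule tri_mono)
    have "16 \<le> ?N" by (simp add: algebra_simps)
    then show "Suc (40 * side ^ 2 + Suc (Suc ((?N - 0) * Suc 6) + (2 * ?N + 5))) \<le> 100 * side ^ 2"
      unfolding power2_eq_square by simp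
  qed
qed

text \<open>Any prescribed table is the outcome of some run. The triple cannot yield this, because
  it only bounds the set of outcomes from above.\<close>

lemma reach_guess:
  assumes X: "1 \<le> X" "X \<le> 8" and h: "\<And>i. i \<le> 11 \<Longrightarrow> h i = 0" "h 38 = int m" "h 39 = 0"
    and G: "\<And>z. G z \<in> {1, 2}"
  shows "sstep\<^sup>*\<^sup>* (guess X # ps, (h, C)) (ps, (h, C(X := fill (side * side) G (C X))))"
proof -
  let ?N = "side * side"
  define st where "st k = (h(39 := int ?N - int k, X := int k), C(X := fill k G (C X)))" for k
  let ?W = "While 39 3 (Seq (Mv 39 (-1)) (Seq (Choose (Wr X 1) (Wr X 2)) (Mv X 1)))"
  let ?r = "Seq (reset X) (Mv X 1)"
  note trans = rtranclp_trans[of sstep] and step = converse_rtranclp_into_rtranclp[of sstep]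
  have "h X = 0" using h(1)[of X] X by simp
  then have st0: "st 0 = (h(39 := int ?N), C)"
    using X by (auto simp: st_def fill_def fun_eq_iff)
  have 1: "sstep\<^sup>*\<^sup>* (Seq (forv 38 (stride 39)) (reps 39 4 (stride 39)) # qs, (h, C)) (qs, st 0)" for qs
    unfolding st0 by (rule tri_reach[OF ev_size[of h, unfolded ev_def]]) (use h in auto)
  have body: "sstep\<^sup>*\<^sup>* (?W # qs, st k) (?W # qs, st (Suc k))" if "k < ?N" for k qs
  proof -
    have "int k < int ?N" using that by (simp only: of_nat_less_iff)
    then have "0 < int ?N - int k" by simp
    then have n3: "reads (st k) 39 \<noteq> 3"
      using counter(2)[of 39 "int ?N - int k"] X by (simp add: reads_def st_def)
    let ?h = "h(39 := int ?N - int (Suc k), X := int k)" and ?C = "C(X := fill k G (C X))"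
    let ?D = "?C(X := (?C X)(int k := G k))"
    have e1: "(fst (st k))(39 := fst (st k) 39 + - 1) = ?h" using X by (auto simp: st_def fun_eq_iff)
    have e2: "(?h(X := ?h X + 1), ?D) = st (Suc k)"
      by (auto simp: st_def fill_def fun_eq_iff nat_less_iff)
    let ?qs = "?W # qs"
    let ?CW = "Choose (Wr X 1) (Wr X 2)"
    have s1: "sstep (?qs, st k) (Seq (Mv 39 (-1)) (Seq ?CW (Mv X 1)) # ?qs, st k)" using n3 by simp
    have s2: "sstep (Seq (Mv 39 (-1)) (Seq ?CW (Mv X 1)) # ?qs, st k) (Mv 39 (-1) # Seq ?CW (Mv X 1) # ?qs, st k)" by simp
    have s3: "sstep (Mv 39 (-1) # Seq ?CW (Mv X 1) # ?qs, st k) (Seq ?CW (Mv X 1) # ?qs, (?h, ?C))"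
      using e1 by (simp add: st_def)
    have s4: "sstep (Seq ?CW (Mv X 1) # ?qs, (?h, ?C)) (?CW # Mv X 1 # ?qs, (?h, ?C))" by simp
    have s5: "sstep (?CW # Mv X 1 # ?qs, (?h, ?C)) (Wr X (G k) # Mv X 1 # ?qs, (?h, ?C))"
      using G[of k] by auto
    have s6: "sstep (Wr X (G k) # Mv X 1 # ?qs, (?h, ?C)) (Mv X 1 # ?qs, (?h, ?D))" by simp
    have s7: "sstep (Mv X 1 # ?qs, (?h, ?D)) (?qs, st (Suc k))" unfolding sstep_simps e2[symmetric] by simp
    show ?thesis
      by (rule step[OF s1 step[OF s2 step[OF s3 step[OF s4 step[OF s5 step[OF s6 r_into_rtranclp[of sstep, OF s7]]]]]]])
  qed
  have loop: "sstep\<^sup>*\<^sup>* (?W # qs, st 0) (?W # qs, st k)" if "k \<le> ?N" for k qs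
    using that
  proof (induction k)
    case (Suc k)
    then show ?case using trans[OF Suc.IH body[of k]] by simp
  qed simp
  have "reads (st ?N) 39 = 3" using counter(1)[of 39] X by (simp add: reads_def st_def)
  then have "sstep (?W # qs, st ?N) (qs, st ?N)" for qs by simp
  then have 2: "sstep\<^sup>*\<^sup>* (?W # qs, st 0) (qs, st ?N)" for qs
    using loop[of ?N qs] rtranclp.rtrancl_into_rtrancl[of sstep] by simp
  let ?C = "C(X := fill ?N G (C X))" and ?h = "h(39 := int ?N - int ?N, X := int ?N)"
  interpret l: layout ?C m by (rule layout_fill[OF X]) (rule G)
  have "?h(X := -1, X := (?h(X := -1)) X + 1) = h" using X h by (auto simp: fun_eq_iff)
  moreover have "ev ?C (reset X) ?h (Suc (nat (?h X - (-1)) * 2)) (?h(X := -1))"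
    proof (rule ev_reset)
      show "?C X (-1) = 3" by (rule l.work(1)[OF X(2)])
      show "?C X y \<noteq> 3" if "-1 < y" for y by (rule l.work(2)[OF X(2)]) (use that in simp)
      have "(0::int) \<le> int ?N" by (rule of_nat_0_le_iff)
      then show "-1 \<le> ?h X" by (simp del: of_nat_mult)
    qed
  ultimately have "\<exists>n. ev ?C ?r ?h n h" using ev_Seq[OF _ ev_Mv[of ?C X 1]] by metis
  then have 3: "sstep\<^sup>*\<^sup>* (?r # qs, st ?N) (qs, (h, ?C))" for qs
    using tri_reach unfolding ev_def st_def by blast
  have s1: "sstep (guess X # ps, (h, C)) (Seq (forv 38 (stride 39)) (reps 39 4 (stride 39)) # Seq ?W ?r # ps, (h, C))"
    by (simp add: guess_def)
  have s2: "sstep (Seq ?W ?r # ps, st 0) (?W # ?r # ps, st 0)" by simp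
  show ?thesis
    by (rule step[OF s1 trans[OF 1 step[OF s2 trans[OF 2 3]]]])
qed

end

section \<open>Guessing all relation tables\<close>

definition guesses :: "nat list \<Rightarrow> prog" where
  "guesses ks = each (\<lambda>k. guess (Suc k)) ks"

lemma tri_guesses:
  assumes "layout C m" "set ks \<subseteq> {..<8}"
    and h: "\<And>i. i \<le> 11 \<Longrightarrow> h i = 0" "h 38 = int m" "h 39 = 0"
  shows "tri (guesses ks) (h, C) (Suc (length ks * Suc (100 * (m + 4) ^ 2)))
    (\<lambda>s. \<exists>D. s = (h, D) \<and> layout D m \<and> (\<forall>i. i = 0 \<or> 8 < i \<longrightarrow> D i = C i))"
  using assms(1,2)
proof (induction ks arbitrary: C)
  case Nil
  have "tri (Mv 0 0) (h, C) 1 (\<lambda>s. s = (h, C))" using ev_Mv0[of C 0 h] by (simp add: ev_def)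
  then show ?case using Nil unfolding guesses_def by (auto elim: tri_mono)
next
  case (Cons k ks)
  let ?n = "100 * (m + 4) ^ 2"
  interpret layout C m by (rule Cons.prems)
  have 1: "tri (guess (Suc k)) (h, C) ?n
    (\<lambda>s. \<exists>G. (\<forall>z. G z \<in> {1, 2}) \<and> s = (h, C(Suc k := fill (side * side) G (C (Suc k)))))"
    by (rule tri_guess) (use Cons.prems h in auto)
  have 2: "tri (guesses ks) s (Suc (length ks * Suc ?n))
    (\<lambda>s. \<exists>D. s = (h, D) \<and> layout D m \<and> (\<forall>i. i = 0 \<or> 8 < i \<longrightarrow> D i = C i))"
    if ex: "\<exists>G. (\<forall>z. G z \<in> {1, 2}) \<and> s = (h, C(Suc k := fill (side * side) G (C (Suc k))))" for s
  proof -
    from ex obtain G where "(\<forall>z. G z \<in> {1, 2}) \<and> s = (h, C(Suc k := fill (side * side) G (C (Suc k))))"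
      by (rule exE)
    then have G: "\<And>z. G z \<in> {1, 2}" and s: "s = (h, C(Suc k := fill (side * side) G (C (Suc k))))"
      by blast+
    have k: "k < 8" using Cons.prems by simp
    have "layout (C(Suc k := fill (side * side) G (C (Suc k)))) m"
      by (rule layout_fill[OF _ _ G]) (use k in auto)
    then have "tri (guesses ks) s (Suc (length ks * Suc ?n))
      (\<lambda>s'. \<exists>D. s' = (h, D) \<and> layout D m \<and>
        (\<forall>i. i = 0 \<or> 8 < i \<longrightarrow> D i = (C(Suc k := fill (side * side) G (C (Suc k)))) i))"
      unfolding s by (rule Cons.IH) (use Cons.prems(2) in simp)
    moreover have "(C(Suc k := c)) i = C i" if "i = 0 \<or> 8 < i" for c i using k that by auto
    ultimately show ?thesis by (elim tri_mono) simp_all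
  qed
  have "tri (guesses (k # ks)) (h, C) (Suc (?n + Suc (length ks * Suc ?n)))
    (\<lambda>s. \<exists>D. s = (h, D) \<and> layout D m \<and> (\<forall>i. i = 0 \<or> 8 < i \<longrightarrow> D i = C i))"
    using tri_Seq[OF 1 2] by (simp add: guesses_def)
  then show ?case by (rule tri_mono) simp_all
qed

lemma reach_guesses:
  assumes "layout C m" "set ks \<subseteq> {..<8}" "distinct ks"
    and h: "\<And>i. i \<le> 11 \<Longrightarrow> h i = 0" "h 38 = int m" "h 39 = 0"
    and G: "\<And>k z. G k z \<in> {1, 2}"
  shows "\<exists>D. sstep\<^sup>*\<^sup>* (guesses ks # ps, (h, C)) (ps, (h, D)) \<and> layout D m \<and>
    (\<forall>i. i = 0 \<or> 8 < i \<longrightarrow> D i = C i) \<and>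
    (\<forall>k<8. D (Suc k) = (if k \<in> set ks then fill ((m + 4) * (m + 4)) (G k) (C (Suc k)) else C (Suc k)))"
  using assms(1-3)
proof (induction ks arbitrary: C)
  case Nil
  have "sstep (guesses [] # ps, (h, C)) (ps, (h, C))" by (simp add: guesses_def)
  then show ?case using Nil by auto
next
  case (Cons k ks)
  interpret layout C m by (rule Cons.prems)
  let ?C = "C(Suc k := fill (side * side) (G k) (C (Suc k)))"
  have k: "k < 8" using Cons.prems by simp
  have 1: "sstep\<^sup>*\<^sup>* (guess (Suc k) # qs, (h, C)) (qs, (h, ?C))" for qs
    by (rule reach_guess) (use k h G in auto)
  have "layout ?C m" by (rule layout_fill[OF _ _ G]) (use k in auto)
  moreover have "set ks \<subseteq> {..<8}" "distinct ks" using Cons.prems by simp_all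
  ultimately obtain D where
    D: "sstep\<^sup>*\<^sup>* (guesses ks # ps, (h, ?C)) (ps, (h, D))" "layout D m" "\<forall>i. i = 0 \<or> 8 < i \<longrightarrow> D i = ?C i"
      "\<forall>l<8. D (Suc l) = (if l \<in> set ks then fill (side * side) (G l) (?C (Suc l)) else ?C (Suc l))"
    using Cons.IH[of ?C] by metis
  have "sstep (guesses (k # ks) # ps, (h, C)) (guess (Suc k) # guesses ks # ps, (h, C))"
    by (simp add: guesses_def)
  then have "sstep\<^sup>*\<^sup>* (guesses (k # ks) # ps, (h, C)) (ps, (h, D))"
    using rtranclp_trans[OF 1 D(1)] converse_rtranclp_into_rtranclp[of sstep] by blast
  moreover have "\<forall>i. i = 0 \<or> 8 < i \<longrightarrow> D i = C i" using D(3) k by auto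
  moreover have "\<forall>l<8. D (Suc l) = (if l \<in> set (k # ks) then fill (side * side) (G l) (C (Suc l)) else C (Suc l))"
    using D(4) Cons.prems(3) by auto
  ultimately show ?case using D(2) by blast
qed

subsection \<open>The decision procedure\<close>

definition machine :: prog where
  "machine = Seq (each mark [0..<40]) (Seq powers (Seq (each limit range_tapes)
     (Seq (guesses [0..<8]) (comp separated_fo))))"

lemma wfp_each: "\<lbrakk>0 < K; \<And>i. i \<in> set is \<Longrightarrow> wfp K A (f i)\<rbrakk> \<Longrightarrow> wfp K A (each f is)"
  by (induction "is") auto

lemma wfp_reps: "\<lbrakk>X < K; wfp K A p\<rbrakk> \<Longrightarrow> wfp K A (reps X k p)"
  by (induction k) auto

lemma wfp_comp: "okf f \<Longrightarrow> wfp 40 5 (comp f)"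
  by (induction f) (auto simp: lookup_def goto_def forv_def stride_def reset_def intro!: wfp_reps)

lemma wfp_machine: "wfp 40 5 machine"
proof -
  have "wfp 40 5 (guess (Suc k))" if "k < 8" for k
    using that by (auto simp: guess_def forv_def stride_def reset_def intro!: wfp_reps)
  moreover have "wfp 40 5 (limit i)" if "i < 36" for i
    using that by (auto simp: limit_def forv_def reset_def)
  ultimately show ?thesis
    unfolding machine_def guesses_def wfp.simps
    by (intro conjI wfp_each wfp_comp okf_separated_fo)
      (use range_tapes(1) in \<open>auto simp: mark_def powers_def dbl_def reset_def\<close>)
qed

text \<open>Quantified values are below \<open>m\<close> and offsets at most 3, so a table of side
  \<open>m + 4\<close> contains all that the sentence can inspect.\<close>

lemma sat_cong:
  assumes "okf f" "\<And>j. e j < m" "\<And>k u v. \<lbrakk>k < 8; u < m + 4; v < m + 4\<rbrakk> \<Longrightarrow> X k u v = Y k u v"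
  shows "sat inp X m e f = sat inp Y m e f"
  using assms(1,2)
proof (induction f arbitrary: e)
  case (Rel k u a v b)
  have "e u < m" "e v < m" using Rel by auto
  then show ?case using Rel.prems(1) assms(3)[of k "e u + a" "e v + b"] by simp
next
  case (Ex j f)
  have "sat inp X m (e(j := x)) f = sat inp Y m (e(j := x)) f" if "x < m" for x
    by (rule Ex.IH) (use Ex.prems that in auto)
  then show ?case by auto
qed auto

lemma sat_env:
  assumes "okf f" "\<And>j. j < 12 \<Longrightarrow> e j = e' j"
  shows "sat inp X m e f = sat inp X m e' f"
  using assms
proof (induction f arbitrary: e e')
  case (Ex j f)
  have "sat inp X m (e(j := x)) f = sat inp X m (e'(j := x)) f" for x
    by (rule Ex.IH) (use Ex.prems in auto)
  then show ?case by simp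
next
  case (Not f)
  have "sat inp X m e f = sat inp X m e' f" by (rule Not.IH) (use Not.prems in auto)
  then show ?case by simp
next
  case (Conj f g)
  have "sat inp X m e f = sat inp X m e' f" by (rule Conj.IH) (use Conj.prems in auto)
  moreover have "sat inp X m e g = sat inp X m e' g" by (rule Conj.IH) (use Conj.prems in auto)
  ultimately show ?case by simp
qed simp_all

section \<open>Correctness and running time of the machine\<close>

definition machine_time :: "nat \<Rightarrow> nat" where
  "machine_time m = 241 + 200 * m ^ 2 + (1 + 13 * Suc (12 * m + 10)) +
     Suc (8 * Suc (100 * (m + 4) ^ 2)) + comp_time m separated_fo + 4"

lemma tower_pos: "0 < tower k"
  by simp

context
  fixes w :: "bool list"
begin

abbreviation "msize \<equiv> tower (length w)"
abbreviation "start_heads \<equiv> (\<lambda>_. 0)(38 := int msize) :: nat \<Rightarrow> int"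

lemma ev_check:
  assumes D: "layout D msize" "D 0 = limited w 0"
  shows "ev D (comp separated_fo) start_heads (comp_time msize separated_fo)
    (start_heads(9 := if sat (word.sym w) (layout.rel D msize) msize (\<lambda>_. 0) separated_fo then 1 else 0))"
proof -
  interpret layout D msize by (rule D)
  interpret word w .
  have "limited w 0 (int z) = sym z" for z
    using range_tapes(1)[of 0]
    by (auto simp: limited_def marked_def input_state_def input_tape_def sym_def)
  then have inp: "inp = sym" by (simp add: inp_def fun_eq_iff D(2))
  have "clean start_heads" using tower_pos by (auto simp: clean_def)
  moreover have "start_heads (vart j) = 0 \<and> start_heads (acct j) = 0" if "j \<in> qvars separated_fo" for j
  proof -
    have "j < 12" using that qvars_separated_fo by auto
    then show ?thesis by auto
  qed
  ultimately have e: "ev D (comp separated_fo) start_heads (comp_time msize separated_fo)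
    (start_heads(9 := if sat inp rel msize (\<lambda>j. nat (start_heads (vart j))) separated_fo then 1 else 0))"
    by (intro ev_comp okf_separated_fo)
  have "sat inp rel msize (\<lambda>j. nat (start_heads (vart j))) separated_fo = sat inp rel msize (\<lambda>_. 0) separated_fo"
    by (rule sat_env[OF okf_separated_fo]) auto
  then show ?thesis using e unfolding inp by simp
qed

lemma counter_9: "limited w 9 0 = 3" "limited w 9 1 = 0"
  using range_tapes(1)[of 9] by (auto simp: limited_def marked_def input_state_def)

text \<open>Flag value 1 puts head 9 on a blank, flag value 0 on the marker 3; so reading a blank
  means that the sentence was found true.\<close>

definition accepts :: "mstate \<Rightarrow> bool" where
  "accepts s \<longleftrightarrow> reads s 9 = 0"

lemma accepts_check:
  assumes "D 9 = limited w 9"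
  shows "accepts (start_heads(9 := if b then 1 else 0), D) \<longleftrightarrow> b"
  using counter_9 assms by (simp add: accepts_def reads_def)

text \<open>The postcondition of all runs expresses soundness only, as a wrong guess may be
  rejected. Completeness is \<open>reach_machine\<close>.\<close>

definition correct :: "mstate \<Rightarrow> bool" where
  "correct s \<longleftrightarrow> (accepts s \<longrightarrow> (\<exists>X. sat (word.sym w) X msize (\<lambda>_. 0) separated_fo))"

lemma tri_machine: "tri machine (input_state w) (machine_time msize) correct"
proof -
  let ?h = start_heads
  have 1: "tri (each mark [0..<40]) (input_state w) 241 (\<lambda>s. s = (\<lambda>_. 0, marked w))"
    using evs_marks unfolding evs_def .
  have 2: "tri powers s (200 * msize ^ 2) (\<lambda>s. s = (?h, marked w))" if "s = (\<lambda>_. 0, marked w)" for s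
    using ev_powers unfolding ev_def that .
  have 3: "tri (each limit range_tapes) s (Suc (13 * Suc (12 * msize + 10))) (\<lambda>s. s = (?h, limited w))"
    if "s = (?h, marked w)" for s
    using evs_limits unfolding evs_def that .
  have 4: "tri (guesses [0..<8]) s (Suc (8 * Suc (100 * (msize + 4) ^ 2)))
    (\<lambda>s. \<exists>D. s = (?h, D) \<and> layout D msize \<and> (\<forall>i. i = 0 \<or> 8 < i \<longrightarrow> D i = limited w i))"
    if "s = (?h, limited w)" for s
  proof -
    have "tri (guesses [0..<8]) (?h, limited w) (Suc (length [0..<8] * Suc (100 * (msize + 4) ^ 2)))
      (\<lambda>s. \<exists>D. s = (?h, D) \<and> layout D msize \<and> (\<forall>i. i = 0 \<or> 8 < i \<longrightarrow> D i = limited w i))"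
      by (rule tri_guesses[OF layout_limited]) auto
    then show ?thesis unfolding that by (simp only: length_upt diff_zero)
  qed
  have 5: "tri (comp separated_fo) s (comp_time msize separated_fo) correct"
    if s: "\<exists>D. s = (?h, D) \<and> layout D msize \<and> (\<forall>i. i = 0 \<or> 8 < i \<longrightarrow> D i = limited w i)" for s
  proof -
    obtain D where D: "s = (?h, D)" "layout D msize" "D 0 = limited w 0" "D 9 = limited w 9" using s by auto
    show ?thesis
      using ev_check[OF D(2,3)] unfolding ev_def D(1)
    proof (rule tri_mono)
      fix s assume s: "s = (?h(9 := if sat (word.sym w) (layout.rel D msize) msize (\<lambda>_. 0) separated_fo then 1 else 0), D)"
      show "correct s"
        unfolding correct_def s accepts_check[where D = D, OF D(4)] by blast
    qed simp
  qed
  have "tri machine (input_state w) (Suc (241 + Suc (200 * msize ^ 2 + Suc (Suc (13 * Suc (12 * msize + 10)) +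
      Suc (Suc (8 * Suc (100 * (msize + 4) ^ 2)) + comp_time msize separated_fo))))) correct"
    unfolding machine_def by (rule tri_Seq[OF 1 tri_Seq[OF 2 tri_Seq[OF 3 tri_Seq[OF 4 5]]]])
  then show ?thesis by (rule tri_mono) (simp_all add: machine_time_def)
qed

lemma reach_machine:
  assumes X: "sat (word.sym w) X msize (\<lambda>_. 0) separated_fo"
  shows "\<exists>s. sstep\<^sup>*\<^sup>* ([machine], input_state w) ([], s) \<and> accepts s"
proof -
  let ?h = start_heads and ?S = "msize + 4"
  note trans = rtranclp_trans[of sstep] and step = converse_rtranclp_into_rtranclp[of sstep]
  \<comment> \<open>The tables to be guessed: the relations of \<open>X\<close> written row by row,
    with 2 for true and 1 for false.\<close>
  define G :: "nat \<Rightarrow> nat \<Rightarrow> nat" where "G k z = (if X k (z div ?S) (z mod ?S) then 2 else 1)" for k z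
  have "\<exists>D. sstep\<^sup>*\<^sup>* (guesses [0..<8] # [comp separated_fo], (?h, limited w)) ([comp separated_fo], (?h, D)) \<and>
      layout D msize \<and> (\<forall>i. i = 0 \<or> 8 < i \<longrightarrow> D i = limited w i) \<and>
      (\<forall>k<8. D (Suc k) = (if k \<in> set [0..<8] then fill (?S * ?S) (G k) (limited w (Suc k)) else limited w (Suc k)))"
    by (rule reach_guesses[OF layout_limited]) (auto simp: G_def)
  then obtain D where D: "sstep\<^sup>*\<^sup>* (guesses [0..<8] # [comp separated_fo], (?h, limited w)) ([comp separated_fo], (?h, D))"
    "layout D msize" "D 0 = limited w 0" "D 9 = limited w 9"
    and Dk: "\<And>k. k < 8 \<Longrightarrow> D (Suc k) = fill (?S * ?S) (G k) (limited w (Suc k))"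
    by auto
  interpret layout D msize by (rule D(2))
  have "rel k u v = X k u v" if k: "k < 8" and uv: "u < ?S" "v < ?S" for k u v
  proof -
    have "u * ?S + v < Suc u * ?S" using uv by simp
    also have "\<dots> \<le> ?S * ?S" using uv by (intro mult_le_mono1) simp
    finally have "u * ?S + v < ?S * ?S" .
    then have "int (u * ?S + v) < int (?S * ?S)" by (simp only: of_nat_less_iff)
    then have "D (Suc k) (int (u * ?S + v)) = G k (u * ?S + v)"
      unfolding Dk[OF k] fill_def by (simp del: of_nat_add of_nat_mult)
    moreover have "(u * ?S + v) div ?S = u" "(u * ?S + v) mod ?S = v" using uv(2) by simp_all
    ultimately show ?thesis unfolding rel_def by (simp add: G_def)
  qed
  then have "sat (word.sym w) rel msize (\<lambda>_. 0) separated_fo"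
    using sat_cong[OF okf_separated_fo, of "\<lambda>_. 0" msize rel X] X tower_pos by blast
  then have "ev D (comp separated_fo) ?h (comp_time msize separated_fo) (?h(9 := 1))"
    using ev_check[OF D(2,3)] by simp
  then have 5: "sstep\<^sup>*\<^sup>* ([comp separated_fo], (?h, D)) ([], (?h(9 := 1), D))"
    unfolding ev_def by (rule tri_reach)
  have 1: "sstep\<^sup>*\<^sup>* (each mark [0..<40] # qs, input_state w) (qs, (\<lambda>_. 0, marked w))" for qs
    using evs_marks tri_reach unfolding evs_def by blast
  have 2: "sstep\<^sup>*\<^sup>* (powers # qs, (\<lambda>_. 0, marked w)) (qs, (?h, marked w))" for qs
    using ev_powers tri_reach unfolding ev_def by blast
  have 3: "sstep\<^sup>*\<^sup>* (each limit range_tapes # qs, (?h, marked w)) (qs, (?h, limited w))" for qs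
    using evs_limits tri_reach unfolding evs_def by blast
  have s: "sstep\<^sup>*\<^sup>* (Seq p q # qs, s) c" if "sstep\<^sup>*\<^sup>* (p # q # qs, s) c" for p q qs s c
    by (rule step[OF _ that]) simp
  have "sstep\<^sup>*\<^sup>* ([machine], input_state w) ([], (?h(9 := 1), D))"
    unfolding machine_def
    by (rule s[OF trans[OF 1 s[OF trans[OF 2 s[OF trans[OF 3 s[OF trans[OF D(1) 5]]]]]]]])
  moreover have "accepts (?h(9 := 1), D)" using accepts_check[where D = D and b = True, OF D(4)] by simp
  ultimately show ?thesis by blast
qed

end

subsection \<open>Bounds\<close>

text \<open>With \<open>b = 2 ^ s\<close>, \<open>?q = b * b\<close> and \<open>a = 2 ^ ?q\<close>
  the bound has an exponent of at most \<open>4 * (b * a)\<close>, which is 2 to the power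
  \<open>2 + s + ?q\<close>. This power is at most \<open>b * ?q = 2 ^ (3 * s)\<close>, and three
  symbols of input per subformula bring it below \<open>2 ^ n\<close>.\<close>

lemma point_bound_tower:
  assumes "1 \<le> s" "3 * s \<le> n"
  shows "point_bound s \<le> tower n"
proof -
  let ?q = "2 ^ s * 2 ^ s :: nat"
  define a where "a = (2::nat) ^ ?q"
  define b where "b = (2::nat) ^ s"
  have ab: "2 \<le> b" "?q \<le> a" "s \<le> b" "1 \<le> a"
    using assms(1) le_self_power power_increasing[of 1 s "2::nat"] by (simp_all add: a_def b_def)
  have "point_bound s = 2 ^ (a * 2 + (b * a + (s + ?q)))"
    by (simp add: point_bound_def a_def b_def power_add)
  also have "\<dots> \<le> 2 ^ (4 * (b * a))"
  proof (rule power_increasing)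
    have "a * 2 \<le> b * a" "a \<le> b * a" "b \<le> b * a" using ab by simp_all
    then show "a * 2 + (b * a + (s + ?q)) \<le> 4 * (b * a)" using ab by linarith
  qed simp
  also have "4 * (b * a) = 2 ^ (2 + s + ?q)" by (simp add: a_def b_def power_add)
  also have "(2::nat) ^ (2 ^ (2 + s + ?q)) \<le> tower n"
  proof (intro power_increasing)
    have "2 + s \<le> ?q"
    proof -
      have "Suc s \<le> b" unfolding b_def by (induction s) auto
      moreover have "2 * b \<le> b * b" using ab by simp
      ultimately show ?thesis using ab unfolding b_def[symmetric] by linarith
    qed
    then have "2 + s + ?q \<le> b * ?q" using mult_le_mono1[OF ab(1), of ?q] by linarith
    also have "b * ?q = 2 ^ (3 * s)" by (simp add: b_def power_add[symmetric] eval_nat_numeral)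
    also have "\<dots> \<le> 2 ^ n" using assms(2) by (simp add: power_increasing)
    finally show "2 + s + ?q \<le> 2 ^ n" .
  qed simp_all
  finally show ?thesis .
qed

text \<open>This is the margin that the recursion equations of the parse need for their
  offsets.\<close>

lemma tower_ge: "n + 3 \<le> tower n"
proof -
  have "n + 3 \<le> 2 ^ (n + 2)" by (induction n) auto
  moreover have "n + 2 \<le> 2 ^ (2 ^ n)"
  proof (induction n)
    case (Suc n)
    have "(2::nat) ^ (2 ^ Suc n) = 2 ^ (2 ^ n) * 2 ^ (2 ^ n)" by (simp add: power_add[symmetric] mult_2)
    moreover have "2 ^ 1 \<le> (2::nat) ^ (2 ^ n)" by (intro power_increasing) simp_all
    then have "2 * 2 ^ (2 ^ n) \<le> 2 ^ (2 ^ n) * (2 ^ (2 ^ n) :: nat)" by (intro mult_le_mono1) simp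
    ultimately show ?case using Suc by linarith
  qed simp
  then have "(2::nat) ^ (n + 2) \<le> tower n" by (intro power_increasing) simp_all
  ultimately show ?thesis by linarith
qed

text \<open>A factor \<open>e\<close> in the exponent of the tower is at most \<open>2 ^ e\<close>;
  one level further up this is an additive \<open>e\<close>, which the top exponent
  \<open>n + e\<close> absorbs. Polynomial overhead in the tower thus costs only a constant at the
  top.\<close>

lemma tower_power: "tower n ^ e \<le> tower (n + e)"
proof (cases "e = 0")
  case False
  have "e * 2 ^ (2 ^ n) \<le> 2 ^ (e + 2 ^ n)" by (simp add: power_add le_self_power)
  also have "\<dots> \<le> 2 ^ (2 ^ (n + e))"
  proof (rule power_increasing)
    have "Suc e \<le> 2 ^ e" by (induction e) auto
    then have "2 ^ n * Suc e \<le> 2 ^ n * 2 ^ e" by (rule mult_le_mono2)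
    moreover have "e + 2 ^ n \<le> 2 ^ n * Suc e" by simp
    ultimately show "e + 2 ^ n \<le> 2 ^ (n + e)" unfolding power_add by (rule order_trans[rotated])
  qed simp
  finally show ?thesis by (simp add: power_mult[symmetric] mult.commute power_increasing)
qed simp

lemma machine_time_poly: "\<exists>c e. \<forall>m\<ge>4. Suc (machine_time m) \<le> c * m ^ e"
proof -
  obtain c d where cd: "\<And>m. comp_time m separated_fo \<le> c * (m + 4) ^ d"
    using comp_time_poly by blast
  \<comment> \<open>Passing to \<open>m ^ 2\<close> absorbs the shift in \<open>m + 4\<close>, which
    it dominates from \<open>m = 4\<close> on, and the exponent \<open>d + 2\<close> serves all
    summands at once.\<close>
  have "Suc (machine_time m) \<le> (10000 + c) * (m ^ 2) ^ (d + 2)" if m: "4 \<le> m" for m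
  proof -
    let ?y = "m ^ 2"
    have "m * 4 \<le> ?y" using m by (simp add: power2_eq_square)
    then have y: "m + 4 \<le> ?y" "1 \<le> ?y" using m by linarith+
    have p: "(m + 4) ^ d \<le> ?y ^ (d + 2)" "(m + 4) ^ 2 \<le> ?y ^ (d + 2)" "?y \<le> ?y ^ (d + 2)"
    proof -
      show "(m + 4) ^ d \<le> ?y ^ (d + 2)"
        by (rule order_trans[OF power_mono[OF y(1)] power_increasing[OF _ y(2)]]) simp_all
      show "(m + 4) ^ 2 \<le> ?y ^ (d + 2)"
        by (rule order_trans[OF power_mono[OF y(1)] power_increasing[OF _ y(2)]]) simp_all
      show "?y \<le> ?y ^ (d + 2)"
        using power_increasing[OF _ y(2), of 1 "d + 2"] by (simp only: power_one_right)
    qed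
    define Z where "Z = ?y ^ (d + 2)"
    have "c * (m + 4) ^ d \<le> c * Z" using p(1) unfolding Z_def by (rule mult_le_mono2)
    then have "comp_time m separated_fo \<le> c * Z" using cd le_trans by blast
    moreover have "(m + 4) ^ 2 \<le> Z" "?y \<le> Z" "m + 4 \<le> Z" using p y(1) unfolding Z_def by linarith+
    ultimately have "Suc (machine_time m) \<le> 10000 * Z + c * Z"
      unfolding machine_time_def by simp
    then show ?thesis unfolding Z_def by (simp add: add_mult_distrib)
  qed
  then show ?thesis by (metis power_mult)
qed

lemma time_bound:
  "\<exists>k d. \<forall>n. Suc (machine_time (tower n)) \<le> k * 2 ^ (2 ^ (2 ^ (n ^ d)))"
proof -
  obtain c e where ce: "\<And>m. 4 \<le> m \<Longrightarrow> Suc (machine_time m) \<le> c * m ^ e"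
    using machine_time_poly by blast
  have t: "Suc (machine_time (tower n)) \<le> c * tower (n + e)" for n
  proof -
    have "2 ^ 1 \<le> (2::nat) ^ (2 ^ n)" by (intro power_increasing) simp_all
    then have "2 ^ 2 \<le> tower n" by (intro power_increasing) simp_all
    then have "Suc (machine_time (tower n)) \<le> c * tower n ^ e" by (intro ce) simp
    also have "\<dots> \<le> c * tower (n + e)" by (intro mult_le_mono2 tower_power)
    finally show ?thesis .
  qed
  have mono: "tower a \<le> tower b" if "a \<le> b" for a b using that by (intro power_increasing) simp_all
  \<comment> \<open>For \<open>n \<ge> 2\<close> the sum \<open>n + e\<close> is at most
    \<open>n ^ (e + 2)\<close>. The constant factor \<open>tower (1 + e)\<close> takes care of the
    lengths 0 and 1, whose powers do not grow.\<close>
  have "Suc (machine_time (tower n)) \<le> (c * tower (1 + e)) * tower (n ^ (e + 2))" for n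
  proof (cases "n < 2")
    case True
    have "c * tower (n + e) \<le> c * tower (1 + e)" using True by (intro mult_le_mono2 mono) simp
    also have "\<dots> \<le> (c * tower (1 + e)) * tower (n ^ (e + 2))" using tower_pos[of "n ^ (e + 2)"] by simp
    finally show ?thesis using t[of n] by linarith
  next
    case False
    have "e \<le> 2 ^ e" by (rule le_self_power)
    have "n + e \<le> n * (1 + e)" using False by simp
    also have "\<dots> \<le> n * n ^ (e + 1)"
    proof (rule mult_le_mono2)
      have "1 + e \<le> 2 ^ (e + 1)" by (induction e) auto
      also have "\<dots> \<le> n ^ (e + 1)" using False by (intro power_mono) simp_all
      finally show "1 + e \<le> n ^ (e + 1)" .
    qed
    finally have "tower (n + e) \<le> tower (n ^ (e + 2))" by (intro mono) simp
    then have "c * tower (n + e) \<le> c * tower (n ^ (e + 2))" by (rule mult_le_mono2)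
    also have "\<dots> \<le> (c * tower (1 + e)) * tower (n ^ (e + 2))"
      using tower_pos[of "1 + e"] by (intro mult_le_mono1) simp
    finally show ?thesis using t[of n] by linarith
  qed
  then show ?thesis by blast
qed

lemma complement_iff:
  "w \<in> - interpolant_existence \<longleftrightarrow> (\<exists>X. sat (word.sym w) X (tower (length w)) (\<lambda>_. 0) separated_fo)"
proof -
  interpret word w .
  have "(\<exists>\<iota>. is_interpolant \<iota> \<phi> \<psi>) \<longleftrightarrow> \<not> separated (tower n) \<phi> \<psi>" if w: "w = enc \<phi> @ enc \<psi>" for \<phi> \<psi>
  proof (rule interpolant_iff_not_separated, rule point_bound_tower)
    let ?S = "subfms \<phi> \<union> subfms \<psi>"
    have "card ?S \<le> card (subfms \<phi>) + card (subfms \<psi>)" by (rule card_Un_le)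
    then show "3 * card ?S \<le> n" using card_subfms[of \<phi>] card_subfms[of \<psi>] unfolding w by simp
    have "?S \<noteq> {}" using subfms_self by blast
    then show "1 \<le> card ?S" by (simp add: Suc_le_eq card_gt_0_iff)
  qed
  then have "w \<in> interpolant_existence \<longleftrightarrow> (\<exists>\<phi> \<psi>. w = enc \<phi> @ enc \<psi> \<and> \<not> separated (tower n) \<phi> \<psi>)"
    unfolding interpolant_existence_def by blast
  then show ?thesis using separated_fo_iff[OF tower_ge] by simp
qed

theorem theorem3p11:
  shows "interpolant_existence \<in> coN3ExpTime"
proof -
  have safe: "safe (correct w) (machine_time (tower (length w))) ([machine], input_state w)" for w
    by (rule tri_safe[OF tri_machine])
  have "\<exists>M. wf_ntm M \<and> decides_in_time M (- interpolant_existence) (\<lambda>n. Suc (machine_time (tower n)))"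
  proof (rule compile[OF wfp_machine, of 9])
    show "n \<le> machine_time (tower (length w))" if "(sstep ^^ n) ([machine], input_state w) c" for w n c
      using safe_bound[OF safe that] .
    show "w \<in> - interpolant_existence \<longleftrightarrow>
        (\<exists>s. sstep\<^sup>*\<^sup>* ([machine], input_state w) ([], s) \<and> reads s 9 = 0)" for w
      unfolding complement_iff
      using reach_machine[of w] safe_final[OF _ safe[of w]] unfolding accepts_def correct_def by blast
  qed simp_all
  then obtain M where M: "wf_ntm M"
    "decides_in_time M (- interpolant_existence) (\<lambda>n. Suc (machine_time (tower n)))" by blast
  obtain k d where kd: "\<And>n. Suc (machine_time (tower n)) \<le> k * 2 ^ (2 ^ (2 ^ (n ^ d)))"
    using time_bound by blast
  then have "decides_in_time M (- interpolant_existence) (\<lambda>n. k * 2 ^ (2 ^ (2 ^ (n ^ d))))"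
    using M(2) unfolding decides_in_time_def by (meson le_trans)
  then have "- interpolant_existence \<in> NTIME (\<lambda>n. 2 ^ (2 ^ (2 ^ (n ^ d))))"
    using M(1) unfolding NTIME_def by blast
  then show ?thesis unfolding coN3ExpTime_def N3ExpTime_def by blast
qed

end
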